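(* Let $\mathcal G=(\mathrm V,\mathrm E)$ be a locally finite connected metric graph, and let $A:\mathcal G\to\mathbb R$ and $V:\mathcal G\to[1,+\infty)$ satisfy $A\in L^2_{\rm loc}(\mathcal G,\mathbb R)$ and $V\in L^1_{\rm loc}(\mathcal G,\mathbb R)$. Then there exists a unique self-adjoint operator $T$ (in $L^2(\mathcal G,\mathbb C)$) with domain $\operatorname{dom}(T)\subset H^1_A(\mathcal G,\mathbb C)$ such that $$Q(u,v)=(Tu,v)_2\quad\text{for every }u\in\operatorname{dom}(T),\ v\in H^1_A(\mathcal G,\mathbb C).$$
   Context: Each bounded edge $e$ is identified with $I_e=[0,\ell_e]$, $\ell_e>0$, each unbounded edge with $I_e=[0,+\infty)$; $\mathcal G$ carries the shortest-path metric. A connected metric graph is locally finite if $\mathrm E$ is at most countable and every bounded subset of $\mathcal G$ intersects at most finitely many edges. Functions $u:\mathcal G\to\mathbb C$ are identified with families $(u_e)_{e\in\mathrm E}$, $u_e:I_e\to\mathbb C$. $L^2(\mathcal G,\mathbb C)$ is the complex Hilbert space of families $(u_e)$ with $u_e\in L^2(I_e,\mathbb C)$ and $\sum_e\|u_e\|^2_{L^2(I_e)}<+\infty$, with inner product $(u,v)_2=\int_{\mathcal G}u\bar v\,dx$. $A\in L^2_{\rm loc}$, $V\in L^1_{\rm loc}$ mean $A\in L^2(B)$, $V\in L^1(B)$ for every bounded $B\subset\mathcal G$. $D_A=\frac1i\frac{d}{dx}-A(x)$ (edgewise, weak derivative) and $H^1_A(\mathcal G,\mathbb C)=\{u\in C(\mathcal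 G,\mathbb C): D_Au\in L^2(\mathcal G,\mathbb C),\ \int_{\mathcal G}V(x)|u|^2dx<+\infty\}$. The quadratic (sesquilinear) form $Q$ has domain $\operatorname{dom}(Q)=H^1_A(\mathcal G,\mathbb C)$ and is given by $Q(u,v)=\int_{\mathcal G}(D_Au\overline{D_Av}+V(x)u\bar v)\,dx$. *)

theory Defs
  imports "HOL-Analysis.Analysis"
begin

section \<open>Metric graphs\<close>

text \<open>
  Loops and parallel edges are allowed. An edge \<open>e\<close> is glued at the parameter \<open>0\<close> to the vertex
  \<open>tail G e\<close> and, if it is bounded, at the parameter \<open>len G e\<close> to the vertex \<open>head G e\<close>. An unbounded
  edge has \<open>len G e = \<infinity>\<close>; its \<open>head\<close> plays no role.
\<close>

record ('v, 'e) metric_graph =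
  verts :: "'v set"
  edges :: "'e set"
  tail :: "'e \<Rightarrow> 'v"
  head :: "'e \<Rightarrow> 'v"
  len :: "'e \<Rightarrow> ereal"

definition metric_graph :: "('v, 'e) metric_graph \<Rightarrow> bool" where
  "metric_graph G \<longleftrightarrow>
     (\<forall>e\<in>edges G. 0 < len G e \<and> tail G e \<in> verts G \<and> (len G e < \<infinity> \<longrightarrow> head G e \<in> verts G))"

definition edge_interval :: "('v, 'e) metric_graph \<Rightarrow> 'e \<Rightarrow> real set" where
  "edge_interval G e = {x. 0 \<le> x \<and> ereal x \<le> len G e}"

text \<open>
  The points of the glued space: a point is either a vertex or lies in the interior of exactly
  one edge.
\<close>

datatype ('v, 'e) point = Vertex 'v | Inner 'e real

definition points :: "('v, 'e) metric_graph \<Rightarrow> ('v, 'e) point set" where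
  "points G =
     Vertex ` verts G \<union> {Inner e x | e x. e \<in> edges G \<and> 0 < x \<and> ereal x < len G e}"

definition edge_point :: "('v, 'e) metric_graph \<Rightarrow> 'e \<Rightarrow> real \<Rightarrow> ('v, 'e) point" where
  "edge_point G e x =
     (if x = 0 then Vertex (tail G e)
      else if ereal x = len G e then Vertex (head G e)
      else Inner e x)"

text \<open>
  \<open>path_len G p q l\<close>: some path from \<open>p\<close> to \<open>q\<close> that is a finite concatenation of segments
  \<open>[s, t]\<close>, each inside one edge, has total length \<open>l\<close>.
\<close>

inductive path_len ::
    "('v, 'e) metric_graph \<Rightarrow> ('v, 'e) point \<Rightarrow> ('v, 'e) point \<Rightarrow> real \<Rightarrow> bool"
  for G where
  refl: "p \<in> points G \<Longrightarrow> path_len G p p 0"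
| step: "\<lbrakk>path_len G p (edge_point G e s) l; e \<in> edges G;
           s \<in> edge_interval G e; t \<in> edge_interval G e\<rbrakk>
         \<Longrightarrow> path_len G p (edge_point G e t) (l + \<bar>s - t\<bar>)"

definition connected_graph :: "('v, 'e) metric_graph \<Rightarrow> bool" where
  "connected_graph G \<longleftrightarrow> (\<forall>p\<in>points G. \<forall>q\<in>points G. \<exists>l. path_len G p q l)"

text \<open>
  The value \<open>0\<close> for pairs not joined by a path is a dummy: in a connected graph it occurs only
  outside \<open>points G\<close>. It keeps the function nonnegative and symmetric everywhere, as
  \<open>Metric_space\<close> requires.
\<close>

definition graph_dist ::
    "('v, 'e) metric_graph \<Rightarrow> ('v, 'e) point \<Rightarrow> ('v, 'e) point \<Rightarrow> real" where
  "graph_dist G p q = (if \<exists>l. path_len G p q l then Inf {l. path_len G p q l} else 0)"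

text \<open>
  Not stated through \<open>Metric_space.mbounded\<close>, since that \<open>graph_dist\<close> separates points is itself
  a consequence of local finiteness.
\<close>

definition bounded_part :: "('v, 'e) metric_graph \<Rightarrow> ('v, 'e) point set \<Rightarrow> bool" where
  "bounded_part G B \<longleftrightarrow>
     B \<subseteq> points G \<and> (\<exists>r. \<forall>p\<in>B. \<forall>q\<in>B. graph_dist G p q \<le> r)"

definition locally_finite_graph :: "('v, 'e) metric_graph \<Rightarrow> bool" where
  "locally_finite_graph G \<longleftrightarrow> countable (edges G) \<and>
     (\<forall>B. bounded_part G B \<longrightarrow>
        finite {e \<in> edges G. edge_point G e ` edge_interval G e \<inter> B \<noteq> {}})"


section \<open>Function spaces on a metric graph\<close>

text \<open>
  A function on the graph is given by the family of its restrictions to the edges; the values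
  \<open>u e x\<close> with \<open>e \<notin> edges G\<close> or \<open>x \<notin> edge_interval G e\<close> are irrelevant.
\<close>

type_synonym ('e, 'a) fam = "'e \<Rightarrow> real \<Rightarrow> 'a"

definition edge_trace ::
    "('v, 'e) metric_graph \<Rightarrow> ('v, 'e) point set \<Rightarrow> 'e \<Rightarrow> real set" where
  "edge_trace G B e = {x \<in> edge_interval G e. edge_point G e x \<in> B}"

definition measurable_part :: "('v, 'e) metric_graph \<Rightarrow> ('v, 'e) point set \<Rightarrow> bool" where
  "measurable_part G B \<longleftrightarrow> (\<forall>e\<in>edges G. edge_trace G B e \<in> sets lebesgue)"

definition L1_on ::
    "('v, 'e) metric_graph \<Rightarrow> ('v, 'e) point set
      \<Rightarrow> ('e, 'a::{banach, second_countable_topology}) fam \<Rightarrow> bool" where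
  "L1_on G B f \<longleftrightarrow>
     (\<forall>e\<in>edges G. set_integrable lebesgue (edge_trace G B e) (f e)) \<and>
     (\<lambda>e. LINT x:edge_trace G B e|lebesgue. norm (f e x)) summable_on edges G"

definition L2_on ::
    "('v, 'e) metric_graph \<Rightarrow> ('v, 'e) point set
      \<Rightarrow> ('e, 'a::{banach, second_countable_topology}) fam \<Rightarrow> bool" where
  "L2_on G B u \<longleftrightarrow>
     (\<forall>e\<in>edges G. set_borel_measurable lebesgue (edge_trace G B e) (u e)) \<and>
     L1_on G B (\<lambda>e x. (norm (u e x))\<^sup>2)"

definition L1_loc :: "('v, 'e) metric_graph \<Rightarrow> ('e, real) fam \<Rightarrow> bool" where
  "L1_loc G f \<longleftrightarrow> (\<forall>B. bounded_part G B \<and> measurable_part G B \<longrightarrow> L1_on G B f)"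

definition L2_loc :: "('v, 'e) metric_graph \<Rightarrow> ('e, real) fam \<Rightarrow> bool" where
  "L2_loc G f \<longleftrightarrow> (\<forall>B. bounded_part G B \<and> measurable_part G B \<longrightarrow> L2_on G B f)"

definition graph_integral :: "('v, 'e) metric_graph \<Rightarrow> ('e, complex) fam \<Rightarrow> complex" where
  "graph_integral G f = (\<Sum>\<^sub>\<infinity>e\<in>edges G. LINT x:edge_interval G e|lebesgue. f e x)"

definition continuous_fam :: "('v, 'e) metric_graph \<Rightarrow> ('e, complex) fam \<Rightarrow> bool" where
  "continuous_fam G u \<longleftrightarrow>
     (\<exists>g. continuous_map (Metric_space.mtopology (points G) (graph_dist G)) euclidean g \<and>
          (\<forall>e\<in>edges G. \<forall>x\<in>edge_interval G e. u e x = g (edge_point G e x)))"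


section \<open>The magnetic Sobolev space and the form \<open>Q\<close>\<close>

definition test_function :: "real set \<Rightarrow> (real \<Rightarrow> real) \<Rightarrow> bool" where
  "test_function S \<phi> \<longleftrightarrow>
     (\<forall>n x. (deriv ^^ n) \<phi> field_differentiable (at x)) \<and>
     compact (closure {x. \<phi> x \<noteq> 0}) \<and> closure {x. \<phi> x \<noteq> 0} \<subseteq> S"

definition locally_integrable :: "real set \<Rightarrow> (real \<Rightarrow> complex) \<Rightarrow> bool" where
  "locally_integrable S f \<longleftrightarrow> (\<forall>K. compact K \<and> K \<subseteq> S \<longrightarrow> set_integrable lebesgue K f)"

definition has_weak_deriv ::
    "real set \<Rightarrow> (real \<Rightarrow> complex) \<Rightarrow> (real \<Rightarrow> complex) \<Rightarrow> bool" where
  "has_weak_deriv S f g \<longleftrightarrow>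
     locally_integrable S f \<and> locally_integrable S g \<and>
     (\<forall>\<phi>. test_function S \<phi> \<longrightarrow>
        (LINT x:S|lebesgue. f x * of_real (deriv \<phi> x)) =
        - (LINT x:S|lebesgue. g x * of_real (\<phi> x)))"

definition weakly_differentiable :: "('v, 'e) metric_graph \<Rightarrow> ('e, complex) fam \<Rightarrow> bool" where
  "weakly_differentiable G u \<longleftrightarrow>
     (\<forall>e\<in>edges G. \<exists>g. has_weak_deriv (interior (edge_interval G e)) (u e) g)"

text \<open>The weak derivative is determined up to null sets only; one representative is chosen.\<close>

definition weak_deriv ::
    "('v, 'e) metric_graph \<Rightarrow> ('e, complex) fam \<Rightarrow> ('e, complex) fam" where
  "weak_deriv G u = (\<lambda>e. SOME g. has_weak_deriv (interior (edge_interval G e)) (u e) g)"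

definition mag_deriv ::
    "('v, 'e) metric_graph \<Rightarrow> ('e, real) fam \<Rightarrow> ('e, complex) fam \<Rightarrow> ('e, complex) fam" where
  "mag_deriv G A u = (\<lambda>e x. (1 / \<i>) * weak_deriv G u e x - of_real (A e x) * u e x)"

definition H1_mag ::
    "('v, 'e) metric_graph \<Rightarrow> ('e, real) fam \<Rightarrow> ('e, real) fam \<Rightarrow> ('e, complex) fam set" where
  "H1_mag G A V =
     {u. continuous_fam G u \<and> weakly_differentiable G u \<and>
         L2_on G (points G) (mag_deriv G A u) \<and>
         L1_on G (points G) (\<lambda>e x. V e x * (norm (u e x))\<^sup>2)}"

definition Q_form ::
    "('v, 'e) metric_graph \<Rightarrow> ('e, real) fam \<Rightarrow> ('e, real) fam
      \<Rightarrow> ('e, complex) fam \<Rightarrow> ('e, complex) fam \<Rightarrow> complex" where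
  "Q_form G A V u v =
     graph_integral G (\<lambda>e x. mag_deriv G A u e x * cnj (mag_deriv G A v e x)
                            + of_real (V e x) * u e x * cnj (v e x))"


section \<open>Unbounded operators in a complex inner product space\<close>

text \<open>The inner product is linear in its first argument.\<close>

record 'h cinner_space =
  vectors :: "'h set"
  vadd :: "'h \<Rightarrow> 'h \<Rightarrow> 'h"
  vscale :: "complex \<Rightarrow> 'h \<Rightarrow> 'h"
  vinner :: "'h \<Rightarrow> 'h \<Rightarrow> complex"

definition vdist :: "'h cinner_space \<Rightarrow> 'h \<Rightarrow> 'h \<Rightarrow> real" where
  "vdist H x y = (let d = vadd H x (vscale H (-1) y) in sqrt (Re (vinner H d d)))"

text \<open>An operator is a partial map, so that it carries its domain \<open>dom T\<close>.\<close>

definition linear_operator :: "'h cinner_space \<Rightarrow> ('h \<rightharpoonup> 'h) \<Rightarrow> bool" where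
  "linear_operator H T \<longleftrightarrow>
     dom T \<subseteq> vectors H \<and> ran T \<subseteq> vectors H \<and>
     (\<forall>u\<in>dom T. \<forall>v\<in>dom T. T (vadd H u v) = Some (vadd H (the (T u)) (the (T v)))) \<and>
     (\<forall>c. \<forall>u\<in>dom T. T (vscale H c u) = Some (vscale H c (the (T u))))"

definition densely_defined :: "'h cinner_space \<Rightarrow> ('h \<rightharpoonup> 'h) \<Rightarrow> bool" where
  "densely_defined H T \<longleftrightarrow> (\<forall>x\<in>vectors H. \<forall>\<epsilon>>0. \<exists>y\<in>dom T. vdist H x y < \<epsilon>)"

definition adjoint_rel :: "'h cinner_space \<Rightarrow> ('h \<rightharpoonup> 'h) \<Rightarrow> 'h \<Rightarrow> 'h \<Rightarrow> bool" where
  "adjoint_rel H T v w \<longleftrightarrow>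
     v \<in> vectors H \<and> w \<in> vectors H \<and>
     (\<forall>u\<in>dom T. vinner H (the (T u)) v = vinner H u w)"

definition adjoint_op :: "'h cinner_space \<Rightarrow> ('h \<rightharpoonup> 'h) \<Rightarrow> ('h \<rightharpoonup> 'h)" where
  "adjoint_op H T v =
     (if \<exists>w. adjoint_rel H T v w then Some (THE w. adjoint_rel H T v w) else None)"

definition self_adjoint :: "'h cinner_space \<Rightarrow> ('h \<rightharpoonup> 'h) \<Rightarrow> bool" where
  "self_adjoint H T \<longleftrightarrow>
     linear_operator H T \<and> densely_defined H T \<and> adjoint_op H T = T"


section \<open>The space \<open>L\<^sup>2\<close> of a metric graph\<close>

text \<open>Its vectors are classes of square-integrable families that agree almost everywhere.\<close>

definition L2_class :: "('v, 'e) metric_graph \<Rightarrow> ('e, complex) fam \<Rightarrow> ('e, complex) fam set" where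
  "L2_class G u =
     {w. L2_on G (points G) w \<and>
         (\<forall>e\<in>edges G. AE x in lebesgue. x \<in> edge_interval G e \<longrightarrow> w e x = u e x)}"

definition rep :: "('e, complex) fam set \<Rightarrow> ('e, complex) fam" where
  "rep a = (SOME w. w \<in> a)"

definition L2 :: "('v, 'e) metric_graph \<Rightarrow> ('e, complex) fam set cinner_space" where
  "L2 G =
     \<lparr>vectors = L2_class G ` {u. L2_on G (points G) u},
      vadd = (\<lambda>a b. L2_class G (\<lambda>e x. rep a e x + rep b e x)),
      vscale = (\<lambda>c a. L2_class G (\<lambda>e x. c * rep a e x)),
      vinner = (\<lambda>a b. graph_integral G (\<lambda>e x. rep a e x * cnj (rep b e x)))\<rparr>"

end

theory Submission
  imports Defs
begin

text \<open>
  The operator comes from the representation theorem for closed forms. Suppose that a Hermitian form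
  \<open>q\<close> on a subspace \<open>D\<close> of a Hilbert space \<open>H\<close> dominates the inner product, that \<open>D\<close> is complete for
  \<open>q\<close>, and that only \<open>0\<close> is orthogonal to \<open>D\<close>. By Riesz there is for every \<open>f\<close> a unique \<open>S f\<close> in \<open>D\<close>
  with \<open>q (S f) v = (f, v)\<close> for all \<open>v\<close> in \<open>D\<close>. The map \<open>S\<close> is injective and symmetric, so its inverse
  \<open>T\<close> is symmetric with range \<open>H\<close>, and such an operator is self-adjoint. An operator \<open>T'\<close> that represents
  \<open>q\<close> satisfies \<open>u = S (T' u)\<close>, hence is a restriction of \<open>T\<close>; if it is self-adjoint as well, taking
  adjoints reverses the inclusion. This is \<open>form_representation\<close>; the rest of the text verifies its
  hypotheses for \<open>Q\<close>.

  \<^emph>\<open>Completeness of \<open>L\<^sup>2\<close>.\<close> A family of functions on the edges is one function on the disjoint union of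
  the edge intervals, which carries a measure \<open>M\<close>. Then \<open>L\<^sup>2\<close> of the graph is \<open>L\<^sup>2\<close> of \<open>M\<close>, and
  \<open>Riesz_Fischer\<close> applies.

  \<^emph>\<open>Only \<open>0\<close> is orthogonal to the form domain.\<close> Since \<open>A\<^sup>2\<close> and \<open>V\<close> are locally integrable, every test
  function supported inside one edge lies in the form domain. A locally integrable function that is
  orthogonal to all of these vanishes almost everywhere.

  \<^emph>\<open>Completeness of the form domain.\<close> Let \<open>u\<^sub>n\<close> be Cauchy for \<open>Q\<close>. Then \<open>D\<^sub>A u\<^sub>n\<close> and \<open>\<surd>V u\<^sub>n\<close> are Cauchy
  in \<open>L\<^sup>2\<close>. Because \<open>u' = \<i> (D\<^sub>A u + A u)\<close> and \<open>A\<close> is locally square integrable, Hoelder's inequality bounds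
  the \<open>L\<^sup>1\<close> norm of \<open>u'\<close> on every bounded piece of an edge by the form norm of \<open>u\<close>; integrating \<open>u'\<close> gives
  a local bound on the supremum of \<open>|u|\<close> (\<open>Sobolev\<close>). Hence \<open>u\<^sub>n\<close> converges locally uniformly along each
  edge, the limit takes consistent values at the vertices, and the weak derivatives pass to the limit
  (\<open>H1_complete\<close>). For continuity on the graph itself, local finiteness is decisive: a small ball
  around a point is a star made of finitely many pieces of edges (\<open>star\<close>), so that continuity along
  every edge is the same as continuity for the graph metric (\<open>continuous_fam_iff\<close>).

  The bumps \<open>exp (- 1 / (n (x - a)) - 1 / (n (b - x)))\<close> on \<open>(a, b)\<close> serve all purposes on the line. As
  \<open>n\<close> grows they tend to the indicator function of \<open>(a, b)\<close>, while their derivatives tend to the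
  difference of the unit masses at \<open>a\<close> and \<open>b\<close>. The first limit gives the fundamental lemma of the
  calculus of variations, the second one shows that a continuous function is the integral of its
  weak derivative.
\<close>

section \<open>Operators associated with closed forms\<close>

text \<open>
  A form is given on a carrier set with its own addition and scalar multiplication, because vectors
  of \<^typ>\<open>'h cinner_space\<close> form a set, and because the inner product and the form domain share these
  operations. Identities between vectors enter only through the values of the form.
\<close>

locale pos_form =
  fixes D :: "'h set" and add :: "'h \<Rightarrow> 'h \<Rightarrow> 'h" and scale :: "complex \<Rightarrow> 'h \<Rightarrow> 'h"
    and q :: "'h \<Rightarrow> 'h \<Rightarrow> complex"
  assumes nonempty: "D \<noteq> {}"
    and add_in: "x \<in> D \<Longrightarrow> y \<in> D \<Longrightarrow> add x y \<in> D"
    and scale_in: "x \<in> D \<Longrightarrow> scale c x \<in> D"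
    and q_add: "x \<in> D \<Longrightarrow> y \<in> D \<Longrightarrow> z \<in> D \<Longrightarrow> q (add x y) z = q x z + q y z"
    and q_scale: "x \<in> D \<Longrightarrow> z \<in> D \<Longrightarrow> q (scale c x) z = c * q x z"
    and q_herm: "x \<in> D \<Longrightarrow> y \<in> D \<Longrightarrow> q y x = cnj (q x y)"
    and q_pos: "x \<in> D \<Longrightarrow> 0 \<le> Re (q x x)"
begin

definition diff :: "'h \<Rightarrow> 'h \<Rightarrow> 'h" where
  "diff x y = add x (scale (-1) y)"

lemma diff_in: "x \<in> D \<Longrightarrow> y \<in> D \<Longrightarrow> diff x y \<in> D"
  by (simp add: diff_def add_in scale_in)

lemma q_add_right: "x \<in> D \<Longrightarrow> y \<in> D \<Longrightarrow> z \<in> D \<Longrightarrow> q z (add x y) = q z x + q z y"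
  by (metis add_in complex_cnj_add q_add q_herm)

lemma q_scale_right: "x \<in> D \<Longrightarrow> z \<in> D \<Longrightarrow> q z (scale c x) = cnj c * q z x"
  by (metis complex_cnj_mult q_herm q_scale scale_in)

lemma q_diff: "x \<in> D \<Longrightarrow> y \<in> D \<Longrightarrow> z \<in> D \<Longrightarrow> q (diff x y) z = q x z - q y z"
  by (simp add: diff_def q_add q_scale scale_in)

lemma q_diff_right: "x \<in> D \<Longrightarrow> y \<in> D \<Longrightarrow> z \<in> D \<Longrightarrow> q z (diff x y) = q z x - q z y"
  by (simp add: diff_def q_add_right q_scale_right scale_in)

lemma Im_q_self: "x \<in> D \<Longrightarrow> Im (q x x) = 0"
  by (metis Reals_cnj_iff complex_is_Real_iff q_herm)

lemma q_self: "x \<in> D \<Longrightarrow> q x x = complex_of_real (Re (q x x))"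
  by (simp add: Im_q_self complex_eq_iff)

lemma q_add_scale_self:
  assumes "x \<in> D" "y \<in> D"
  shows "Re (q (add x (scale c y)) (add x (scale c y)))
       = Re (q x x) + 2 * Re (c * q y x) + (cmod c)\<^sup>2 * Re (q y y)"
proof -
  have "q (add x (scale c y)) (add x (scale c y))
      = q x x + c * q y x + cnj c * q x y + c * cnj c * q y y"
    using assms by (simp add: q_add q_add_right q_scale q_scale_right add_in scale_in algebra_simps)
  moreover have "cnj c * q x y = cnj (c * q y x)"
    using assms q_herm[of y x] by simp
  moreover have "c * cnj c * q y y = complex_of_real ((cmod c)\<^sup>2 * Re (q y y))"
    using q_self[OF assms(2)] complex_norm_square[of c] by (metis of_real_mult)
  ultimately show ?thesis by simp
qed

text \<open>
  The form may be degenerate, so the case \<open>q y y = 0\<close> is separate: there \<open>q (x + c y) (x + c y)\<close> is affine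
  in \<open>c\<close> and bounded below, hence constant.
\<close>

lemma Cauchy_Schwarz:
  assumes "x \<in> D" "y \<in> D"
  shows "(cmod (q x y))\<^sup>2 \<le> Re (q x x) * Re (q y y)"
proof -
  let ?a = "Re (q x x)" and ?b = "Re (q y y)" and ?w = "q x y"
  have yx: "q y x = cnj ?w" using assms q_herm by blast
  have key: "0 \<le> ?a + 2 * (t * (cmod ?w)\<^sup>2) + t\<^sup>2 * (cmod ?w)\<^sup>2 * ?b" for t
  proof -
    have "0 \<le> Re (q (add x (scale (of_real t * ?w) y)) (add x (scale (of_real t * ?w) y)))"
      using assms q_pos add_in scale_in by blast
    also have "\<dots> = ?a + 2 * Re (of_real t * ?w * cnj ?w) + (cmod (of_real t * ?w))\<^sup>2 * ?b"
      by (simp add: q_add_scale_self assms yx)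
    also have "of_real t * ?w * cnj ?w = complex_of_real (t * (cmod ?w)\<^sup>2)"
      using complex_norm_square[of ?w] by (metis mult.assoc of_real_mult)
    finally show ?thesis by (simp add: norm_mult power_mult_distrib)
  qed
  show ?thesis
  proof (cases "?w = 0")
    case True then show ?thesis using assms q_pos by (simp add: mult_nonneg_nonneg)
  next
    case False
    then have W: "0 < (cmod ?w)\<^sup>2" by simp
    have a: "0 \<le> ?a" and b: "0 \<le> ?b" using assms q_pos by auto
    show ?thesis
    proof (cases "?b = 0")
      case True
      have "0 \<le> ?a + 2 * ((- (?a + 1) / (cmod ?w)\<^sup>2) * (cmod ?w)\<^sup>2)"
        using key[of "- (?a + 1) / (cmod ?w)\<^sup>2"] True by simp
      moreover have "(- (?a + 1) / (cmod ?w)\<^sup>2) * (cmod ?w)\<^sup>2 = - (?a + 1)"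
        using W by simp
      ultimately show ?thesis using a by linarith
    next
      case False
      then have b: "0 < ?b" using b by simp
      have "0 \<le> ?a + 2 * ((- 1 / ?b) * (cmod ?w)\<^sup>2) + (- 1 / ?b)\<^sup>2 * (cmod ?w)\<^sup>2 * ?b"
        by (rule key)
      also have "\<dots> = ?a - (cmod ?w)\<^sup>2 / ?b"
        using b by (simp add: field_simps power2_eq_square)
      finally show ?thesis using b by (simp add: field_simps)
    qed
  qed
qed

definition complete_form :: bool where
  "complete_form \<longleftrightarrow>
     (\<forall>s. (\<forall>n. s n \<in> D) \<longrightarrow>
          (\<forall>\<epsilon>>0. \<exists>N. \<forall>m\<ge>N. \<forall>n\<ge>N. Re (q (diff (s m) (s n)) (diff (s m) (s n))) < \<epsilon>) \<longrightarrow>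
          (\<exists>x\<in>D. (\<lambda>n. Re (q (diff (s n) x) (diff (s n) x))) \<longlonglongrightarrow> 0))"

lemma q_tendsto:
  assumes "\<And>n. s n \<in> D" "z \<in> D" "v \<in> D"
    and lim: "(\<lambda>n. Re (q (diff (s n) z) (diff (s n) z))) \<longlonglongrightarrow> 0"
  shows "(\<lambda>n. q v (s n)) \<longlonglongrightarrow> q v z"
proof -
  have bd: "(cmod (q v (s n) - q v z))\<^sup>2 \<le> Re (q v v) * Re (q (diff (s n) z) (diff (s n) z))" for n
    using Cauchy_Schwarz[of v "diff (s n) z"] assms by (simp add: q_diff_right diff_in)
  have "(\<lambda>n. Re (q v v) * Re (q (diff (s n) z) (diff (s n) z))) \<longlonglongrightarrow> Re (q v v) * 0"
    by (rule tendsto_mult_left[OF lim])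
  then have "(\<lambda>n. (cmod (q v (s n) - q v z))\<^sup>2) \<longlonglongrightarrow> Re (q v v) * 0"
    by (rule tendsto_sandwich[where f = "\<lambda>_. 0", rotated 3])
       (use bd in \<open>auto intro: always_eventually\<close>)
  then have "(\<lambda>n. sqrt ((cmod (q v (s n) - q v z))\<^sup>2)) \<longlonglongrightarrow> sqrt (Re (q v v) * 0)"
    by (rule tendsto_real_sqrt)
  then have "(\<lambda>n. cmod (q v (s n) - q v z)) \<longlonglongrightarrow> 0" by simp
  then show ?thesis by (rule LIM_zero_cancel[OF tendsto_norm_zero_cancel])
qed

text \<open>
  Minimize \<open>q v v - 2 Re (L v)\<close> over \<open>M\<close>. The bound on \<open>L\<close> keeps the infimum finite, and the parallelogram
  law makes every minimizing sequence Cauchy. Its limit \<open>z\<close> need not lie in \<open>M\<close>, but the first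
  variation survives the limit and shows that \<open>z\<close> represents \<open>L\<close> on \<open>M\<close>. The choice \<open>M = D\<close> is the Riesz
  representation theorem; for a smaller \<open>M\<close> the sequence shows that \<open>z\<close> lies in the closure of \<open>M\<close>, which
  is how density is obtained.
\<close>

lemma Riesz_minimizing_sequence:
  assumes complete_form and "0 \<le> K"
    and sub: "M \<subseteq> D" and M: "pos_form M add scale q"
    and L_add: "\<And>x y. x \<in> M \<Longrightarrow> y \<in> M \<Longrightarrow> L (add x y) = L x + L y"
    and L_scale: "\<And>c x. x \<in> M \<Longrightarrow> L (scale c x) = c * L x"
    and L_bound: "\<And>x. x \<in> M \<Longrightarrow> (cmod (L x))\<^sup>2 \<le> K * Re (q x x)"
  shows "\<exists>z s. z \<in> D \<and> (\<forall>n. s n \<in> M) \<and> (\<lambda>n. Re (q (diff (s n) z) (diff (s n) z))) \<longlonglongrightarrow> 0 \<and>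
               (\<forall>v\<in>M. q v z = L v)"
proof -
  interpret M: pos_form M add scale q by (rule M)
  define J where "J v = Re (q v v) - 2 * Re (L v)" for v
  have quad: "0 \<le> r\<^sup>2 - 2 * (k * r) + k\<^sup>2" for r k :: real
    using zero_le_power2[of "r - k"] by (simp add: power2_eq_square algebra_simps)
  have J_low: "- K \<le> J v" if "v \<in> M" for v
  proof -
    have r: "0 \<le> Re (q v v)" using M.q_pos[OF that] .
    have "\<bar>Re (L v)\<bar> \<le> cmod (L v)" by (rule abs_Re_le_cmod)
    also have "\<dots> \<le> sqrt (K * Re (q v v))" using L_bound[OF that] real_le_rsqrt by blast
    also have "\<dots> = sqrt K * sqrt (Re (q v v))" by (rule real_sqrt_mult)
    finally show ?thesis
      using quad[of "sqrt (Re (q v v))" "sqrt K"] r \<open>0 \<le> K\<close> by (simp add: J_def)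
  qed
  define m where "m = Inf (J ` M)"
  have bdd: "bdd_below (J ` M)"
    by (rule bdd_belowI2[of M "- K"]) (rule J_low)
  have m_le: "m \<le> J v" if "v \<in> M" for v
    unfolding m_def using bdd that by (simp add: cInf_lower)
  have "\<exists>v\<in>M. J v < m + 1 / real (Suc n)" for n
  proof -
    have "m < m + 1 / real (Suc n)" by simp
    then show ?thesis
      using cInf_lessD[of "J ` M"] M.nonempty unfolding m_def by blast
  qed
  then obtain s where sM: "\<And>n. s n \<in> M" and s_less: "\<And>n. J (s n) < m + 1 / real (Suc n)"
    by metis
  have sD: "s n \<in> D" for n using sM sub by blast
  \<comment> \<open>Parallelogram law; the midpoint of \<open>x\<close> and \<open>y\<close> has value at least \<open>m\<close>.\<close>
  have par: "Re (q (diff x y) (diff x y)) \<le> 2 * (J x - m) + 2 * (J y - m)" if "x \<in> M" "y \<in> M" for x y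
  proof -
    have D: "x \<in> D" "y \<in> D" using that sub by auto
    let ?h = "scale (1/2) (add x y)"
    have h: "?h \<in> M" by (simp add: M.add_in M.scale_in that)
    have "m \<le> J ?h" by (rule m_le[OF h])
    also have "J ?h = (Re (q x x) + Re (q y y) + 2 * Re (q x y)) / 4 - Re (L x) - Re (L y)"
      using that D q_herm[OF D]
      by (simp add: J_def L_scale L_add M.add_in q_scale q_scale_right q_add q_add_right add_in scale_in
          field_simps)
    finally have "4 * m \<le> Re (q x x) + Re (q y y) + 2 * Re (q x y) - 4 * Re (L x) - 4 * Re (L y)"
      by (simp add: field_simps)
    moreover have "Re (q (diff x y) (diff x y)) = Re (q x x) + Re (q y y) - 2 * Re (q x y)"
      using D q_herm[OF D] by (simp add: q_diff q_diff_right diff_in)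
    ultimately show ?thesis by (simp add: J_def)
  qed
  have "\<exists>z\<in>D. (\<lambda>n. Re (q (diff (s n) z) (diff (s n) z))) \<longlonglongrightarrow> 0"
  proof -
    have "\<exists>N. \<forall>i\<ge>N. \<forall>j\<ge>N. Re (q (diff (s i) (s j)) (diff (s i) (s j))) < \<epsilon>" if "\<epsilon> > 0" for \<epsilon>
    proof -
      obtain N where N: "4 / \<epsilon> < real N" using reals_Archimedean2 by blast
      have less: "J (s i) - m < \<epsilon> / 4" if "N \<le> i" for i
      proof -
        have "4 / \<epsilon> < real (Suc i)" using N that by linarith
        then have "1 / real (Suc i) < \<epsilon> / 4" using \<open>\<epsilon> > 0\<close> by (simp add: field_simps)
        then show ?thesis using s_less[of i] by linarith
      qed
      have "Re (q (diff (s i) (s j)) (diff (s i) (s j))) < \<epsilon>" if "N \<le> i" "N \<le> j" for i j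
      proof -
        have *: "x < \<epsilon>" if "x \<le> 2 * c + 2 * d" "c < \<epsilon> / 4" "d < \<epsilon> / 4" for x c d
          using that by linarith
        show ?thesis
          using *[OF par[OF sM sM, of i j] less[OF that(1)] less[OF that(2)]] .
      qed
      then show ?thesis by blast
    qed
    then show ?thesis using \<open>complete_form\<close> sD unfolding complete_form_def by blast
  qed
  then obtain z where z: "z \<in> D" and lim: "(\<lambda>n. Re (q (diff (s n) z) (diff (s n) z))) \<longlonglongrightarrow> 0"
    by blast
  have re0: "Re (q v z - L v) = 0" if v: "v \<in> M" for v
  proof -
    have vD: "v \<in> D" using v sub by blast
    let ?c = "Re (q v z - L v)" and ?b = "Re (q v v)"
    have quad0: "0 \<le> 2 * t * ?c + t\<^sup>2 * ?b" for t
    proof -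
      have "- (1 / real (Suc n)) \<le> 2 * t * Re (q v (s n) - L v) + t\<^sup>2 * ?b" for n
      proof -
        let ?w = "add (s n) (scale (of_real t) v)"
        have "J ?w = J (s n) + 2 * t * Re (q v (s n) - L v) + t\<^sup>2 * ?b"
          using q_add_scale_self[OF sD vD, of n "of_real t"] sM v
          by (simp add: J_def L_add L_scale M.scale_in algebra_simps)
        moreover have "m \<le> J ?w" by (simp add: m_le M.add_in M.scale_in sM v)
        ultimately show ?thesis using s_less[of n] by linarith
      qed
      moreover have "(\<lambda>n. 2 * t * Re (q v (s n) - L v) + t\<^sup>2 * ?b) \<longlonglongrightarrow> 2 * t * ?c + t\<^sup>2 * ?b"
        by (intro tendsto_add tendsto_mult tendsto_const tendsto_Re tendsto_diff q_tendsto sD z vD lim)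
      moreover have "(\<lambda>n. - (1 / real (Suc n))) \<longlonglongrightarrow> 0"
        using LIMSEQ_inverse_real_of_nat_add_minus[of 0] by (simp add: inverse_eq_divide)
      ultimately show ?thesis by (meson LIMSEQ_le)
    qed
    have b: "0 \<le> ?b" by (rule q_pos[OF vD])
    show ?thesis
    proof (rule ccontr)
      assume c: "?c \<noteq> 0"
      define k where "k = ?c / (?b + 1)"
      have c_eq: "?c = k * (?b + 1)" using b by (simp add: k_def)
      \<comment> \<open>Moving against the sign of the linear coefficient makes the quadratic negative.\<close>
      have "0 \<le> 2 * (- k) * ?c + (- k)\<^sup>2 * ?b" by (rule quad0)
      also have "\<dots> = - (k\<^sup>2 * (?b + 2))"
        unfolding c_eq by (simp add: power2_eq_square algebra_simps)
      also have "\<dots> < 0"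
        using b c by (simp add: k_def mult_pos_pos add_nonneg_pos)
      finally show False by simp
    qed
  qed
  have "q v z = L v" if v: "v \<in> M" for v
  proof -
    have vD: "v \<in> D" using v sub by blast
    have "Re (q v z - L v) = 0" by (rule re0[OF v])
    moreover have "Re (\<i> * (q v z - L v)) = 0"
      using re0[of "scale \<i> v"] v vD z by (simp add: M.scale_in q_scale L_scale)
    ultimately show ?thesis by (simp add: complex_eq_iff)
  qed
  then show ?thesis using z sM lim by blast
qed

end

text \<open>
  The operator is the inverse of the solution map \<open>S\<close> of \<open>q (S f) v = (f, v)\<close>. Its domain, the range of
  \<open>S\<close>, is dense because an element orthogonal to it is mapped to \<open>0\<close> by \<open>S\<close>. Surjectivity of \<open>T\<close> turns
  symmetry into self-adjointness, and it forces every competitor to agree with \<open>T\<close>.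
\<close>

theorem form_representation:
  fixes H :: "'h cinner_space" and D :: "'h set" and q :: "'h \<Rightarrow> 'h \<Rightarrow> complex"
  assumes H: "pos_form (vectors H) (vadd H) (vscale H) (vinner H)"
    and H_complete: "pos_form.complete_form (vectors H) (vadd H) (vscale H) (vinner H)"
    and definite: "\<And>x y. x \<in> vectors H \<Longrightarrow> y \<in> vectors H \<Longrightarrow> vdist H x y = 0 \<Longrightarrow> x = y"
    and Q: "pos_form D (vadd H) (vscale H) q"
    and Q_complete: "pos_form.complete_form D (vadd H) (vscale H) q"
    and DH: "D \<subseteq> vectors H"
    and q_ge: "\<And>x. x \<in> D \<Longrightarrow> Re (vinner H x x) \<le> Re (q x x)"
    and perp: "\<And>x. x \<in> vectors H \<Longrightarrow> (\<And>v. v \<in> D \<Longrightarrow> vinner H x v = 0) \<Longrightarrow> vinner H x x = 0"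
  shows "\<exists>!T. self_adjoint H T \<and> dom T \<subseteq> D \<and>
              (\<forall>u\<in>dom T. \<forall>v\<in>D. q u v = vinner H (the (T u)) v)"
proof -
  interpret H: pos_form "vectors H" "vadd H" "vscale H" "vinner H" by (rule H)
  interpret Q: pos_form D "vadd H" "vscale H" q by (rule Q)
  let ?ip = "vinner H" and ?X = "vectors H"
  have vdist: "vdist H x y = sqrt (Re (?ip (H.diff x y) (H.diff x y)))" for x y
    by (simp add: vdist_def H.diff_def Let_def)
  have eqI: "x = y" if "x \<in> ?X" "y \<in> ?X" "\<And>v. v \<in> ?X \<Longrightarrow> ?ip x v = ?ip y v" for x y
  proof (rule definite[OF that(1,2)])
    show "vdist H x y = 0" using that by (simp add: vdist H.q_diff H.diff_in)
  qed
  have eqI_D: "x = y" if "x \<in> ?X" "y \<in> ?X" and eq: "\<And>v. v \<in> D \<Longrightarrow> ?ip x v = ?ip y v" for x y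
  proof (rule definite[OF that(1,2)])
    have "?ip (H.diff x y) (H.diff x y) = 0"
      using that DH by (intro perp) (auto simp: H.q_diff H.diff_in)
    then show "vdist H x y = 0" by (simp add: vdist)
  qed
  have eqI_q: "x = y" if "x \<in> D" "y \<in> D" "\<And>v. v \<in> D \<Longrightarrow> q x v = q y v" for x y
  proof (rule definite)
    show "x \<in> ?X" "y \<in> ?X" using that DH by auto
    have d: "H.diff x y \<in> D" using Q.diff_in that by (simp add: H.diff_def Q.diff_def)
    have "q (H.diff x y) (H.diff x y) = 0"
      using that d Q.q_diff[of x y "H.diff x y"] by (simp add: H.diff_def Q.diff_def)
    then have "Re (?ip (H.diff x y) (H.diff x y)) = 0"
      using q_ge[OF d] H.q_pos[of "H.diff x y"] d DH by auto
    then show "vdist H x y = 0" by (simp add: vdist)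
  qed
  \<comment> \<open>The functional \<open>v \<mapsto> (v, f)\<close> is bounded for \<open>q\<close> since \<open>q\<close> dominates the inner product.\<close>
  have "\<exists>u\<in>D. \<forall>v\<in>D. q u v = ?ip f v" if f: "f \<in> ?X" for f
  proof -
    have "\<exists>z s. z \<in> D \<and> (\<forall>n. s n \<in> D) \<and> (\<lambda>n. Re (q (Q.diff (s n) z) (Q.diff (s n) z))) \<longlonglongrightarrow> 0 \<and>
               (\<forall>v\<in>D. q v z = ?ip v f)"
    proof (rule Q.Riesz_minimizing_sequence[OF Q_complete _ subset_refl Q, where K = "Re (?ip f f)"])
      show "0 \<le> Re (?ip f f)" using f by (rule H.q_pos)
      fix x assume x: "x \<in> D"
      have "(cmod (?ip x f))\<^sup>2 \<le> Re (?ip x x) * Re (?ip f f)"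
        using H.Cauchy_Schwarz f x DH by blast
      also have "\<dots> \<le> Re (?ip f f) * Re (q x x)"
        using q_ge[OF x] H.q_pos[OF f] by (subst mult.commute) (rule mult_left_mono)
      finally show "(cmod (?ip x f))\<^sup>2 \<le> Re (?ip f f) * Re (q x x)" .
    qed (use f DH in \<open>auto simp: H.q_add H.q_scale subset_eq\<close>)
    then obtain z where z: "z \<in> D" "\<And>v. v \<in> D \<Longrightarrow> q v z = ?ip v f" by blast
    then have "q z v = ?ip f v" if "v \<in> D" for v
      using that Q.q_herm[of v z] H.q_herm[of v f] f DH by auto
    then show ?thesis using z by blast
  qed
  then obtain S where SD: "\<And>f. f \<in> ?X \<Longrightarrow> S f \<in> D"
    and S: "\<And>f v. f \<in> ?X \<Longrightarrow> v \<in> D \<Longrightarrow> q (S f) v = ?ip f v" by metis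
  have SX: "S f \<in> ?X" if "f \<in> ?X" for f using SD[OF that] DH by blast
  have S_inj: "f = g" if "f \<in> ?X" "g \<in> ?X" "S f = S g" for f g
    using that S by (intro eqI_D) metis+
  have S_sym: "?ip f (S g) = ?ip (S f) g" if "f \<in> ?X" "g \<in> ?X" for f g
  proof -
    have "?ip f (S g) = q (S f) (S g)" using that S SD by metis
    also have "\<dots> = cnj (q (S g) (S f))" using that SD Q.q_herm by blast
    also have "\<dots> = cnj (?ip g (S f))" using that S SD by metis
    also have "\<dots> = ?ip (S f) g" using that SX H.q_herm by metis
    finally show ?thesis .
  qed
  have S_unique: "u = S f" if "u \<in> D" "f \<in> ?X" "\<And>v. v \<in> D \<Longrightarrow> q u v = ?ip f v" for u f
    using that S SD by (intro eqI_q) auto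
  define T where "T u = (if \<exists>f\<in>?X. S f = u then Some (THE f. f \<in> ?X \<and> S f = u) else None)" for u
  have TS: "T (S f) = Some f" if "f \<in> ?X" for f
  proof -
    have "(THE g. g \<in> ?X \<and> S g = S f) = f" using that S_inj by (intro the_equality) auto
    then show ?thesis using that by (auto simp: T_def)
  qed
  have domT: "dom T = S ` ?X" using TS by (auto simp: T_def split: if_splits)
  have S_add: "vadd H (S f) (S g) = S (vadd H f g)" if "f \<in> ?X" "g \<in> ?X" for f g
    using that SD S DH by (intro S_unique) (auto simp: Q.add_in H.add_in Q.q_add H.q_add subset_eq)
  have S_scale: "vscale H c (S f) = S (vscale H c f)" if "f \<in> ?X" for f c
    using that SD S DH by (intro S_unique) (auto simp: Q.scale_in H.scale_in Q.q_scale H.q_scale subset_eq)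
  have lin: "linear_operator H T"
    unfolding linear_operator_def domT
  proof (intro conjI ballI allI)
    show "S ` ?X \<subseteq> ?X" using SX by auto
    show "ran T \<subseteq> ?X"
    proof
      fix f assume "f \<in> ran T"
      then obtain u where u: "T u = Some f" by (auto simp: ran_def)
      then have "u \<in> S ` ?X" using domT by blast
      then show "f \<in> ?X" using u TS by auto
    qed
    show "T (vadd H u v) = Some (vadd H (the (T u)) (the (T v)))" if "u \<in> S ` ?X" "v \<in> S ` ?X" for u v
      using that by (auto simp: TS S_add H.add_in)
    show "T (vscale H c u) = Some (vscale H c (the (T u)))" if "u \<in> S ` ?X" for u c
      using that by (auto simp: TS S_scale H.scale_in)
  qed
  have domT_sub: "dom T \<subseteq> ?X" using domT SX by auto
  have domT_form: "pos_form (dom T) (vadd H) (vscale H) ?ip"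
  proof
    show "dom T \<noteq> {}" using domT H.nonempty by auto
    show "vadd H x y \<in> dom T" if "x \<in> dom T" "y \<in> dom T" for x y
      using that by (auto simp: domT S_add H.add_in)
    show "vscale H c x \<in> dom T" if "x \<in> dom T" for x c
      using that by (auto simp: domT S_scale H.scale_in)
  qed (use domT_sub in \<open>auto intro: H.q_add H.q_scale H.q_herm H.q_pos\<close>)
  have dense: "densely_defined H T"
    unfolding densely_defined_def
  proof (intro ballI allI impI)
    fix x and \<epsilon> :: real assume x: "x \<in> ?X" and "\<epsilon> > 0"
    have "\<exists>z s. z \<in> ?X \<and> (\<forall>n. s n \<in> dom T) \<and> (\<lambda>n. Re (?ip (H.diff (s n) z) (H.diff (s n) z))) \<longlonglongrightarrow> 0 \<and>
               (\<forall>v\<in>dom T. ?ip v z = ?ip v x)"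
    proof (rule H.Riesz_minimizing_sequence[OF H_complete _ domT_sub domT_form, where K = "Re (?ip x x)"])
      show "0 \<le> Re (?ip x x)" using x by (rule H.q_pos)
      show "(cmod (?ip y x))\<^sup>2 \<le> Re (?ip x x) * Re (?ip y y)" if "y \<in> dom T" for y
        using H.Cauchy_Schwarz[of y x] that x domT_sub by (auto simp: mult.commute)
    qed (use domT_sub x in \<open>auto simp: H.q_add H.q_scale subset_eq\<close>)
    then obtain z s where z: "z \<in> ?X" and s: "\<And>n. s n \<in> dom T"
      and lim: "(\<lambda>n. Re (?ip (H.diff (s n) z) (H.diff (s n) z))) \<longlonglongrightarrow> 0"
      and perp_z: "\<And>v. v \<in> dom T \<Longrightarrow> ?ip v z = ?ip v x" by blast
    have perp_z: "?ip (S f) z = ?ip (S f) x" if "f \<in> ?X" for f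
      using that perp_z domT by simp
    \<comment> \<open>The projection \<open>z\<close> of \<open>x\<close> to the closure of the domain equals \<open>x\<close>.\<close>
    have "S z = S x"
    proof (rule eqI)
      show "?ip (S z) v = ?ip (S x) v" if "v \<in> ?X" for v
        using that z x perp_z[OF that] S_sym[of _ v] SX H.q_herm by metis
    qed (use SX z x in auto)
    then have "z = x" using S_inj z x by blast
    have "eventually (\<lambda>n. Re (?ip (H.diff (s n) z) (H.diff (s n) z)) < \<epsilon>\<^sup>2) sequentially"
      using lim \<open>\<epsilon> > 0\<close> by (intro order_tendstoD(2)[OF lim]) simp
    then obtain n where n: "Re (?ip (H.diff (s n) z) (H.diff (s n) z)) < \<epsilon>\<^sup>2"
      by (auto simp: eventually_sequentially)
    have sn: "s n \<in> ?X" using s domT_sub by blast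
    have "?ip (H.diff x (s n)) (H.diff x (s n)) = ?ip (H.diff (s n) x) (H.diff (s n) x)"
      using x sn by (simp add: H.q_diff H.q_diff_right H.diff_in)
    then have "vdist H x (s n) < \<epsilon>"
      using n \<open>\<epsilon> > 0\<close> \<open>z = x\<close> by (simp add: vdist real_sqrt_less_iff real_less_lsqrt)
    then show "\<exists>y\<in>dom T. vdist H x y < \<epsilon>" using s by blast
  qed
  \<comment> \<open>Surjectivity of \<open>T\<close>: an element of the graph of the adjoint is determined by its second entry.\<close>
  have adj: "adjoint_rel H T v w \<longleftrightarrow> w \<in> ?X \<and> v = S w" for v w
  proof
    assume "adjoint_rel H T v w"
    then have v: "v \<in> ?X" and w: "w \<in> ?X" and eq: "\<And>f. f \<in> ?X \<Longrightarrow> ?ip f v = ?ip (S f) w"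
      using TS by (auto simp: adjoint_rel_def domT)
    have "v = S w"
    proof (rule eqI[OF v SX[OF w]])
      fix f assume "f \<in> ?X"
      then show "?ip v f = ?ip (S w) f"
        using eq[of f] S_sym[of f w] v w SX H.q_herm by metis
    qed
    then show "w \<in> ?X \<and> v = S w" using w by blast
  next
    assume "w \<in> ?X \<and> v = S w"
    then show "adjoint_rel H T v w"
      using TS S_sym SX by (auto simp: adjoint_rel_def domT)
  qed
  have "adjoint_op H T = T"
    by (rule ext) (auto simp: adjoint_op_def adj T_def intro!: arg_cong[where f = The])
  then have sa: "self_adjoint H T" using lin dense by (simp add: self_adjoint_def)
  show ?thesis
  proof (rule ex1I[of _ T])
    show "self_adjoint H T \<and> dom T \<subseteq> D \<and> (\<forall>u\<in>dom T. \<forall>v\<in>D. q u v = vinner H (the (T u)) v)"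
      using sa SD S TS by (auto simp: domT)
  next
    fix T' assume T': "self_adjoint H T' \<and> dom T' \<subseteq> D \<and> (\<forall>u\<in>dom T'. \<forall>v\<in>D. q u v = vinner H (the (T' u)) v)"
    then have lin': "linear_operator H T'" and adj': "adjoint_op H T' = T'"
      by (auto simp: self_adjoint_def)
    have sub: "T u = Some f" if "T' u = Some f" for u f
    proof -
      have f: "f \<in> ?X" using that lin' by (auto simp: linear_operator_def ran_def)
      have "u = S f"
        using that T' f by (intro S_unique) force+
      then show ?thesis using TS f by simp
    qed
    have sup: "T' u = Some f" if "T u = Some f" for u f
    proof -
      have u: "f \<in> ?X" "u = S f"
        using that domT TS by (metis domI imageE option.inject)+
      have "adjoint_rel H T' u f"
        unfolding adjoint_rel_def
      proof (intro conjI ballI)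
        show "u \<in> ?X" "f \<in> ?X" using u SX by auto
        fix w assume "w \<in> dom T'"
        then obtain g where g: "T' w = Some g" by blast
        then have "T w = Some g" by (rule sub)
        then have "g \<in> ?X" "w = S g"
          using domT TS by (metis domI imageE option.inject)+
        then show "?ip (the (T' w)) u = ?ip w f" using g u S_sym by simp
      qed
      then have "adjoint_op H T' u \<noteq> None" by (auto simp: adjoint_op_def)
      then obtain g where "T' u = Some g" using adj' by auto
      then show ?thesis using sub[of u g] that by simp
    qed
    show "T' = T"
    proof
      fix u show "T' u = T u" using sub[of u] sup[of u] by (cases "T' u"; cases "T u") auto
    qed
  qed
qed

section \<open>Smooth bumps and the fundamental lemma\<close>

text \<open>
  Multiplying \<open>exp (- 1 / x)\<close> by polynomials in \<open>1 / x\<close> gives a class of functions that is closed under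
  differentiation, so smoothness at \<open>0\<close> is settled for all orders by a single limit.
\<close>

definition expinv :: "real poly \<Rightarrow> real \<Rightarrow> real" where
  "expinv p x = (if 0 < x then poly p (1 / x) * exp (- (1 / x)) else 0)"

lemma poly_times_exp_tendsto_0: "((\<lambda>t. poly p t * exp (- t)) \<longlongrightarrow> (0::real)) at_top"
proof -
  have eq: "poly p t * exp (- t) = (\<Sum>i\<le>degree p. coeff p i * (t ^ i / exp t))" for t :: real
    by (simp add: poly_altdef exp_minus sum_distrib_right divide_inverse mult.assoc)
  have "((\<lambda>t. \<Sum>i\<le>degree p. coeff p i * (t ^ i / exp t)) \<longlongrightarrow> (\<Sum>i\<le>degree p. coeff p i * 0)) at_top"
    by (rule tendsto_sum) (rule tendsto_mult_left[OF tendsto_power_div_exp_0])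
  then show ?thesis by (simp add: eq)
qed

lemma expinv_tendsto_0: "(expinv p \<longlongrightarrow> 0) (at_right 0)"
proof -
  have "((\<lambda>x. poly p (inverse x) * exp (- inverse x)) \<longlongrightarrow> 0) (at_right (0::real))"
    by (rule filterlim_compose[OF poly_times_exp_tendsto_0 filterlim_inverse_at_top_right])
  then show ?thesis
    by (rule Lim_transform_eventually)
       (auto simp: eventually_at_right_less expinv_def inverse_eq_divide
             intro: eventually_mono[OF eventually_at_right_less])
qed

lemma DERIV_expinv: "DERIV (expinv p) x :> expinv ([:0, 0, 1:] * (p - pderiv p)) x"
proof -
  consider "x < 0" | "x = 0" | "0 < x" by linarith
  then show ?thesis
  proof cases
    case 1
    have "(expinv p has_field_derivative 0) (at x)"
      by (rule has_field_derivative_transform_within_open[of "\<lambda>_. 0" _ _ "{..<0}"])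
         (use 1 in \<open>auto simp: expinv_def\<close>)
    then show ?thesis using 1 by (simp add: expinv_def)
  next
    case 3
    have "DERIV (\<lambda>y. poly p (1 / y) * exp (- (1 / y))) x :>
            poly ([:0, 0, 1:] * (p - pderiv p)) (1 / x) * exp (- (1 / x))"
      using 3 by (auto intro!: derivative_eq_intros DERIV_chain2[OF poly_DERIV]
          simp: field_simps power2_eq_square)
    then have "(expinv p has_field_derivative
            poly ([:0, 0, 1:] * (p - pderiv p)) (1 / x) * exp (- (1 / x))) (at x)"
      by (rule has_field_derivative_transform_within_open[of _ _ _ "{0<..}"])
         (use 3 in \<open>auto simp: expinv_def\<close>)
    then show ?thesis using 3 by (simp add: expinv_def)
  next
    case 2
    have "((\<lambda>h. expinv p h / h) \<longlongrightarrow> 0) (at_right 0)"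
    proof (rule Lim_transform_eventually[OF expinv_tendsto_0[of "pCons 0 p"]])
      show "\<forall>\<^sub>F h in at_right 0. expinv (pCons 0 p) h = expinv p h / h"
        by (rule eventually_mono[OF eventually_at_right_less]) (auto simp: expinv_def)
    qed
    moreover have "((\<lambda>h. expinv p h / h) \<longlongrightarrow> 0) (at_left 0)"
      by (rule Lim_transform_eventually[OF tendsto_const])
         (auto simp: expinv_def eventually_at_left_field intro!: exI[of _ "-1"])
    ultimately have "((\<lambda>h. expinv p h / h) \<longlongrightarrow> 0) (at 0)"
      by (simp add: filterlim_split_at)
    then show ?thesis using 2 by (simp add: DERIV_def expinv_def)
  qed
qed

text \<open>
  Products of two members of the class, one for each end of an interval, together with their sums, are
  again closed under differentiation.
\<close>

inductive_set expinv_span :: "(real \<Rightarrow> real) set" where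
  mult: "(\<lambda>x. expinv p (c * x + d) * expinv p' (c' * x + d')) \<in> expinv_span"
| add: "f \<in> expinv_span \<Longrightarrow> g \<in> expinv_span \<Longrightarrow> (\<lambda>x. f x + g x) \<in> expinv_span"

lemma DERIV_expinv_affine:
  "DERIV (\<lambda>x. expinv p (c * x + d)) x :> expinv (smult c ([:0, 0, 1:] * (p - pderiv p))) (c * x + d)"
proof -
  have "DERIV (\<lambda>x. expinv p (c * x + d)) x :> expinv ([:0, 0, 1:] * (p - pderiv p)) (c * x + d) * c"
    by (rule DERIV_chain2[OF DERIV_expinv]) (auto intro!: derivative_eq_intros)
  moreover have "expinv ([:0, 0, 1:] * (p - pderiv p)) (c * x + d) * c
      = expinv (smult c ([:0, 0, 1:] * (p - pderiv p))) (c * x + d)"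
    by (simp add: expinv_def mult_ac)
  ultimately show ?thesis by simp
qed

lemma DERIV_expinv_span:
  "f \<in> expinv_span \<Longrightarrow> \<exists>f'\<in>expinv_span. \<forall>x. DERIV f x :> f' x"
proof (induction rule: expinv_span.induct)
  case (mult p c d p' c' d')
  let ?q = "smult c ([:0, 0, 1:] * (p - pderiv p))" and ?q' = "smult c' ([:0, 0, 1:] * (p' - pderiv p'))"
  let ?f' = "\<lambda>x. expinv ?q (c * x + d) * expinv p' (c' * x + d') + expinv ?q' (c' * x + d') * expinv p (c * x + d)"
  have "?f' \<in> expinv_span"
    by (rule expinv_span.add; rule expinv_span.mult)
  moreover have "DERIV (\<lambda>x. expinv p (c * x + d) * expinv p' (c' * x + d')) x :> ?f' x" for x
    by (rule DERIV_mult[OF DERIV_expinv_affine DERIV_expinv_affine])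
  ultimately show ?case by (intro bexI[of _ ?f'] allI)
next
  case (add f g)
  then obtain f' g' where "f' \<in> expinv_span" "g' \<in> expinv_span"
    and "\<And>x. DERIV f x :> f' x" "\<And>x. DERIV g x :> g' x" by blast
  then show ?case
    by (intro bexI[of _ "\<lambda>x. f' x + g' x"] allI DERIV_add expinv_span.add)
qed

lemma deriv_iterate_expinv_span: "f \<in> expinv_span \<Longrightarrow> (deriv ^^ n) f \<in> expinv_span"
proof (induction n)
  case (Suc n)
  then obtain f' where "f' \<in> expinv_span" "\<forall>x. DERIV ((deriv ^^ n) f) x :> f' x"
    using DERIV_expinv_span by blast
  moreover then have "deriv ((deriv ^^ n) f) = f'" by (auto intro: DERIV_imp_deriv)
  ultimately show ?case by simp
qed simp

lemma expinv_span_smooth: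
  assumes "f \<in> expinv_span" shows "(deriv ^^ n) f field_differentiable at x"
  using DERIV_expinv_span[OF deriv_iterate_expinv_span[OF assms]]
  unfolding field_differentiable_def by blast

definition smooth_step :: "real \<Rightarrow> real" where "smooth_step = expinv 1"
definition smooth_step' :: "real \<Rightarrow> real" where "smooth_step' = expinv [:0, 0, 1:]"

lemma DERIV_smooth_step: "DERIV smooth_step x :> smooth_step' x"
  using DERIV_expinv[of 1 x] by (simp add: smooth_step_def smooth_step'_def pderiv_1)

lemma smooth_step_nonpos: "x \<le> 0 \<Longrightarrow> smooth_step x = 0" and smooth_step'_nonpos: "x \<le> 0 \<Longrightarrow> smooth_step' x = 0"
  by (simp_all add: smooth_step_def smooth_step'_def expinv_def)

lemma smooth_step_pos: "0 < x \<Longrightarrow> smooth_step x = exp (- (1 / x))" by (simp add: smooth_step_def expinv_def)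

lemma smooth_step_bounds: "0 \<le> smooth_step x" "smooth_step x \<le> 1"
  by (simp_all add: smooth_step_def expinv_def)

lemma smooth_step'_nonneg: "0 \<le> smooth_step' x"
  by (simp add: smooth_step'_def expinv_def)

lemma isCont_smooth_step: "isCont smooth_step x" and isCont_smooth_step': "isCont smooth_step' x"
  using DERIV_smooth_step DERIV_expinv DERIV_isCont unfolding smooth_step'_def by blast+

lemma smooth_step_measurable [measurable]: "smooth_step \<in> borel_measurable borel"
  and smooth_step'_measurable [measurable]: "smooth_step' \<in> borel_measurable borel"
  using isCont_smooth_step isCont_smooth_step'
  by (auto intro!: borel_measurable_continuous_onI continuous_at_imp_continuous_on)

lemma smooth_step_tendsto_1: "(smooth_step \<longlongrightarrow> 1) at_top"
proof -
  have "((\<lambda>x::real. exp (- inverse x)) \<longlongrightarrow> exp (- 0)) at_top"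
    by (intro tendsto_exp tendsto_minus tendsto_inverse_0_at_top filterlim_ident)
  then have "((\<lambda>x::real. exp (- inverse x)) \<longlongrightarrow> 1) at_top" by simp
  then show ?thesis
    by (rule Lim_transform_eventually)
       (auto simp: smooth_step_pos inverse_eq_divide intro: eventually_mono[OF eventually_gt_at_top[of 0]])
qed

text \<open>
  The total mass is the increment of the step from \<open>0\<close> to \<open>1\<close>; it is what makes the rescaled derivative
  converge to a unit mass.
\<close>

lemma has_bochner_integral_smooth_step': "has_bochner_integral lborel smooth_step' 1"
proof (rule has_bochner_integral_nn_integral)
  have "(\<integral>\<^sup>+x. ennreal (smooth_step' x) * indicator {0..} x \<partial>lborel) = ennreal (1 - smooth_step 0)"
    by (rule nn_integral_FTC_atLeast[OF smooth_step'_measurable DERIV_smooth_step smooth_step'_nonneg smooth_step_tendsto_1])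
  moreover have "(\<integral>\<^sup>+x. ennreal (smooth_step' x) * indicator {0..} x \<partial>lborel) = (\<integral>\<^sup>+x. ennreal (smooth_step' x) \<partial>lborel)"
    by (rule nn_integral_cong) (auto simp: smooth_step'_nonpos split: split_indicator)
  ultimately show "(\<integral>\<^sup>+x. ennreal (smooth_step' x) \<partial>lborel) = ennreal 1" by (simp add: smooth_step_nonpos)
qed (auto simp: smooth_step'_nonneg)

text \<open>
  Scaling by \<open>n\<close> inside the step amounts to taking the \<open>n\<close>-th root of the bump, which drives it to \<open>1\<close>
  inside the interval and keeps it at \<open>0\<close> outside.
\<close>

definition bump :: "nat \<Rightarrow> real \<Rightarrow> real \<Rightarrow> real \<Rightarrow> real" where
  "bump n a b x = smooth_step (real n * (x - a)) * smooth_step (real n * (b - x))"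

text \<open>
  The part of the derivative of a bump that concentrates at one end point, as a function of the distance
  \<open>y\<close> from that end point; \<open>c\<close> is the length of the interval. Both ends give the same kernel.
\<close>

definition endpoint_kernel :: "nat \<Rightarrow> real \<Rightarrow> real \<Rightarrow> real" where
  "endpoint_kernel n c y = real n * smooth_step' (real n * y) * smooth_step (real n * (c - y))"

definition bump' :: "nat \<Rightarrow> real \<Rightarrow> real \<Rightarrow> real \<Rightarrow> real" where
  "bump' n a b x = endpoint_kernel n (b - a) (x - a) - endpoint_kernel n (b - a) (b - x)"

lemma endpoint_kernel_continuous: "continuous_on S (endpoint_kernel n c)"
  unfolding endpoint_kernel_def[abs_def]
  by (intro continuous_intros continuous_at_imp_continuous_on ballI
      isCont_o2[OF _ isCont_smooth_step'] isCont_o2[OF _ isCont_smooth_step])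

lemma endpoint_kernel_nonpos: "y \<le> 0 \<Longrightarrow> endpoint_kernel n c y = 0" "c \<le> y \<Longrightarrow> endpoint_kernel n c y = 0"
  by (simp_all add: endpoint_kernel_def smooth_step_nonpos smooth_step'_nonpos mult_nonneg_nonpos)

lemma DERIV_bump: "DERIV (bump n a b) x :> bump' n a b x"
  unfolding bump_def bump'_def endpoint_kernel_def
  by (auto intro!: derivative_eq_intros DERIV_chain2[OF DERIV_smooth_step] simp: algebra_simps)

lemma deriv_bump: "deriv (bump n a b) x = bump' n a b x"
  by (rule DERIV_imp_deriv[OF DERIV_bump])

lemma bump_outside: "x \<notin> {a<..<b} \<Longrightarrow> bump n a b x = 0"
  and bump'_outside: "x \<notin> {a<..<b} \<Longrightarrow> bump' n a b x = 0"
  by (cases "x \<le> a"; auto simp: bump_def bump'_def smooth_step_nonpos endpoint_kernel_nonpos mult_nonneg_nonpos)+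

lemma bump_bounds: "0 \<le> bump n a b x" "bump n a b x \<le> 1"
  unfolding bump_def by (simp_all add: smooth_step_bounds mult_le_one)

lemma bump_continuous: "continuous_on S (bump n a b)"
  by (meson DERIV_bump DERIV_isCont continuous_at_imp_continuous_on)

lemma bump'_continuous: "continuous_on S (bump' n a b)"
  unfolding bump'_def[abs_def]
  by (intro continuous_intros continuous_on_compose2[OF endpoint_kernel_continuous[of UNIV]]) auto

lemma bump_measurable [measurable]: "bump n a b \<in> borel_measurable borel"
  by (rule borel_measurable_continuous_onI[OF bump_continuous])

lemma test_function_bump:
  assumes "{a..b} \<subseteq> S" shows "test_function S (bump n a b)"
  unfolding test_function_def
proof (intro conjI allI)
  have "bump n a b = (\<lambda>x. expinv 1 (real n * x + (- real n * a)) * expinv 1 ((- real n) * x + real n * b))"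
    by (auto simp: bump_def smooth_step_def algebra_simps)
  then have "bump n a b \<in> expinv_span" by (simp only: expinv_span.mult)
  then show "(deriv ^^ k) (bump n a b) field_differentiable at x" for k x
    by (rule expinv_span_smooth)
  have "{x. bump n a b x \<noteq> 0} \<subseteq> {a..b}"
  proof
    fix x assume "x \<in> {x. bump n a b x \<noteq> 0}"
    then have "x \<in> {a<..<b}" using bump_outside[of x a b n] by blast
    then show "x \<in> {a..b}" by simp
  qed
  then have sub: "closure {x. bump n a b x \<noteq> 0} \<subseteq> {a..b}" by (simp add: closure_minimal)
  then show "closure {x. bump n a b x \<noteq> 0} \<subseteq> S" using assms by blast
  show "compact (closure {x. bump n a b x \<noteq> 0})"
    using compact_Icc[of a b] sub compact_Int_closed[of "{a..b}" "closure {x. bump n a b x \<noteq> 0}"]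
    by (simp add: Int_absorb1)
qed

lemma bump_tendsto_indicator:
  "(\<lambda>n. bump n a b x) \<longlonglongrightarrow> indicator {a<..<b} x"
proof (cases "x \<in> {a<..<b}")
  case True
  have "filterlim (\<lambda>n. real n * c) at_top sequentially" if "0 < c" for c
    using that by (intro filterlim_at_top_mult_tendsto_pos[OF tendsto_const] filterlim_real_sequentially) 
  then have "(\<lambda>n. smooth_step (real n * c)) \<longlonglongrightarrow> 1" if "0 < c" for c
    using that by (intro filterlim_compose[OF smooth_step_tendsto_1])
  then have "(\<lambda>n. bump n a b x) \<longlonglongrightarrow> 1 * 1"
    unfolding bump_def using True by (intro tendsto_mult) auto
  then show ?thesis using True by simp
qed (simp add: bump_outside)


lemma bump_integral_tendsto:
  fixes h :: "real \<Rightarrow> complex"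
  assumes h: "locally_integrable S h" and sub: "{a..b} \<subseteq> S"
  shows "(\<lambda>n. LINT x:S|lebesgue. h x * of_real (bump n a b x)) \<longlonglongrightarrow> (LINT x:{a<..<b}|lebesgue. h x)"
proof -
  have int: "integrable lebesgue (\<lambda>x. indicator {a..b} x *\<^sub>R h x)"
    using h sub unfolding locally_integrable_def set_integrable_def by blast
  have eq: "indicator S x *\<^sub>R (h x * of_real (bump n a b x))
          = (indicator {a..b} x *\<^sub>R h x) * of_real (bump n a b x)" for n x
    using sub bump_outside[of x a b n] by (cases "x \<in> {a..b}") (auto simp: indicator_def)
  show ?thesis
    unfolding set_lebesgue_integral_def eq
  proof (rule integral_dominated_convergence[where w = "\<lambda>x. norm (indicator {a..b} x *\<^sub>R h x)"])
    show "(\<lambda>x. indicator {a<..<b} x *\<^sub>R h x) \<in> borel_measurable lebesgue"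
    proof -
      have "(\<lambda>x. indicator {a<..<b} x *\<^sub>R h x) = (\<lambda>x. indicator {a<..<b} x *\<^sub>R (indicator {a..b} x *\<^sub>R h x))"
        by (auto simp: indicator_def)
      moreover have "\<dots> \<in> borel_measurable lebesgue"
        using int by (intro borel_measurable_scaleR borel_measurable_indicator borel_measurable_integrable) auto
      ultimately show ?thesis by simp
    qed
    have "bump n a b \<in> borel_measurable lebesgue" for n
      by (rule measurable_completion) simp
    then show "(\<lambda>x. (indicator {a..b} x *\<^sub>R h x) * of_real (bump n a b x)) \<in> borel_measurable lebesgue" for n
      by (intro borel_measurable_times measurable_compose[OF _ borel_measurable_of_real] borel_measurable_integrable[OF int])
    show "integrable lebesgue (\<lambda>x. norm (indicator {a..b} x *\<^sub>R h x))"
      using int by (rule integrable_norm)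
    have "(\<lambda>n. (indicator {a..b} x *\<^sub>R h x) * of_real (bump n a b x))
          \<longlonglongrightarrow> (indicator {a..b} x *\<^sub>R h x) * of_real (indicator {a<..<b} x)" for x
      by (intro tendsto_mult tendsto_const tendsto_of_real bump_tendsto_indicator)
    moreover have "(indicator {a..b} x *\<^sub>R h x) * of_real (indicator {a<..<b} x) = indicator {a<..<b} x *\<^sub>R h x" for x
      by (simp add: indicator_def)
    ultimately show "AE x in lebesgue. (\<lambda>n. (indicator {a..b} x *\<^sub>R h x) * of_real (bump n a b x))
          \<longlonglongrightarrow> indicator {a<..<b} x *\<^sub>R h x"
      by simp
    show "AE x in lebesgue. norm ((indicator {a..b} x *\<^sub>R h x) * of_real (bump n a b x))
            \<le> norm (indicator {a..b} x *\<^sub>R h x)" for n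
    proof (rule AE_I2)
      fix x
      have "norm ((indicator {a..b} x *\<^sub>R h x) * complex_of_real (bump n a b x))
          = norm (indicator {a..b} x *\<^sub>R h x) * bump n a b x"
        using bump_bounds[of n a b x] by (simp add: norm_mult)
      also have "\<dots> \<le> norm (indicator {a..b} x *\<^sub>R h x) * 1"
        by (intro mult_left_mono bump_bounds) auto
      finally show "norm ((indicator {a..b} x *\<^sub>R h x) * complex_of_real (bump n a b x)) \<le> norm (indicator {a..b} x *\<^sub>R h x)"
        by simp
    qed
  qed
qed

text \<open>
  Almost every point is a limit of averages over small intervals to its right, and all these averages
  vanish.
\<close>

lemma zero_on_subintervals_imp_AE_zero:
  fixes h :: "real \<Rightarrow> complex"
  assumes int: "set_integrable lebesgue {a..b} h"
    and zero: "\<And>c d. a < c \<Longrightarrow> c < d \<Longrightarrow> d < b \<Longrightarrow> (LINT x:{c..d}|lebesgue. h x) = 0"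
  shows "AE x in lebesgue. x \<in> {a<..<b} \<longrightarrow> h x = 0"
proof -
  let ?f = "\<lambda>x. indicator {a..b} x *\<^sub>R h x"
  have f_int: "set_integrable lebesgue (cbox c d) ?f" for c d
    using int unfolding set_integrable_def
    by (rule integrable_mult_indicator[rotated]) auto
  have f_int: "?f integrable_on cbox c d" for c d
    using f_int by (rule set_lebesgue_integral_eq_integral)
  obtain N where N: "negligible N"
    and lim: "\<And>x e. \<lbrakk>x \<notin> N; 0 < e\<rbrakk> \<Longrightarrow> \<exists>d>0. \<forall>k. 0 < k \<and> k < d \<longrightarrow>
                norm (integral (cbox x (x + k *\<^sub>R One)) ?f /\<^sub>R k ^ DIM(real) - ?f x) < e"
    by (rule integrable_ccontinuous_explicit[of ?f, OF f_int]) blast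
  have "h x = 0" if x: "x \<in> {a<..<b}" "x \<notin> N" for x
  proof (rule ccontr)
    assume "h x \<noteq> 0"
    then have "0 < norm (h x)" by simp
    then obtain d where d: "d > 0" and dlim: "\<And>k. 0 < k \<Longrightarrow> k < d \<Longrightarrow>
        norm (integral {x..x + k} ?f /\<^sub>R k - ?f x) < norm (h x)"
      using lim[OF x(2), of "norm (h x)"] by auto
    define k where "k = min (d / 2) ((b - x) / 2)"
    have k: "0 < k" "k < d" "x + k < b" using d x by (auto simp: k_def min_def field_simps)
    have sub: "{x..x + k} \<subseteq> {a..b}" using x k by auto
    have "set_integrable lebesgue {x..x + k} h" using int by (rule set_integrable_subset) (use sub in auto)
    then have "integral {x..x + k} h = (LINT x:{x..x + k}|lebesgue. h x)"
      by (simp add: set_lebesgue_integral_eq_integral)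
    also have "\<dots> = 0" using x k by (intro zero) auto
    finally have "integral {x..x + k} ?f = 0"
      using sub integral_cong[of "{x..x+k}" ?f h] by (auto simp: indicator_def)
    then show False using dlim[OF k(1,2)] x by (simp add: indicator_def)
  qed
  then have "{x. \<not> (x \<in> {a<..<b} \<longrightarrow> h x = 0)} \<subseteq> N" by auto
  moreover have "N \<in> null_sets lebesgue" using N negligible_iff_null_sets by blast
  ultimately show ?thesis by (intro AE_I'[of N]) auto
qed

text \<open>
  Intervals with rational end points cover an open set and are countable in number.
\<close>

lemma AE_on_open_real:
  assumes "open S"
    and loc: "\<And>a b. {a..b} \<subseteq> S \<Longrightarrow> AE x in lebesgue. x \<in> {a<..<b} \<longrightarrow> P (x::real)"
  shows "AE x in lebesgue. x \<in> S \<longrightarrow> P x"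
proof -
  let ?I = "{(a::rat, b::rat). {of_rat a..of_rat b} \<subseteq> S}"
  have "AE x in lebesgue. \<forall>i\<in>?I. x \<in> {of_rat (fst i)<..<of_rat (snd i)} \<longrightarrow> P x"
  proof (subst AE_ball_countable)
    show "countable ?I" by (rule countableI_type)
    show "\<forall>i\<in>?I. AE x in lebesgue. x \<in> {of_rat (fst i)<..<of_rat (snd i)} \<longrightarrow> P x"
      using loc by fastforce
  qed
  then show ?thesis
  proof (rule eventually_mono)
    fix x assume *: "\<forall>i\<in>?I. x \<in> {of_rat (fst i)<..<of_rat (snd i)} \<longrightarrow> P x"
    show "x \<in> S \<longrightarrow> P x"
    proof
      assume "x \<in> S"
      then obtain e where e: "e > 0" "cball x e \<subseteq> S" using \<open>open S\<close> open_contains_cball by blast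
      obtain a b where "x - e < of_rat a" "of_rat a < x" "x < of_rat b" "of_rat b < x + e"
        using of_rat_dense[of "x - e" x] of_rat_dense[of x "x + e"] e(1) by auto
      then show "P x" using *[rule_format, of "(a, b)"] e(2) by (auto simp: cball_eq_atLeastAtMost subset_eq)
    qed
  qed
qed

text \<open>
  Bumps tend to indicator functions of intervals, so \<open>h\<close> has integral \<open>0\<close> over every compact subinterval.
\<close>

lemma bump_orthogonal_imp_AE_zero:
  fixes h :: "real \<Rightarrow> complex"
  assumes h: "locally_integrable S h" and "open S"
    and orth: "\<And>n a b. {a..b} \<subseteq> S \<Longrightarrow> (LINT x:S|lebesgue. h x * of_real (bump n a b x)) = 0"
  shows "AE x in lebesgue. x \<in> S \<longrightarrow> h x = 0"
proof (rule AE_on_open_real[OF \<open>open S\<close>], rule zero_on_subintervals_imp_AE_zero)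
  fix a b assume sub: "{a..b} \<subseteq> S"
  show "set_integrable lebesgue {a..b} h"
    using h sub unfolding locally_integrable_def by blast
  fix c d assume cd: "a < c" "c < d" "d < b"
  have sub': "{c..d} \<subseteq> S" using sub cd by auto
  have "(\<lambda>n. 0) \<longlonglongrightarrow> (LINT x:{c<..<d}|lebesgue. h x)"
    using bump_integral_tendsto[OF h sub'] orth[OF sub'] by simp
  then have "(LINT x:{c<..<d}|lebesgue. h x) = 0" by (simp add: LIMSEQ_const_iff)
  moreover have "(LINT x:{c<..<d}|lebesgue. h x) = (LINT x:{c..d}|lebesgue. h x)"
  proof (rule set_integral_cong_set)
    have int: "set_integrable lebesgue {c..d} h"
      using h sub' unfolding locally_integrable_def by blast
    then show "set_borel_measurable lebesgue {c..d} h"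
      unfolding set_integrable_def set_borel_measurable_def by (rule borel_measurable_integrable)
    have "set_integrable lebesgue {c<..<d} h"
      by (rule set_integrable_subset[OF int]) auto
    then show "set_borel_measurable lebesgue {c<..<d} h"
      unfolding set_integrable_def set_borel_measurable_def by (rule borel_measurable_integrable)
    have "AE x in lebesgue. x \<noteq> c \<and> x \<noteq> d"
      using AE_lborel_singleton[of c] AE_lborel_singleton[of d] by (intro AE_completion) auto
    then show "AE x in lebesgue. x \<in> {c..d} \<longleftrightarrow> x \<in> {c<..<d}" by (rule eventually_mono) auto
  qed
  ultimately show "(LINT x:{c..d}|lebesgue. h x) = 0" by simp
qed

text \<open>
  Substituting \<open>x = z + \<sigma> y / n\<close> removes the scale from the derivative of the step, which is then an
  integrable majorant. The sign \<open>\<sigma>\<close> distinguishes the left from the right end of an interval.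
\<close>

lemma endpoint_kernel_integral_tendsto:
  fixes F :: "real \<Rightarrow> complex"
  assumes F[measurable]: "F \<in> borel_measurable borel" and bd: "\<And>x. norm (F x) \<le> C"
    and \<sigma>: "\<sigma> = 1 \<or> \<sigma> = -1" and c: "0 < c"
    and lim: "\<And>y. 0 < y \<Longrightarrow> (\<lambda>n. F (z + \<sigma> * y / real n)) \<longlonglongrightarrow> L"
  shows "(\<lambda>n. LINT x|lborel. F x * of_real (endpoint_kernel n c (\<sigma> * (x - z)))) \<longlonglongrightarrow> L"
proof -
  let ?g = "\<lambda>n y. F (z + \<sigma> * y / real n) * of_real (smooth_step' y * smooth_step (real n * c - y))"
  have "(LINT x|lborel. F x * of_real (endpoint_kernel n c (\<sigma> * (x - z)))) = (LINT y|lborel. ?g n y)" if n: "0 < n" for n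
  proof -
    have s: "\<sigma> * \<sigma> = 1" "\<bar>\<sigma>\<bar> = 1" "\<sigma> / real n \<noteq> 0" using \<sigma> n by auto
    have "(LINT x|lborel. F x * of_real (endpoint_kernel n c (\<sigma> * (x - z))))
        = (1 / real n) *\<^sub>R (LINT y|lborel. F (z + \<sigma> / real n * y) * of_real (endpoint_kernel n c (\<sigma> * (z + \<sigma> / real n * y - z))))"
      using s n by (subst lborel_integral_real_affine[OF s(3), where t = z]) (simp add: abs_mult)
    also have "\<dots> = (LINT y|lborel. (1 / real n) *\<^sub>R (F (z + \<sigma> / real n * y) * of_real (endpoint_kernel n c (\<sigma> * (z + \<sigma> / real n * y - z)))))"
      by (rule integral_scaleR_right[symmetric])
    also have "\<dots> = (LINT y|lborel. ?g n y)"
    proof (rule Bochner_Integration.integral_cong[OF HOL.refl])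
      fix y
      have 1: "real n * (\<sigma> * (z + \<sigma> / real n * y - z)) = y" using s n by (simp add: field_simps)
      have 2: "real n * (c - \<sigma> * (z + \<sigma> / real n * y - z)) = real n * c - y" using s n by (simp add: field_simps)
      show "(1 / real n) *\<^sub>R (F (z + \<sigma> / real n * y) * of_real (endpoint_kernel n c (\<sigma> * (z + \<sigma> / real n * y - z)))) = ?g n y"
        unfolding endpoint_kernel_def 1 2 using n by (simp add: scaleR_conv_of_real)
    qed
    finally show ?thesis .
  qed
  then have ev: "\<forall>\<^sub>F n in sequentially. (LINT y|lborel. ?g n y) = (LINT x|lborel. F x * of_real (endpoint_kernel n c (\<sigma> * (x - z))))"
    by (intro eventually_mono[OF eventually_gt_at_top[of 0]]) simp
  have "(\<lambda>n. LINT y|lborel. ?g n y) \<longlonglongrightarrow> (LINT y|lborel. L * of_real (smooth_step' y))"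
  proof (rule integral_dominated_convergence[where w = "\<lambda>y. C * smooth_step' y"])
    show "integrable lborel (\<lambda>y. C * smooth_step' y)"
      using has_bochner_integral_smooth_step' by (auto simp: has_bochner_integral_iff)
    show "AE y in lborel. norm (?g n y) \<le> C * smooth_step' y" for n
    proof (rule AE_I2)
      fix y
      have "norm (?g n y) = norm (F (z + \<sigma> * y / real n)) * (smooth_step' y * smooth_step (real n * c - y))"
        using smooth_step'_nonneg[of y] smooth_step_bounds[of "real n * c - y"] by (simp add: norm_mult)
      also have "\<dots> \<le> C * (smooth_step' y * 1)"
        using bd[of z] norm_ge_zero[of "F z"]
        by (intro mult_mono bd mult_left_mono smooth_step_bounds smooth_step'_nonneg mult_nonneg_nonneg) linarith+
      finally show "norm (?g n y) \<le> C * smooth_step' y" by simp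
    qed
    show "AE y in lborel. (\<lambda>n. ?g n y) \<longlonglongrightarrow> L * of_real (smooth_step' y)"
    proof (rule AE_I2)
      fix y
      show "(\<lambda>n. ?g n y) \<longlonglongrightarrow> L * of_real (smooth_step' y)"
      proof (cases "0 < y")
        case True
        have "filterlim (\<lambda>n. real n * c) at_top sequentially"
          using c by (intro filterlim_at_top_mult_tendsto_pos[OF tendsto_const] filterlim_real_sequentially)
        then have "filterlim (\<lambda>n. (- y) + real n * c) at_top sequentially"
          by (rule filterlim_tendsto_add_at_top[OF tendsto_const])
        then have "(\<lambda>n. smooth_step (- y + real n * c)) \<longlonglongrightarrow> 1"
          by (rule filterlim_compose[OF smooth_step_tendsto_1])
        then have "(\<lambda>n. ?g n y) \<longlonglongrightarrow> L * of_real (smooth_step' y * 1)"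
          by (intro tendsto_mult lim[OF True] tendsto_of_real tendsto_const) (simp add: algebra_simps)
        then show ?thesis by simp
      qed (simp add: smooth_step'_nonpos)
    qed
  qed measurable
  moreover have "(LINT y|lborel. L * of_real (smooth_step' y)) = L"
    using has_bochner_integral_smooth_step' by (simp add: has_bochner_integral_iff)
  ultimately have "(\<lambda>n. LINT y|lborel. ?g n y) \<longlonglongrightarrow> L" by (simp only:)
  then show ?thesis using ev by (rule Lim_transform_eventually)
qed

text \<open>
  Test the weak derivative against bumps on \<open>(a, b)\<close>: the left-hand side tends to \<open>f a - f b\<close>, the
  right-hand side to minus the integral of \<open>g\<close>.
\<close>

lemma weak_deriv_imp_integral:
  assumes wd: "has_weak_deriv S f g" and cont: "continuous_on S f"
    and sub: "{a..b} \<subseteq> S" and "a < b"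
  shows "f b - f a = (LINT x:{a<..<b}|lebesgue. g x)"
proof -
  \<comment> \<open>Cutting off at the end points keeps \<open>f\<close> bounded and Borel; the bumps vanish outside \<open>(a, b)\<close>.\<close>
  define F where "F x = indicator {a..b} x *\<^sub>R f x" for x
  have contF: "continuous_on {a..b} f" using cont sub continuous_on_subset by blast
  have F[measurable]: "F \<in> borel_measurable borel"
    unfolding F_def[abs_def]
    by (rule borel_measurable_continuous_on_indicator) (use contF in auto)
  have "bounded (f ` {a..b})" by (intro compact_imp_bounded compact_continuous_image contF) simp
  then obtain C where C: "\<And>x. x \<in> {a..b} \<Longrightarrow> norm (f x) \<le> C" unfolding bounded_iff by (metis imageI)
  have "0 \<le> C" using order_trans[OF norm_ge_zero C[of a]] \<open>a < b\<close> by simp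
  then have bd: "norm (F x) \<le> C" for x using C by (simp add: F_def indicator_def)
  let ?I = "\<lambda>\<sigma> p n. LINT x|lborel. F x * of_real (endpoint_kernel n (b - a) (\<sigma> * (x - p)))"
  have lim: "?I \<sigma> p \<longlonglongrightarrow> f p" if "\<sigma> = 1 \<and> p = a \<or> \<sigma> = -1 \<and> p = b" for \<sigma> p
  proof (rule endpoint_kernel_integral_tendsto[OF F bd])
    fix y :: real assume y: "0 < y"
    have seq: "(\<lambda>n. \<sigma> * y / real n) \<longlonglongrightarrow> 0" "(\<lambda>n. y / real n) \<longlonglongrightarrow> 0" by (rule lim_const_over_n)+
    have "\<forall>\<^sub>F n in sequentially. y / real n < b - a"
      by (rule order_tendstoD(2)[OF seq(2)]) (use \<open>a < b\<close> in simp)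
    then have ev: "\<forall>\<^sub>F n in sequentially. p + \<sigma> * y / real n \<in> {a..b}"
      by (rule eventually_mono) (use y that \<open>a < b\<close> in auto)
    have "(\<lambda>n. f (p + \<sigma> * y / real n)) \<longlonglongrightarrow> f p"
      by (rule continuous_on_tendsto_compose[OF contF _ _ ev])
         (use tendsto_add[OF tendsto_const[of p] seq(1)] that \<open>a < b\<close> in auto)
    then show "(\<lambda>n. F (p + \<sigma> * y / real n)) \<longlonglongrightarrow> f p"
      by (rule Lim_transform_eventually) (rule eventually_mono[OF ev], simp add: F_def)
  qed (use that \<open>a < b\<close> in auto)
  have intF: "integrable lborel (\<lambda>x. F x * of_real (endpoint_kernel n (b - a) (\<sigma> * (x - p))))" for n \<sigma> p
  proof -
    have "set_integrable lborel {a..b} (\<lambda>x. f x * of_real (endpoint_kernel n (b - a) (\<sigma> * (x - p))))"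
      by (rule borel_integrable_atLeastAtMost')
         (intro continuous_intros contF continuous_on_compose2[OF endpoint_kernel_continuous[of UNIV]]; simp)
    then show ?thesis by (simp add: F_def set_integrable_def)
  qed
  have split: "(LINT x:S|lebesgue. f x * of_real (deriv (bump n a b) x)) = ?I 1 a n - ?I (-1) b n" for n
  proof -
    have "(LINT x:S|lebesgue. f x * of_real (deriv (bump n a b) x)) = (LINT x|lebesgue. F x * of_real (bump' n a b x))"
      unfolding set_lebesgue_integral_def F_def deriv_bump
      using sub bump'_outside[of _ a b n]
      by (intro Bochner_Integration.integral_cong HOL.refl) (auto simp: indicator_def)
    also have "(\<lambda>x. F x * of_real (bump' n a b x)) = (\<lambda>x. F x * of_real (endpoint_kernel n (b - a) (1 * (x - a)))
        - F x * of_real (endpoint_kernel n (b - a) ((-1) * (x - b))))"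
      by (rule ext) (simp add: bump'_def algebra_simps)
    also have "integral\<^sup>L lebesgue \<dots> = integral\<^sup>L lborel \<dots>"
      by (rule integral_completion)
         (rule borel_measurable_integrable[OF Bochner_Integration.integrable_diff[OF intF intF]])
    also have "\<dots> = ?I 1 a n - ?I (-1) b n"
      by (rule Bochner_Integration.integral_diff[OF intF intF])
    finally show ?thesis .
  qed
  have g: "locally_integrable S g" using wd by (simp add: has_weak_deriv_def)
  have "(LINT x:S|lebesgue. f x * of_real (deriv (bump n a b) x)) = - (LINT x:S|lebesgue. g x * of_real (bump n a b x))" for n
    using wd test_function_bump[OF sub] by (simp add: has_weak_deriv_def)
  then have "(\<lambda>n. ?I 1 a n - ?I (-1) b n) \<longlonglongrightarrow> - (LINT x:{a<..<b}|lebesgue. g x)"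
    using tendsto_minus[OF bump_integral_tendsto[OF g sub]] unfolding split by simp
  moreover have "(\<lambda>n. ?I 1 a n - ?I (-1) b n) \<longlonglongrightarrow> f a - f b"
    by (intro tendsto_diff lim) simp_all
  ultimately have "f a - f b = - (LINT x:{a<..<b}|lebesgue. g x)" by (rule LIMSEQ_unique[rotated])
  then show ?thesis by (metis minus_diff_eq minus_minus)
qed

section \<open>Weak derivatives on an open subset of the line\<close>

lemma test_function_properties:
  assumes "test_function S \<phi>"
  obtains K C where "compact K" "K \<subseteq> S" "\<And>x. x \<notin> K \<Longrightarrow> \<phi> x = 0" "\<And>x. x \<notin> K \<Longrightarrow> deriv \<phi> x = 0"
    "\<And>x. \<bar>\<phi> x\<bar> \<le> C" "\<And>x. \<bar>deriv \<phi> x\<bar> \<le> C" "0 \<le> C"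
    "\<And>x. DERIV \<phi> x :> deriv \<phi> x" "continuous_on UNIV \<phi>" "continuous_on UNIV (deriv \<phi>)"
proof -
  let ?K = "closure {x. \<phi> x \<noteq> 0}"
  have sm: "(deriv ^^ n) \<phi> field_differentiable at x" for n x
    using assms by (simp add: test_function_def)
  have K: "compact ?K" "?K \<subseteq> S" using assms by (simp_all add: test_function_def)
  have D: "DERIV \<phi> x :> deriv \<phi> x" for x
    using field_differentiable_derivI[OF sm[of 0 x]] by simp
  have D': "DERIV (deriv \<phi>) x :> deriv (deriv \<phi>) x" for x
    using field_differentiable_derivI[OF sm[of 1 x]] by simp
  have c: "continuous_on A \<phi>" for A
    using D by (meson DERIV_isCont continuous_at_imp_continuous_on)
  have c': "continuous_on A (deriv \<phi>)" for A
    using D' by (meson DERIV_isCont continuous_at_imp_continuous_on)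
  have z: "\<phi> x = 0" if "x \<notin> ?K" for x using that closure_subset[of "{x. \<phi> x \<noteq> 0}"] by auto
  have z': "deriv \<phi> x = 0" if "x \<notin> ?K" for x
  proof -
    have "(\<phi> has_field_derivative 0) (at x)"
    proof (rule has_field_derivative_transform_within_open[of "\<lambda>_. 0" 0 x "- ?K"])
      show "open (- ?K)" by (intro open_Compl closed_closure)
      show "x \<in> - ?K" using that by simp
      show "0 = \<phi> y" if "y \<in> - ?K" for y by (rule z[symmetric]) (use that in blast)
    qed (rule DERIV_const)
    then show ?thesis by (rule DERIV_imp_deriv)
  qed
  have "bounded (\<phi> ` ?K)" "bounded (deriv \<phi> ` ?K)"
    by (intro compact_imp_bounded compact_continuous_image c c' K)+
  then obtain B B' where "\<And>x. x \<in> ?K \<Longrightarrow> \<bar>\<phi> x\<bar> \<le> B" "\<And>x. x \<in> ?K \<Longrightarrow> \<bar>deriv \<phi> x\<bar> \<le> B'"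
    unfolding bounded_iff by (metis imageI real_norm_def)
  note B = this
  define C where "C = max 0 (max B B')"
  have C': "\<bar>\<phi> x\<bar> \<le> C \<and> \<bar>deriv \<phi> x\<bar> \<le> C" for x
    using B[of x] z[of x] z'[of x] by (cases "x \<in> ?K") (simp_all add: C_def le_max_iff_disj)
  have C: "\<bar>\<phi> x\<bar> \<le> C" "\<bar>deriv \<phi> x\<bar> \<le> C" for x
    using C'[of x] by (blast, blast)
  have "0 \<le> C" by (simp add: C_def)
  show ?thesis
    by (rule that[OF K z z' C \<open>0 \<le> C\<close> D c c'])
qed

lemma integrable_times_bounded:
  fixes f :: "real \<Rightarrow> complex" and \<psi> :: "real \<Rightarrow> real"
  assumes f: "set_integrable lebesgue K f" and \<psi>: "\<psi> \<in> borel_measurable borel" "\<And>x. \<bar>\<psi> x\<bar> \<le> C"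
  shows "set_integrable lebesgue K (\<lambda>x. f x * of_real (\<psi> x))"
proof -
  have int: "integrable lebesgue (\<lambda>x. indicator K x *\<^sub>R f x)" using f by (simp add: set_integrable_def)
  have m: "\<psi> \<in> borel_measurable lebesgue" by (rule measurable_completion) (simp add: \<psi>)
  have C: "0 \<le> C" using \<psi>(2)[of 0] by linarith
  have "integrable lebesgue (\<lambda>x. (indicator K x *\<^sub>R f x) * of_real (\<psi> x))"
  proof (rule Bochner_Integration.integrable_bound)
    show "integrable lebesgue (\<lambda>x. C *\<^sub>R (indicator K x *\<^sub>R f x))"
      using int by (rule integrable_scaleR_right)
    show "(\<lambda>x. (indicator K x *\<^sub>R f x) * complex_of_real (\<psi> x)) \<in> borel_measurable lebesgue"
      by (intro borel_measurable_times measurable_compose[OF m borel_measurable_of_real] borel_measurable_integrable[OF int])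
    show "AE x in lebesgue. norm ((indicator K x *\<^sub>R f x) * complex_of_real (\<psi> x)) \<le> norm (C *\<^sub>R (indicator K x *\<^sub>R f x))"
    proof (rule AE_I2)
      fix x
      have "norm ((indicator K x *\<^sub>R f x) * complex_of_real (\<psi> x)) = norm (indicator K x *\<^sub>R f x) * \<bar>\<psi> x\<bar>"
        by (simp add: norm_mult)
      also have "\<dots> \<le> norm (indicator K x *\<^sub>R f x) * C"
        by (rule mult_left_mono[OF \<psi>(2)]) simp
      also have "\<dots> = norm (C *\<^sub>R (indicator K x *\<^sub>R f x))"
        by (subst norm_scaleR) (simp only: abs_of_nonneg[OF C] mult.commute)
      finally show "norm ((indicator K x *\<^sub>R f x) * complex_of_real (\<psi> x)) \<le> norm (C *\<^sub>R (indicator K x *\<^sub>R f x))" .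
    qed
  qed
  then show ?thesis by (simp add: set_integrable_def mult.assoc)
qed

lemma supported_integral:
  fixes f :: "real \<Rightarrow> complex" and \<psi> :: "real \<Rightarrow> real"
  assumes f: "locally_integrable S f" and K: "compact K" "K \<subseteq> S"
    and \<psi>: "continuous_on UNIV \<psi>" "\<And>x. \<bar>\<psi> x\<bar> \<le> C" "\<And>x. x \<notin> K \<Longrightarrow> \<psi> x = 0"
  shows "set_integrable lebesgue S (\<lambda>x. f x * of_real (\<psi> x))" (is ?i)
    and "(LINT x:S|lebesgue. f x * of_real (\<psi> x)) = (LINT x:K|lebesgue. f x * of_real (\<psi> x))"
    and "cmod (LINT x:S|lebesgue. f x * of_real (\<psi> x)) \<le> C * (LINT x:K|lebesgue. cmod (f x))"
proof -
  have eq: "indicator S x *\<^sub>R (f x * of_real (\<psi> x)) = indicator K x *\<^sub>R (f x * of_real (\<psi> x))" for x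
    using K(2) \<psi>(3)[of x] by (auto simp: indicator_def)
  have fK: "set_integrable lebesgue K f" using f K by (auto simp: locally_integrable_def)
  have m: "\<psi> \<in> borel_measurable borel" using \<psi>(1) by (rule borel_measurable_continuous_onI)
  have i: "set_integrable lebesgue K (\<lambda>x. f x * of_real (\<psi> x))"
    by (rule integrable_times_bounded[OF fK m \<psi>(2)])
  then show ?i unfolding set_integrable_def eq .
  show eqi: "(LINT x:S|lebesgue. f x * of_real (\<psi> x)) = (LINT x:K|lebesgue. f x * of_real (\<psi> x))"
    unfolding set_lebesgue_integral_def eq ..
  have "cmod (LINT x:K|lebesgue. f x * of_real (\<psi> x)) \<le> (LINT x|lebesgue. C * (indicator K x *\<^sub>R cmod (f x)))"
    unfolding set_lebesgue_integral_def
  proof (rule Bochner_Integration.integral_norm_bound_integral)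
    show "integrable lebesgue (\<lambda>x. indicator K x *\<^sub>R (f x * complex_of_real (\<psi> x)))"
      using i by (simp add: set_integrable_def)
    have "integrable lebesgue (\<lambda>x. indicator K x *\<^sub>R cmod (f x))"
      using set_integrable_norm[OF fK] by (simp add: set_integrable_def)
    then show "integrable lebesgue (\<lambda>x. C * (indicator K x *\<^sub>R cmod (f x)))" by (rule integrable_mult_right)
    show "cmod (indicator K x *\<^sub>R (f x * complex_of_real (\<psi> x))) \<le> C * (indicator K x *\<^sub>R cmod (f x))" for x
      using mult_right_mono[OF \<psi>(2)[of x] norm_ge_zero[of "f x"]]
      by (simp add: norm_mult mult.commute indicator_def)
  qed
  then show "cmod (LINT x:S|lebesgue. f x * of_real (\<psi> x)) \<le> C * (LINT x:K|lebesgue. cmod (f x))"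
    unfolding eqi by (simp add: set_lebesgue_integral_def)
qed

lemma locally_integrable_lincomb:
  assumes "locally_integrable S f" "locally_integrable S f'"
  shows "locally_integrable S (\<lambda>x. s * f x + t * f' x)"
  unfolding locally_integrable_def
proof (intro allI impI)
  fix K assume "compact K \<and> K \<subseteq> S"
  then have "set_integrable lebesgue K f" "set_integrable lebesgue K f'"
    using assms unfolding locally_integrable_def by blast+
  then show "set_integrable lebesgue K (\<lambda>x. s * f x + t * f' x)"
    by (intro set_integral_add(1) set_integrable_mult_right)
qed

lemma has_weak_deriv_lincomb:
  assumes "has_weak_deriv S f g" "has_weak_deriv S f' g'"
  shows "has_weak_deriv S (\<lambda>x. s * f x + t * f' x) (\<lambda>x. s * g x + t * g' x)"
proof -
  have L: "locally_integrable S f" "locally_integrable S g" "locally_integrable S f'" "locally_integrable S g'"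
    using assms by (auto simp: has_weak_deriv_def)
  have "(LINT x:S|lebesgue. (s * f x + t * f' x) * of_real (deriv \<phi> x))
      = - (LINT x:S|lebesgue. (s * g x + t * g' x) * of_real (\<phi> x))" if \<phi>: "test_function S \<phi>" for \<phi>
  proof -
    obtain K C where K: "compact K" "K \<subseteq> S" "\<And>x. x \<notin> K \<Longrightarrow> \<phi> x = 0" "\<And>x. x \<notin> K \<Longrightarrow> deriv \<phi> x = 0"
      "\<And>x. \<bar>\<phi> x\<bar> \<le> C" "\<And>x. \<bar>deriv \<phi> x\<bar> \<le> C" "continuous_on UNIV \<phi>" "continuous_on UNIV (deriv \<phi>)"
      using test_function_properties[OF \<phi>] by metis
    have split: "(LINT x:S|lebesgue. (s * h x + t * h' x) * of_real (\<psi> x))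
        = s * (LINT x:S|lebesgue. h x * of_real (\<psi> x)) + t * (LINT x:S|lebesgue. h' x * of_real (\<psi> x))"
      if "set_integrable lebesgue S (\<lambda>x. h x * of_real (\<psi> x))" "set_integrable lebesgue S (\<lambda>x. h' x * of_real (\<psi> x))"
      for h h' :: "real \<Rightarrow> complex" and \<psi>
    proof -
      have e: "(s * h x + t * h' x) * of_real (\<psi> x) = s * (h x * of_real (\<psi> x)) + t * (h' x * of_real (\<psi> x))" for x
        by (simp add: algebra_simps)
      show ?thesis
        unfolding e
        by (subst set_integral_add(2)) (use that in \<open>auto intro: set_integrable_mult_right\<close>)
    qed
    have "set_integrable lebesgue S (\<lambda>x. h x * of_real (\<phi> x))" "set_integrable lebesgue S (\<lambda>x. h x * of_real (deriv \<phi> x))"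
      if "locally_integrable S h" for h
      using supported_integral(1)[OF that K(1,2)] K by blast+
    then show ?thesis
      using L assms \<phi> by (simp add: split has_weak_deriv_def)
  qed
  then show ?thesis using L by (simp add: has_weak_deriv_def locally_integrable_lincomb)
qed

text \<open>
  The difference of two weak derivatives is orthogonal to all bumps. Allowing the functions to differ
  on a null set makes the statement applicable to classes in \<open>L\<^sup>2\<close>.
\<close>

lemma has_weak_deriv_unique:
  assumes "open S" and wd: "has_weak_deriv S f g" "has_weak_deriv S f' g'"
    and eq: "AE x in lebesgue. x \<in> S \<longrightarrow> f x = f' x"
  shows "AE x in lebesgue. x \<in> S \<longrightarrow> g x = g' x"
proof -
  have wd: "has_weak_deriv S (\<lambda>x. 1 * f x + (-1) * f' x) (\<lambda>x. 1 * g x + (-1) * g' x)"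
    by (rule has_weak_deriv_lincomb) (use wd in auto)
  have "AE x in lebesgue. x \<in> S \<longrightarrow> 1 * g x + (-1) * g' x = 0"
  proof (rule bump_orthogonal_imp_AE_zero[OF _ \<open>open S\<close>])
    show "locally_integrable S (\<lambda>x. 1 * g x + (-1) * g' x)" using wd by (simp add: has_weak_deriv_def)
    fix n a b assume "{a..b} \<subseteq> S"
    then have "(LINT x:S|lebesgue. (1 * g x + (-1) * g' x) * of_real (bump n a b x))
      = - (LINT x:S|lebesgue. (1 * f x + (-1) * f' x) * of_real (deriv (bump n a b) x))"
      using wd test_function_bump[of a b S n] by (simp add: has_weak_deriv_def)
    also have "(LINT x:S|lebesgue. (1 * f x + (-1) * f' x) * of_real (deriv (bump n a b) x)) = 0"
      unfolding set_lebesgue_integral_def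
      by (rule integral_eq_zero_AE) (use eq in \<open>eventually_elim; simp add: indicator_def\<close>)
    finally show "(LINT x:S|lebesgue. (1 * g x + (-1) * g' x) * of_real (bump n a b x)) = 0" by simp
  qed
  then show ?thesis by (rule eventually_mono) auto
qed

lemma integrable_lborel_imp_lebesgue:
  fixes f :: "real \<Rightarrow> 'a::{banach, second_countable_topology}"
  assumes "set_integrable lborel A f" shows "set_integrable lebesgue A f"
    "(LINT x:A|lebesgue. f x) = (LINT x:A|lborel. f x)"
proof -
  have "integrable lborel (\<lambda>x. indicator A x *\<^sub>R f x)" using assms by (simp add: set_integrable_def)
  then have "(\<lambda>x. indicator A x *\<^sub>R f x) \<in> borel_measurable lborel" by (rule borel_measurable_integrable)
  then show "set_integrable lebesgue A f" "(LINT x:A|lebesgue. f x) = (LINT x:A|lborel. f x)"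
    using assms by (simp_all add: set_integrable_def set_lebesgue_integral_def integrable_completion integral_completion)
qed

lemma continuous_imp_locally_integrable:
  fixes f :: "real \<Rightarrow> complex"
  assumes "continuous_on S f" shows "locally_integrable S f"
  unfolding locally_integrable_def
proof (intro allI impI)
  fix K assume K: "compact K \<and> K \<subseteq> S"
  then have "continuous_on K f" using assms continuous_on_subset by blast
  then have "set_integrable lborel K f"
    unfolding set_integrable_def using K by (intro borel_integrable_compact) auto
  then show "set_integrable lebesgue K f" by (rule integrable_lborel_imp_lebesgue)
qed

lemma bump_has_weak_deriv:
  assumes sub: "{a..b} \<subseteq> S"
  shows "has_weak_deriv S (\<lambda>x. of_real (bump n a b x)) (\<lambda>x. of_real (bump' n a b x))"
proof -
  have cont': "continuous_on A (bump' n a b)" for A by (rule bump'_continuous)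
  have "(LINT x:S|lebesgue. of_real (bump n a b x) * of_real (deriv \<phi> x))
      = - (LINT x:S|lebesgue. complex_of_real (bump' n a b x) * of_real (\<phi> x))"
    if \<phi>: "test_function S \<phi>" for \<phi>
  proof -
    obtain D: "\<And>x. DERIV \<phi> x :> deriv \<phi> x" and c: "continuous_on UNIV \<phi>" "continuous_on UNIV (deriv \<phi>)"
      using test_function_properties[OF \<phi>] by metis
    have c: "continuous_on A \<phi>" "continuous_on A (deriv \<phi>)" for A
      using c continuous_on_subset by blast+
    have red: "(LINT x:S|lebesgue. complex_of_real (p x) * of_real (r x)) = of_real (LINT x:{a..b}|lborel. p x * r x)"
      "set_integrable lborel {a..b} (\<lambda>x. p x * r x)"
      if "\<And>x. x \<notin> {a..b} \<Longrightarrow> p x = 0" "continuous_on {a..b} p" "continuous_on {a..b} r" for p r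
    proof -
      show i: "set_integrable lborel {a..b} (\<lambda>x. p x * r x)"
        by (rule borel_integrable_atLeastAtMost') (intro continuous_on_mult that)
      have "(LINT x:S|lebesgue. complex_of_real (p x) * of_real (r x)) = (LINT x|lebesgue. complex_of_real (indicator {a..b} x *\<^sub>R (p x * r x)))"
        unfolding set_lebesgue_integral_def
        by (rule Bochner_Integration.integral_cong) (use sub that(1) in \<open>auto simp: indicator_def\<close>)
      also have "\<dots> = of_real (LINT x:{a..b}|lebesgue. p x * r x)"
        unfolding set_lebesgue_integral_def
        by (rule integral_of_real) (use integrable_lborel_imp_lebesgue(1)[OF i] in \<open>simp add: set_integrable_def\<close>)
      finally show "(LINT x:S|lebesgue. complex_of_real (p x) * of_real (r x)) = of_real (LINT x:{a..b}|lborel. p x * r x)"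
        by (simp add: integrable_lborel_imp_lebesgue(2)[OF i])
    qed
    have z: "x \<notin> {a..b} \<Longrightarrow> bump n a b x = 0" "x \<notin> {a..b} \<Longrightarrow> bump' n a b x = 0" for x
      by (auto intro: bump_outside bump'_outside)
    have r1: "(LINT x:S|lebesgue. complex_of_real (bump n a b x) * of_real (deriv \<phi> x))
        = of_real (LINT x:{a..b}|lborel. bump n a b x * deriv \<phi> x)"
      "set_integrable lborel {a..b} (\<lambda>x. bump n a b x * deriv \<phi> x)"
      by (rule red; fact z bump_continuous c)+
    have r2: "(LINT x:S|lebesgue. complex_of_real (bump' n a b x) * of_real (\<phi> x))
        = of_real (LINT x:{a..b}|lborel. bump' n a b x * \<phi> x)"
      "set_integrable lborel {a..b} (\<lambda>x. bump' n a b x * \<phi> x)"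
      by (rule red; fact z cont' c)+
    have "(LINT x:{a..b}|lborel. bump n a b x * deriv \<phi> x) + (LINT x:{a..b}|lborel. bump' n a b x * \<phi> x)
        = (LINT x:{a..b}|lborel. bump n a b x * deriv \<phi> x + bump' n a b x * \<phi> x)"
      by (rule set_integral_add(2)[symmetric]) (use r1(2) r2(2) in auto)
    also have "\<dots> = 0"
    proof (cases "a \<le> b")
      case True
      have "(LINT x|lborel. indicator {a..b} x *\<^sub>R (bump n a b x * deriv \<phi> x + bump' n a b x * \<phi> x))
         = bump n a b b * \<phi> b - bump n a b a * \<phi> a"
      proof (rule integral_FTC_atLeastAtMost[OF True])
        fix x
        have "DERIV (\<lambda>x. bump n a b x * \<phi> x) x :> bump n a b x * deriv \<phi> x + bump' n a b x * \<phi> x"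
          using DERIV_mult[OF DERIV_bump[of n a b x] D[of x]] by (simp add: algebra_simps)
        then show "((\<lambda>x. bump n a b x * \<phi> x) has_vector_derivative bump n a b x * deriv \<phi> x + bump' n a b x * \<phi> x) (at x within {a..b})"
          by (simp add: has_real_derivative_iff_has_vector_derivative has_vector_derivative_at_within)
      qed (intro continuous_intros bump_continuous c cont')
      then show ?thesis by (simp add: set_lebesgue_integral_def bump_outside)
    qed (simp add: set_lebesgue_integral_def)
    finally show ?thesis unfolding r1(1) r2(1) by (simp add: eq_neg_iff_add_eq_0 flip: of_real_add)
  qed
  then show ?thesis
    by (auto simp: has_weak_deriv_def intro!: continuous_imp_locally_integrable continuous_intros bump_continuous cont')
qed

text \<open>
  Convergence in \<open>L\<^sup>1\<close> on compact sets suffices, since a test function is bounded with compact support.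
\<close>

lemma has_weak_deriv_limit:
  assumes wd: "\<And>n. has_weak_deriv S (f n) (g n)"
    and F: "locally_integrable S F" and G: "locally_integrable S G"
    and limF: "\<And>K. compact K \<Longrightarrow> K \<subseteq> S \<Longrightarrow> (\<lambda>n. LINT x:K|lebesgue. cmod (f n x - F x)) \<longlonglongrightarrow> 0"
    and limG: "\<And>K. compact K \<Longrightarrow> K \<subseteq> S \<Longrightarrow> (\<lambda>n. LINT x:K|lebesgue. cmod (g n x - G x)) \<longlonglongrightarrow> 0"
  shows "has_weak_deriv S F G"
proof -
  have L: "locally_integrable S (f n)" "locally_integrable S (g n)" for n
    using wd by (auto simp: has_weak_deriv_def)
  have "(LINT x:S|lebesgue. F x * of_real (deriv \<phi> x)) = - (LINT x:S|lebesgue. G x * of_real (\<phi> x))"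
    if \<phi>: "test_function S \<phi>" for \<phi>
  proof -
    obtain K C where K: "compact K" "K \<subseteq> S" "\<And>x. x \<notin> K \<Longrightarrow> \<phi> x = 0" "\<And>x. x \<notin> K \<Longrightarrow> deriv \<phi> x = 0"
      "\<And>x. \<bar>\<phi> x\<bar> \<le> C" "\<And>x. \<bar>deriv \<phi> x\<bar> \<le> C" "continuous_on UNIV \<phi>" "continuous_on UNIV (deriv \<phi>)"
      using test_function_properties[OF \<phi>] by metis
    have lim: "(\<lambda>n. LINT x:S|lebesgue. h n x * of_real (\<psi> x)) \<longlonglongrightarrow> (LINT x:S|lebesgue. H x * of_real (\<psi> x))"
      if h: "\<And>n. locally_integrable S (h n)" "locally_integrable S H"
        and lim: "(\<lambda>n. LINT x:K|lebesgue. cmod (h n x - H x)) \<longlonglongrightarrow> 0"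
        and \<psi>: "continuous_on UNIV \<psi>" "\<And>x. \<bar>\<psi> x\<bar> \<le> C" "\<And>x. x \<notin> K \<Longrightarrow> \<psi> x = 0"
      for h H \<psi>
    proof (rule LIM_zero_cancel, rule Lim_null_comparison)
      have d: "locally_integrable S (\<lambda>x. h n x - H x)" for n
        using locally_integrable_lincomb[OF h(1)[of n] h(2), of 1 "-1"] by simp
      have "(LINT x:S|lebesgue. h n x * of_real (\<psi> x)) - (LINT x:S|lebesgue. H x * of_real (\<psi> x))
          = (LINT x:S|lebesgue. (h n x - H x) * of_real (\<psi> x))" for n
        using set_integral_diff(2)[OF supported_integral(1)[OF h(1)[of n] K(1,2) \<psi>] supported_integral(1)[OF h(2) K(1,2) \<psi>]]
        by (simp add: algebra_simps)
      then show "\<forall>\<^sub>F n in sequentially. norm ((LINT x:S|lebesgue. h n x * of_real (\<psi> x)) - (LINT x:S|lebesgue. H x * of_real (\<psi> x)))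
          \<le> C * (LINT x:K|lebesgue. cmod (h n x - H x))"
        using supported_integral(3)[OF d K(1,2) \<psi>] by simp
      show "(\<lambda>n. C * (LINT x:K|lebesgue. cmod (h n x - H x))) \<longlonglongrightarrow> 0"
        using tendsto_mult_left[OF lim, of C] by simp
    qed
    have 1: "(\<lambda>n. LINT x:S|lebesgue. f n x * of_real (deriv \<phi> x)) \<longlonglongrightarrow> (LINT x:S|lebesgue. F x * of_real (deriv \<phi> x))"
      by (rule lim[OF L(1) F limF[OF K(1,2)] K(8,6,4)])
    have 2: "(\<lambda>n. LINT x:S|lebesgue. g n x * of_real (\<phi> x)) \<longlonglongrightarrow> (LINT x:S|lebesgue. G x * of_real (\<phi> x))"
      by (rule lim[OF L(2) G limG[OF K(1,2)] K(7,5,3)])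
    have "(LINT x:S|lebesgue. f n x * of_real (deriv \<phi> x)) = - (LINT x:S|lebesgue. g n x * of_real (\<phi> x))" for n
      using wd[of n] \<phi> by (simp add: has_weak_deriv_def)
    then show ?thesis using LIMSEQ_unique[OF 1] tendsto_minus[OF 2] by simp
  qed
  then show ?thesis using F G by (simp add: has_weak_deriv_def)
qed

section \<open>Square-integrable functions, and the measure on a disjoint union of edges\<close>

abbreviation sqnorm :: "'a measure \<Rightarrow> ('a \<Rightarrow> complex) \<Rightarrow> real" where
  "sqnorm M f \<equiv> LINT x|M. (cmod (f x))\<^sup>2"

abbreviation sqdist :: "'a measure \<Rightarrow> ('a \<Rightarrow> complex) \<Rightarrow> ('a \<Rightarrow> complex) \<Rightarrow> real" where
  "sqdist M f g \<equiv> LINT x|M. (cmod (f x - g x))\<^sup>2"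

definition square_integrable :: "'a measure \<Rightarrow> ('a \<Rightarrow> complex) \<Rightarrow> bool" where
  "square_integrable M f \<longleftrightarrow> f \<in> borel_measurable M \<and> integrable M (\<lambda>x. (cmod (f x))\<^sup>2)"

lemma cnj_measurable [measurable]: "cnj \<in> borel_measurable borel"
  by (intro borel_measurable_continuous_onI continuous_on_cnj continuous_on_id)

lemma square_integrable_lincomb:
  assumes "square_integrable M f" "square_integrable M g"
  shows "square_integrable M (\<lambda>x. s * f x + t * g x)"
proof -
  have [measurable]: "f \<in> borel_measurable M" "g \<in> borel_measurable M"
    and int: "integrable M (\<lambda>x. (cmod (f x))\<^sup>2)" "integrable M (\<lambda>x. (cmod (g x))\<^sup>2)"
    using assms by (auto simp: square_integrable_def)
  have "integrable M (\<lambda>x. (cmod (s * f x + t * g x))\<^sup>2)"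
  proof (rule Bochner_Integration.integrable_bound)
    show "integrable M (\<lambda>x. 2 * (cmod s)\<^sup>2 * (cmod (f x))\<^sup>2 + 2 * (cmod t)\<^sup>2 * (cmod (g x))\<^sup>2)"
      using int by (intro Bochner_Integration.integrable_add integrable_mult_right)
    have "(cmod (s * f x + t * g x))\<^sup>2 \<le> 2 * (cmod s)\<^sup>2 * (cmod (f x))\<^sup>2 + 2 * (cmod t)\<^sup>2 * (cmod (g x))\<^sup>2" for x
    proof -
      let ?a = "cmod s * cmod (f x)" and ?b = "cmod t * cmod (g x)"
      have "(cmod (s * f x + t * g x))\<^sup>2 \<le> (?a + ?b)\<^sup>2"
        using norm_triangle_ineq[of "s * f x" "t * g x"] by (intro power_mono) (auto simp: norm_mult)
      also have "\<dots> \<le> 2 * ?a\<^sup>2 + 2 * ?b\<^sup>2"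
        using zero_le_power2[of "?a - ?b"] by (simp add: power2_eq_square algebra_simps)
      finally show ?thesis by (simp add: power_mult_distrib)
    qed
    then show "AE x in M. norm ((cmod (s * f x + t * g x))\<^sup>2) \<le> norm (2 * (cmod s)\<^sup>2 * (cmod (f x))\<^sup>2 + 2 * (cmod t)\<^sup>2 * (cmod (g x))\<^sup>2)"
      by (intro AE_I2) simp
  qed measurable
  then show ?thesis by (simp add: square_integrable_def)
qed

lemma square_integrable_diff:
  "square_integrable M f \<Longrightarrow> square_integrable M g \<Longrightarrow> square_integrable M (\<lambda>x. f x - g x)"
  using square_integrable_lincomb[of M f g 1 "-1"] by simp

lemma square_integrable_prod:
  assumes "square_integrable M f" "square_integrable M g"
  shows "integrable M (\<lambda>x. f x * cnj (g x))"
proof (rule Bochner_Integration.integrable_bound)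
  have [measurable]: "f \<in> borel_measurable M" "g \<in> borel_measurable M"
    and int: "integrable M (\<lambda>x. (cmod (f x))\<^sup>2)" "integrable M (\<lambda>x. (cmod (g x))\<^sup>2)"
    using assms by (auto simp: square_integrable_def)
  show "integrable M (\<lambda>x. (cmod (f x))\<^sup>2 + (cmod (g x))\<^sup>2)"
    using int by (rule Bochner_Integration.integrable_add)
  show "(\<lambda>x. f x * cnj (g x)) \<in> borel_measurable M" by measurable
  have "cmod (f x) * cmod (g x) \<le> (cmod (f x))\<^sup>2 + (cmod (g x))\<^sup>2" for x
    using zero_le_power2[of "cmod (f x) - cmod (g x)"] zero_le_power2[of "cmod (f x)"]
    by (simp add: power2_eq_square algebra_simps) (smt (verit) mult_nonneg_nonneg norm_ge_zero)
  then show "AE x in M. norm (f x * cnj (g x)) \<le> norm ((cmod (f x))\<^sup>2 + (cmod (g x))\<^sup>2)"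
    by (intro AE_I2) (simp add: norm_mult)
qed

lemma square_integrable_form:
  "pos_form {f. square_integrable M f} (\<lambda>f g x. f x + g x) (\<lambda>c f x. c * f x)
     (\<lambda>f g. LINT x|M. f x * cnj (g x))"
proof
  show "{f. square_integrable M f} \<noteq> {}"
    by (auto simp: square_integrable_def intro!: exI[of _ "\<lambda>_. 0"])
  fix f g h assume fg: "f \<in> {f. square_integrable M f}" "g \<in> {f. square_integrable M f}"
  show "(\<lambda>x. f x + g x) \<in> {f. square_integrable M f}"
    using fg square_integrable_lincomb[of M f g 1 1] by simp
  show "(LINT x|M. g x * cnj (f x)) = cnj (LINT x|M. f x * cnj (g x))"
    using integral_bounded_linear[OF bounded_linear_cnj square_integrable_prod[of M f g]] fg
    by (simp add: mult.commute)
  show "(LINT x|M. c * f x * cnj (g x)) = c * (LINT x|M. f x * cnj (g x))" for c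
    by (simp add: mult.assoc)
  assume "h \<in> {f. square_integrable M f}"
  then show "(LINT x|M. (f x + g x) * cnj (h x)) = (LINT x|M. f x * cnj (h x)) + (LINT x|M. g x * cnj (h x))"
    using fg by (simp add: distrib_right square_integrable_prod)
next
  fix f c assume f: "f \<in> {f. square_integrable M f}"
  show "(\<lambda>x. c * f x) \<in> {f. square_integrable M f}"
    using f square_integrable_lincomb[of M f f c 0] by simp
  have "(LINT x|M. f x * cnj (f x)) = complex_of_real (sqnorm M f)"
    by (subst integral_complex_of_real[symmetric]) (simp only: complex_norm_square)
  then show "0 \<le> Re (LINT x|M. f x * cnj (f x))" by simp
qed

lemma Holder_2:
  assumes f: "square_integrable M f" and g: "square_integrable M g"
  shows "integrable M (\<lambda>x. cmod (f x) * cmod (g x))"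
    and "(LINT x|M. cmod (f x) * cmod (g x))\<^sup>2 \<le> sqnorm M f * sqnorm M g"
proof -
  interpret F: pos_form "{f. square_integrable M f}" "\<lambda>f g x. f x + g x" "\<lambda>c f x. c * f x"
     "\<lambda>f g. LINT x|M. f x * cnj (g x)" by (rule square_integrable_form)
  show i: "integrable M (\<lambda>x. cmod (f x) * cmod (g x))"
    using integrable_norm[OF square_integrable_prod[OF f g]] by (simp add: norm_mult)
  have n: "square_integrable M (\<lambda>x. complex_of_real (cmod (h x)))" if "square_integrable M h" for h
    using that unfolding square_integrable_def
    by (auto intro!: measurable_compose[OF _ borel_measurable_of_real] borel_measurable_norm)
  have "(cmod (LINT x|M. of_real (cmod (f x)) * cnj (of_real (cmod (g x)))))\<^sup>2
      \<le> Re (LINT x|M. of_real (cmod (f x)) * cnj (of_real (cmod (f x)))) * Re (LINT x|M. of_real (cmod (g x)) * cnj (of_real (cmod (g x))))"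
    by (rule F.Cauchy_Schwarz) (use n f g in auto)
  moreover have "(LINT x|M. complex_of_real (cmod (h x)) * cnj (of_real (cmod (k x)))) = of_real (LINT x|M. cmod (h x) * cmod (k x))" for h k
    by (subst integral_complex_of_real[symmetric]) simp
  ultimately show "(LINT x|M. cmod (f x) * cmod (g x))\<^sup>2 \<le> sqnorm M f * sqnorm M g"
    by (simp add: power2_eq_square)
qed

definition L2_Cauchy :: "'a measure \<Rightarrow> (nat \<Rightarrow> 'a \<Rightarrow> complex) \<Rightarrow> bool" where
  "L2_Cauchy M f \<longleftrightarrow> (\<forall>n. square_integrable M (f n)) \<and>
     (\<forall>\<epsilon>>0. \<exists>N. \<forall>m\<ge>N. \<forall>n\<ge>N. sqdist M (f m) (f n) < \<epsilon>)"

text \<open>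
  Fatou's lemma: the distance of \<open>f n\<close> to the pointwise limit is at most the limit inferior of the
  distances to the later members.
\<close>

lemma L2_Cauchy_pointwise_limit:
  assumes C: "L2_Cauchy M f" and r: "strict_mono (r :: nat \<Rightarrow> nat)"
    and F[measurable]: "F \<in> borel_measurable M"
    and lim: "AE x in M. (\<lambda>k. f (r k) x) \<longlonglongrightarrow> F x"
  shows "square_integrable M F" and "(\<lambda>n. sqdist M (f n) F) \<longlonglongrightarrow> 0"
proof -
  have sq: "square_integrable M (f n)" for n using C by (simp add: L2_Cauchy_def)
  then have [measurable]: "f n \<in> borel_measurable M" for n by (simp add: square_integrable_def)
  have int: "integrable M (\<lambda>x. (cmod (f m x - f n x))\<^sup>2)" for m n
    using square_integrable_diff[OF sq sq] by (simp add: square_integrable_def)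
  have fatou: "(\<integral>\<^sup>+x. ennreal ((cmod (f n x - F x))\<^sup>2) \<partial>M) \<le> ennreal \<epsilon>"
    if N: "\<And>m n. N \<le> m \<Longrightarrow> N \<le> n \<Longrightarrow> sqdist M (f m) (f n) < \<epsilon>" and "N \<le> n" for N n \<epsilon>
  proof -
    have "AE x in M. ennreal ((cmod (f n x - F x))\<^sup>2) = liminf (\<lambda>k. ennreal ((cmod (f n x - f (r k) x))\<^sup>2))"
      using lim
    proof eventually_elim
      case (elim x)
      have "(\<lambda>k. ennreal ((cmod (f n x - f (r k) x))\<^sup>2)) \<longlonglongrightarrow> ennreal ((cmod (f n x - F x))\<^sup>2)"
        by (intro tendsto_ennrealI tendsto_power tendsto_norm tendsto_diff tendsto_const elim)
      then show ?case by (intro lim_imp_Liminf[symmetric] trivial_limit_sequentially)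
    qed
    then have "(\<integral>\<^sup>+x. ennreal ((cmod (f n x - F x))\<^sup>2) \<partial>M) = (\<integral>\<^sup>+x. liminf (\<lambda>k. ennreal ((cmod (f n x - f (r k) x))\<^sup>2)) \<partial>M)"
      by (rule nn_integral_cong_AE)
    also have "\<dots> \<le> liminf (\<lambda>k. \<integral>\<^sup>+x. ennreal ((cmod (f n x - f (r k) x))\<^sup>2) \<partial>M)"
      by (rule nn_integral_liminf) measurable
    also have "\<dots> \<le> ennreal \<epsilon>"
    proof (rule Liminf_le)
      show "\<forall>\<^sub>F k in sequentially. (\<integral>\<^sup>+x. ennreal ((cmod (f n x - f (r k) x))\<^sup>2) \<partial>M) \<le> ennreal \<epsilon>"
        using eventually_ge_at_top[of N]
      proof eventually_elim
        case (elim k)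
        then have "N \<le> r k" using seq_suble[OF r, of k] by linarith
        then show ?case
          using N[OF \<open>N \<le> n\<close>, of "r k"] int[of n "r k"] by (subst nn_integral_eq_integral) (auto intro: ennreal_leI)
      qed
    qed simp
    finally show ?thesis .
  qed
  have bound: "integrable M (\<lambda>x. (cmod (f n x - F x))\<^sup>2)" "sqdist M (f n) F \<le> \<epsilon>"
    if N: "\<And>m n. N \<le> m \<Longrightarrow> N \<le> n \<Longrightarrow> sqdist M (f m) (f n) < \<epsilon>" and "N \<le> n" and "0 < \<epsilon>" for N n \<epsilon>
  proof -
    have *: "(\<integral>\<^sup>+x. ennreal ((cmod (f n x - F x))\<^sup>2) \<partial>M) \<le> ennreal \<epsilon>" by (rule fatou[OF N \<open>N \<le> n\<close>])
    show i: "integrable M (\<lambda>x. (cmod (f n x - F x))\<^sup>2)"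
      unfolding integrable_iff_bounded using le_less_trans[OF *] by simp
    have "ennreal (sqdist M (f n) F) \<le> ennreal \<epsilon>"
      using * by (subst nn_integral_eq_integral[OF i, symmetric]) auto
    then show "sqdist M (f n) F \<le> \<epsilon>" using \<open>0 < \<epsilon>\<close> by (simp add: ennreal_le_iff)
  qed
  obtain N where "\<And>m n. N \<le> m \<Longrightarrow> N \<le> n \<Longrightarrow> sqdist M (f m) (f n) < 1"
    using C unfolding L2_Cauchy_def by (meson zero_less_one)
  then have "integrable M (\<lambda>x. (cmod (f N x - F x))\<^sup>2)" by (rule bound(1)) auto
  then have "square_integrable M (\<lambda>x. f N x - F x)" by (simp add: square_integrable_def)
  then show "square_integrable M F"
    using square_integrable_diff[OF sq[of N], of "\<lambda>x. f N x - F x"] by simp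
  show "(\<lambda>n. sqdist M (f n) F) \<longlonglongrightarrow> 0"
  proof (rule LIMSEQ_I)
    fix e :: real assume "0 < e"
    then obtain N where N: "\<And>m n. N \<le> m \<Longrightarrow> N \<le> n \<Longrightarrow> sqdist M (f m) (f n) < e / 2"
      using C unfolding L2_Cauchy_def by (meson half_gt_zero)
    have "norm (sqdist M (f n) F - 0) < e" if "N \<le> n" for n
    proof -
      have "sqdist M (f n) F \<le> e / 2" by (rule bound(2)[OF N that]) (use \<open>0 < e\<close> in auto)
      moreover have "0 \<le> sqdist M (f n) F" by simp
      ultimately show ?thesis using \<open>0 < e\<close> by (simp del: Bochner_Integration.integral_nonneg_AE)
    qed
    then show "\<exists>no. \<forall>n\<ge>no. norm (sqdist M (f n) F - 0) < e" by blast
  qed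
qed

text \<open>
  Along a subsequence with squared increments of size at most \<open>8\<^sup>-\<^sup>k\<close>, the sum of \<open>2\<^sup>k d\<^sub>k\<close> over
  the squared increments \<open>d\<^sub>k\<close> is integrable, hence finite almost everywhere. This bounds \<open>d\<^sub>k\<close> by a multiple of
  \<open>2\<^sup>-\<^sup>k\<close>, so the increments themselves are summable and the subsequence converges almost everywhere.
\<close>

lemma Riesz_Fischer:
  assumes C: "L2_Cauchy M f"
  shows "\<exists>F. square_integrable M F \<and> (\<lambda>n. sqdist M (f n) F) \<longlonglongrightarrow> 0"
proof -
  have sq: "square_integrable M (f n)" for n using C by (simp add: L2_Cauchy_def)
  then have fm[measurable]: "f n \<in> borel_measurable M" for n by (simp add: square_integrable_def)
  have int: "integrable M (\<lambda>x. (cmod (f m x - f n x))\<^sup>2)" for m n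
    using square_integrable_diff[OF sq sq] by (simp add: square_integrable_def)
  have "\<exists>N. \<forall>m\<ge>N. \<forall>n\<ge>N. sqdist M (f m) (f n) < (1/8) ^ k" for k :: nat
    using C unfolding L2_Cauchy_def by (metis zero_less_divide_1_iff zero_less_numeral zero_less_power)
  then obtain N where N: "\<And>k m n. N k \<le> m \<Longrightarrow> N k \<le> n \<Longrightarrow> sqdist M (f m) (f n) < (1/8) ^ k"
    by metis
  \<comment> \<open>Strictly increasing and at least \<open>N k\<close>.\<close>
  define r where "r k = k + (\<Sum>i\<le>k. N i)" for k
  have r: "strict_mono r" by (auto simp: strict_mono_Suc_iff r_def)
  have rN: "N k \<le> r k" for k
    unfolding r_def using member_le_sum[of k "{..k}" N] by auto
  define d where "d k x = (cmod (f (r (Suc k)) x - f (r k) x))\<^sup>2" for k x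
  have [measurable]: "d k \<in> borel_measurable M" for k unfolding d_def by measurable
  have d_int: "(\<integral>\<^sup>+x. ennreal (2 ^ k * d k x) \<partial>M) \<le> ennreal ((1/4) ^ k)" for k
  proof -
    have "r k \<le> r (Suc k)" using r by (simp add: strict_mono_Suc_iff less_imp_le)
    then have "(LINT x|M. d k x) \<le> (1/8) ^ k"
      unfolding d_def using N[of k "r (Suc k)" "r k"] rN[of k] by linarith
    then have "(LINT x|M. 2 ^ k * d k x) \<le> 2 ^ k * (1/8) ^ k"
      by (simp add: mult_left_mono)
    also have "\<dots> = (1/4::real) ^ k" by (simp flip: power_mult_distrib)
    finally have "(LINT x|M. 2 ^ k * d k x) \<le> (1/4) ^ k" .
    moreover have "integrable M (\<lambda>x. 2 ^ k * d k x)" unfolding d_def by (intro integrable_mult_right int)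
    moreover have "0 \<le> 2 ^ k * d k x" for x by (simp add: d_def)
    ultimately show ?thesis by (subst nn_integral_eq_integral) (auto intro: ennreal_leI)
  qed
  have "(\<integral>\<^sup>+x. (\<Sum>k. ennreal (2 ^ k * d k x)) \<partial>M) = (\<Sum>k. \<integral>\<^sup>+x. ennreal (2 ^ k * d k x) \<partial>M)"
    by (rule nn_integral_suminf) measurable
  also have "\<dots> \<le> (\<Sum>k. ennreal ((1/4) ^ k))" by (intro suminf_le d_int) auto
  also have "\<dots> = ennreal (\<Sum>k. (1/4) ^ k)" by (rule suminf_ennreal2) (auto intro: summable_geometric)
  also have "\<dots> < \<infinity>" by simp
  finally have "AE x in M. (\<Sum>k. ennreal (2 ^ k * d k x)) \<noteq> \<infinity>"
    by (intro nn_integral_PInf_AE) auto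
  then have conv: "AE x in M. convergent (\<lambda>k. f (r k) x)"
  proof eventually_elim
    case (elim x)
    have dnn: "0 \<le> 2 ^ k * d k x" for k by (simp add: d_def)
    have "summable (\<lambda>k. 2 ^ k * d k x)"
      by (rule summable_suminf_not_top) (use dnn elim in auto)
    then obtain B where B: "\<And>k. 2 ^ k * d k x \<le> B"
      using summable_imp_Bseq[of "\<lambda>k. 2 ^ k * d k x"] dnn unfolding Bseq_def
      by (metis abs_of_nonneg real_norm_def)
    have bnd: "cmod (f (r (Suc k)) x - f (r k) x) \<le> sqrt B * (1 / sqrt 2) ^ k" for k
    proof -
      have "(cmod (f (r (Suc k)) x - f (r k) x))\<^sup>2 \<le> B / 2 ^ k"
        using B[of k] by (simp add: d_def field_simps)
      then have "cmod (f (r (Suc k)) x - f (r k) x) \<le> sqrt (B / 2 ^ k)" by (rule real_le_rsqrt)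
      also have "\<dots> = sqrt B * (1 / sqrt 2) ^ k"
        by (simp add: real_sqrt_divide real_sqrt_power power_divide)
      finally show ?thesis .
    qed
    have "summable (\<lambda>k. f (r (Suc k)) x - f (r k) x)"
    proof (rule summable_comparison_test[OF exI[of _ 0]])
      show "summable (\<lambda>k. sqrt B * (1 / sqrt 2) ^ k)"
        by (intro summable_mult summable_geometric) simp
    qed (use bnd in auto)
    then have "convergent (\<lambda>n. \<Sum>k<n. f (r (Suc k)) x - f (r k) x)" by (simp add: summable_iff_convergent)
    then have "convergent (\<lambda>n. f (r 0) x + (\<Sum>k<n. f (r (Suc k)) x - f (r k) x))"
      by (intro convergent_add convergent_const)
    moreover have "f (r 0) x + (\<Sum>k<n. f (r (Suc k)) x - f (r k) x) = f (r n) x" for n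
      using sum_lessThan_telescope[of "\<lambda>k. f (r k) x" n] by simp
    ultimately show ?case by simp
  qed
  define F where "F x = lim (\<lambda>k. f (r k) x)" for x
  have [measurable]: "F \<in> borel_measurable M" unfolding F_def by measurable
  have "AE x in M. (\<lambda>k. f (r k) x) \<longlonglongrightarrow> F x"
    using conv by eventually_elim (simp add: F_def convergent_LIMSEQ_iff)
  note L2_Cauchy_pointwise_limit[OF C r \<open>F \<in> borel_measurable M\<close> this]
  then show ?thesis by (intro exI[of _ F] conjI)
qed

lemma sigma_finite_lebesgue: "sigma_finite_measure (lebesgue :: real measure)"
proof
  show "\<exists>A. countable A \<and> A \<subseteq> sets (lebesgue :: real measure) \<and> \<Union> A = space lebesgue \<and> (\<forall>a\<in>A. emeasure lebesgue a \<noteq> (\<infinity>::ennreal))"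
  proof (intro exI[of _ "range (\<lambda>n::nat. {- real n..real n})"] conjI)
    let ?A = "range (\<lambda>n::nat. {- real n..real n})"
    show "countable ?A" by simp
    show "?A \<subseteq> sets lebesgue" by auto
    have "\<exists>n::nat. x \<in> {- real n..real n}" for x
      using real_arch_simple[of "\<bar>x\<bar>"] by (auto simp: abs_le_iff minus_le_iff)
    then show "\<Union> ?A = space lebesgue" by auto
    show "\<forall>a\<in>?A. emeasure lebesgue a \<noteq> \<infinity>" by auto
  qed
qed

text \<open>
  The sum over the edges of the integrals over the edges is one integral with respect to the product
  of counting measure and Lebesgue measure, restricted to \<open>\<Omega>\<close>. Dominated convergence, Fatou's lemma and
  completeness are then available for whole families at once.
\<close>

locale edge_family =
  fixes E :: "'e set" and I :: "'e \<Rightarrow> real set"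
  assumes countable_E: "countable E" and I_sets: "\<And>e. e \<in> E \<Longrightarrow> I e \<in> sets lebesgue"
begin

definition \<Omega> :: "('e \<times> real) set" where "\<Omega> = Sigma E I"
definition P :: "('e \<times> real) measure" where "P = count_space E \<Otimes>\<^sub>M lebesgue"
definition M :: "('e \<times> real) measure" where "M = restrict_space P \<Omega>"

lemma space_P: "space P = E \<times> UNIV" by (simp add: P_def space_pair_measure)

lemma space_M: "space M = \<Omega>"
  by (auto simp: M_def space_restrict_space space_P \<Omega>_def)

lemma slice_sets: "e \<in> E \<Longrightarrow> A \<in> sets lebesgue \<Longrightarrow> {e} \<times> A \<in> sets P"
  unfolding P_def by (rule pair_measureI) auto

lemma \<Omega>_sets: "\<Omega> \<in> sets P"
proof -
  have "\<Omega> = (\<Union>e\<in>E. {e} \<times> I e)" by (auto simp: \<Omega>_def)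
  also have "\<dots> \<in> sets P" using slice_sets I_sets by (intro sets.countable_UN' countable_E) blast
  finally show ?thesis .
qed

lemma \<Omega>_Int: "\<Omega> \<inter> space P \<in> sets P" using \<Omega>_sets by auto

sublocale pair_sigma_finite "count_space E" "lebesgue :: real measure"
  by (intro pair_sigma_finite.intro sigma_finite_measure_count_space_countable countable_E sigma_finite_lebesgue)

lemma measurable_P_iff: "f \<in> measurable P N \<longleftrightarrow> (\<forall>e\<in>E. (\<lambda>x. f (e, x)) \<in> measurable lebesgue N)"
proof
  assume "f \<in> measurable P N"
  then show "\<forall>e\<in>E. (\<lambda>x. f (e, x)) \<in> measurable lebesgue N"
    by (auto simp: P_def)
next
  assume "\<forall>e\<in>E. (\<lambda>x. f (e, x)) \<in> measurable lebesgue N"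
  then show "f \<in> measurable P N"
    unfolding P_def by (intro measurable_pair_measure_countable1[OF countable_E]) auto
qed

lemma indicator_\<Omega>: "e \<in> E \<Longrightarrow> indicator \<Omega> (e, x) = indicator (I e) x"
  by (simp add: \<Omega>_def indicator_def)

lemma measurable_M_iff:
  fixes f :: "'e \<times> real \<Rightarrow> 'b::real_normed_vector"
  shows "f \<in> borel_measurable M \<longleftrightarrow> (\<forall>e\<in>E. set_borel_measurable lebesgue (I e) (\<lambda>x. f (e, x)))"
  unfolding M_def borel_measurable_restrict_space_iff[OF \<Omega>_Int] measurable_P_iff
  by (simp add: indicator_\<Omega> set_borel_measurable_def)

lemma integrable_M_iff:
  fixes f :: "'e \<times> real \<Rightarrow> 'b::{banach, second_countable_topology}"
  shows "integrable M f \<longleftrightarrow> (\<forall>e\<in>E. set_integrable lebesgue (I e) (\<lambda>x. f (e, x))) \<and>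
      (\<lambda>e. LINT x:I e|lebesgue. norm (f (e, x))) summable_on E" (is "?l \<longleftrightarrow> ?r \<and> ?s")
proof -
  let ?F = "\<lambda>z. indicator \<Omega> z *\<^sub>R f z"
  have eq: "?F (e, x) = indicator (I e) x *\<^sub>R f (e, x)" if "e \<in> E" for e x
    using that by (simp add: indicator_\<Omega>)
  have r: "?r \<longleftrightarrow> (\<forall>e\<in>E. integrable lebesgue (\<lambda>x. ?F (e, x)))"
    by (simp add: eq set_integrable_def)
  have n: "(LINT x|lebesgue. norm (?F (e, x))) = (LINT x:I e|lebesgue. norm (f (e, x)))" if "e \<in> E" for e
    using that by (simp add: eq set_lebesgue_integral_def)
  have s: "?s \<longleftrightarrow> integrable (count_space E) (\<lambda>e. LINT x|lebesgue. norm (?F (e, x)))"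
  proof -
    have "?s \<longleftrightarrow> (\<lambda>e. norm (LINT x|lebesgue. norm (?F (e, x)))) summable_on E"
    proof (rule summable_on_cong)
      fix e assume e: "e \<in> E"
      have "0 \<le> (LINT x|lebesgue. norm (?F (e, x)))" by (rule Bochner_Integration.integral_nonneg) simp
      then show "(LINT x:I e|lebesgue. norm (f (e, x))) = norm (LINT x|lebesgue. norm (?F (e, x)))"
        by (simp only: n[OF e, symmetric] real_norm_def abs_of_nonneg)
    qed
    also have "\<dots> \<longleftrightarrow> integrable (count_space E) (\<lambda>e. LINT x|lebesgue. norm (?F (e, x)))"
      using abs_summable_equivalent[of "\<lambda>e. LINT x|lebesgue. norm (?F (e, x))" E]
      by (simp only: Infinite_Set_Sum.abs_summable_on_def)
    finally show ?thesis .
  qed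
  have "?l \<longleftrightarrow> integrable P ?F" unfolding M_def by (rule integrable_restrict_space[OF \<Omega>_Int])
  also have "\<dots> \<longleftrightarrow> (\<forall>e\<in>E. integrable lebesgue (\<lambda>x. ?F (e, x))) \<and> integrable (count_space E) (\<lambda>e. LINT x|lebesgue. norm (?F (e, x)))"
  proof
    assume i: "integrable P ?F"
    then have i': "integrable (count_space E \<Otimes>\<^sub>M lebesgue) ?F" by (simp add: P_def)
    show "(\<forall>e\<in>E. integrable lebesgue (\<lambda>x. ?F (e, x))) \<and> integrable (count_space E) (\<lambda>e. LINT x|lebesgue. norm (?F (e, x)))"
      using AE_integrable_fst'[OF i'] integrable_fst'[OF integrable_norm[OF i']] by (simp add: AE_count_space)
  next
    assume a: "(\<forall>e\<in>E. integrable lebesgue (\<lambda>x. ?F (e, x))) \<and> integrable (count_space E) (\<lambda>e. LINT x|lebesgue. norm (?F (e, x)))"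
    show "integrable P ?F"
      unfolding P_def
    proof (rule Fubini_integrable)
      have "?F \<in> borel_measurable P" using a by (auto simp: measurable_P_iff intro: borel_measurable_integrable)
      then show "?F \<in> borel_measurable (count_space E \<Otimes>\<^sub>M lebesgue)" by (simp add: P_def)
    qed (use a in \<open>auto simp: AE_count_space\<close>)
  qed
  finally show ?thesis using r s by blast
qed

lemma integral_M:
  fixes f :: "'e \<times> real \<Rightarrow> 'b::{banach, second_countable_topology}"
  assumes "integrable M f"
  shows "integral\<^sup>L M f = (\<Sum>\<^sub>\<infinity>e\<in>E. LINT x:I e|lebesgue. f (e, x))"
proof -
  let ?F = "\<lambda>z. indicator \<Omega> z *\<^sub>R f z"
  have i: "integrable (count_space E \<Otimes>\<^sub>M lebesgue) ?F"
    using assms integrable_restrict_space[OF \<Omega>_Int, of f] by (simp add: M_def P_def)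
  have "integral\<^sup>L M f = integral\<^sup>L (count_space E \<Otimes>\<^sub>M lebesgue) ?F"
    using integral_restrict_space[OF \<Omega>_Int, of f] by (simp add: M_def P_def)
  also have "\<dots> = (LINT e|count_space E. LINT x|lebesgue. ?F (e, x))"
    by (rule integral_fst'[OF i, symmetric])
  also have "\<dots> = infsetsum (\<lambda>e. LINT x|lebesgue. ?F (e, x)) E" by (simp add: infsetsum_def)
  also have "\<dots> = (\<Sum>\<^sub>\<infinity>e\<in>E. LINT x|lebesgue. ?F (e, x))"
    using integrable_fst'[OF i] by (intro infsetsum_infsum) (simp add: Infinite_Set_Sum.abs_summable_on_def)
  also have "\<dots> = (\<Sum>\<^sub>\<infinity>e\<in>E. LINT x:I e|lebesgue. f (e, x))"
    by (rule infsum_cong) (simp add: indicator_\<Omega> set_lebesgue_integral_def)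
  finally show ?thesis .
qed

lemma AE_M_iff: "(AE z in M. Q z) \<longleftrightarrow> (\<forall>e\<in>E. AE x in lebesgue. x \<in> I e \<longrightarrow> Q (e, x))"
proof -
  have "(AE z in M. Q z) \<longleftrightarrow> (AE z in P. z \<in> \<Omega> \<longrightarrow> Q z)"
    unfolding M_def by (rule AE_restrict_space_iff[OF \<Omega>_Int])
  also have "\<dots> \<longleftrightarrow> (\<forall>e\<in>E. AE x in lebesgue. x \<in> I e \<longrightarrow> Q (e, x))"
  proof
    assume "AE z in P. z \<in> \<Omega> \<longrightarrow> Q z"
    then have "AE e in count_space E. AE x in lebesgue. (e, x) \<in> \<Omega> \<longrightarrow> Q (e, x)"
      unfolding P_def by (rule AE_pair)
    then show "\<forall>e\<in>E. AE x in lebesgue. x \<in> I e \<longrightarrow> Q (e, x)"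
      by (auto simp: AE_count_space \<Omega>_def)
  next
    assume a: "\<forall>e\<in>E. AE x in lebesgue. x \<in> I e \<longrightarrow> Q (e, x)"
    have "\<exists>N. N \<in> null_sets lebesgue \<and> {x. \<not> (x \<in> I e \<longrightarrow> Q (e, x))} \<subseteq> N" if "e \<in> E" for e
      using a[rule_format, OF that] by (auto simp: eventually_ae_filter)
    then obtain N where N: "\<And>e. e \<in> E \<Longrightarrow> N e \<in> null_sets lebesgue"
      "\<And>e. e \<in> E \<Longrightarrow> {x. \<not> (x \<in> I e \<longrightarrow> Q (e, x))} \<subseteq> N e" by metis
    have "{e} \<times> N e \<in> null_sets P" if "e \<in> E" for e
    proof (rule null_setsI)
      show "{e} \<times> N e \<in> sets P" using N(1) that by (intro slice_sets) auto
      show "emeasure P ({e} \<times> N e) = 0"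
        using N(1)[OF that] that unfolding P_def by (subst M2.emeasure_pair_measure_Times) auto
    qed
    then have "(\<Union>e\<in>E. {e} \<times> N e) \<in> null_sets P" by (intro null_sets_UN' countable_E)
    moreover have "{z\<in>space P. \<not> (z \<in> \<Omega> \<longrightarrow> Q z)} \<subseteq> (\<Union>e\<in>E. {e} \<times> N e)"
      using N(2) by (force simp: space_P \<Omega>_def)
    ultimately show "AE z in P. z \<in> \<Omega> \<longrightarrow> Q z" by (rule AE_I')
  qed
  finally show ?thesis .
qed

end

section \<open>Geometry of a locally finite metric graph\<close>

text \<open>
  Take the minimum of the finitely many constants.
\<close>

lemma finite_uniform_pos:
  fixes Q :: "'a \<Rightarrow> real \<Rightarrow> bool"
  assumes "finite F" and ex: "\<And>x. x \<in> F \<Longrightarrow> \<exists>d>0. Q x d"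
    and mono: "\<And>x d d'. Q x d \<Longrightarrow> 0 < d' \<Longrightarrow> d' \<le> d \<Longrightarrow> Q x d'"
  shows "\<exists>d>0. \<forall>x\<in>F. Q x d"
  using assms(1) ex
proof (induction F rule: finite_induct)
  case empty
  show ?case by (auto intro: exI[of _ 1])
next
  case (insert x F)
  then obtain d d' where d: "d > 0" "\<forall>y\<in>F. Q y d" "d' > 0" "Q x d'" by (metis insert_iff)
  then have "Q y (min d d')" if "y \<in> insert x F" for y
    using that mono[of y d "min d d'"] mono[of x d' "min d d'"] by auto
  then show ?case using d by (intro exI[of _ "min d d'"]) auto
qed

lemma edge_interval_eq:
  "edge_interval G e = (if len G e = \<infinity> then {0..} else if len G e = -\<infinity> then {} else {0..real_of_ereal (len G e)})"
  by (cases "len G e") (auto simp: edge_interval_def)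

lemma edge_interval_lebesgue: "edge_interval G e \<in> sets lebesgue"
  unfolding edge_interval_eq by auto

lemma interior_edge_interval: "interior (edge_interval G e) = {x. 0 < x \<and> ereal x < len G e}"
  by (cases "len G e") (auto simp: edge_interval_eq interior_real_atLeast)

locale mgraph =
  fixes G :: "('v, 'e) metric_graph"
  assumes metric: "metric_graph G" and connected: "connected_graph G" and lf: "locally_finite_graph G"
begin

abbreviation "E \<equiv> edges G"
abbreviation "I e \<equiv> edge_interval G e"
abbreviation "ep \<equiv> edge_point G"

lemma edge_point_in: "e \<in> E \<Longrightarrow> x \<in> I e \<Longrightarrow> ep e x \<in> points G"
  using metric by (auto simp: edge_point_def points_def metric_graph_def edge_interval_def less_le)

lemma edge_trace_points: "e \<in> E \<Longrightarrow> edge_trace G (points G) e = I e"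
  using edge_point_in by (auto simp: edge_trace_def)

lemma path_len_nonneg: "path_len G p q l \<Longrightarrow> 0 \<le> l"
  by (induction rule: path_len.induct) auto

lemma path_len_trans: "path_len G q r k \<Longrightarrow> path_len G p q l \<Longrightarrow> path_len G p r (l + k)"
proof (induction rule: path_len.induct)
  case (step q e s k t)
  have "path_len G p (ep e t) ((l + k) + \<bar>s - t\<bar>)"
    by (rule path_len.step) (use step in auto)
  then show ?case by (simp add: add.assoc)
qed auto

lemma path_len_segment:
  assumes "e \<in> E" "s \<in> I e" "t \<in> I e" shows "path_len G (ep e s) (ep e t) \<bar>s - t\<bar>"
  using path_len.step[OF path_len.refl[OF edge_point_in[OF assms(1,2)]] assms(1,2,3)] by simp

lemma path_len_sym: "path_len G p q l \<Longrightarrow> path_len G q p l"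
proof (induction rule: path_len.induct)
  case (step p e s l t)
  have "path_len G (ep e t) p (\<bar>t - s\<bar> + l)"
    by (rule path_len_trans[OF step.IH path_len_segment]) (use step in auto)
  then show ?case by (simp add: abs_minus_commute add.commute)
qed (auto intro: path_len.refl)

lemma graph_dist_le: "path_len G p q l \<Longrightarrow> graph_dist G p q \<le> l"
  unfolding graph_dist_def using path_len_nonneg
  by (auto intro!: cInf_lower bdd_belowI[of _ 0])

lemma graph_dist_segment: "e \<in> E \<Longrightarrow> s \<in> I e \<Longrightarrow> t \<in> I e \<Longrightarrow> graph_dist G (ep e s) (ep e t) \<le> \<bar>s - t\<bar>"
  by (rule graph_dist_le[OF path_len_segment])

lemma graph_dist_nonneg: "0 \<le> graph_dist G p q"
  unfolding graph_dist_def using path_len_nonneg by (auto intro!: cInf_greatest)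

lemma graph_dist_commute: "graph_dist G p q = graph_dist G q p"
proof -
  have "path_len G p q = path_len G q p" using path_len_sym by blast
  then show ?thesis by (simp add: graph_dist_def)
qed

lemma short_path:
  assumes "p \<in> points G" "q \<in> points G" "graph_dist G p q < c"
  obtains l where "path_len G p q l" "l < c"
proof -
  have ex: "\<exists>l. path_len G p q l" using connected assms by (auto simp: connected_graph_def)
  then have "Inf {l. path_len G p q l} < c" using assms(3) by (simp add: graph_dist_def)
  then show ?thesis using cInf_lessD[of "{l. path_len G p q l}" c] ex that by auto
qed

lemma graph_dist_triangle:
  assumes "p \<in> points G" "q \<in> points G" "r \<in> points G"
  shows "graph_dist G p r \<le> graph_dist G p q + graph_dist G q r"
proof (rule field_le_epsilon)
  fix \<epsilon> :: real assume "\<epsilon> > 0"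
  obtain l where l: "path_len G p q l" "l < graph_dist G p q + \<epsilon> / 2"
    using short_path[OF assms(1,2), of "graph_dist G p q + \<epsilon> / 2"] \<open>\<epsilon> > 0\<close> by auto
  obtain k where k: "path_len G q r k" "k < graph_dist G q r + \<epsilon> / 2"
    using short_path[OF assms(2,3), of "graph_dist G q r + \<epsilon> / 2"] \<open>\<epsilon> > 0\<close> by auto
  have "graph_dist G p r \<le> l + k" by (rule graph_dist_le[OF path_len_trans[OF k(1) l(1)]])
  then show "graph_dist G p r \<le> graph_dist G p q + graph_dist G q r + \<epsilon>" using l k by linarith
qed

lemma real_len: "ereal x = len G e \<Longrightarrow> real_of_ereal (len G e) = x"
  by (metis real_of_ereal.simps(1))

text \<open>
  All parameters at which \<open>p\<close> occurs on the edges: a vertex of degree \<open>d\<close> has \<open>d\<close> places (a loop counts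
  twice), an inner point has one.
\<close>

definition places :: "('v, 'e) point \<Rightarrow> ('e \<times> real) set" where
  "places p = {(e, s). e \<in> E \<and> s \<in> I e \<and> ep e s = p}"

text \<open>
  The set \<open>{p}\<close> is bounded, so local finiteness leaves only finitely many edges through \<open>p\<close>.
\<close>

lemma finite_places:
  assumes "p \<in> points G" shows "finite (places p)"
proof -
  let ?F = "{e \<in> E. ep e ` I e \<inter> {p} \<noteq> {}}"
  have "bounded_part G {p}" using assms by (auto simp: bounded_part_def)
  then have "finite ?F" using lf unfolding locally_finite_graph_def by blast
  moreover have "finite {s. ep e s = p}" for e
  proof (rule finite_subset)
    show "{s. ep e s = p} \<subseteq> {0, real_of_ereal (len G e), (case p of Inner _ x \<Rightarrow> x | _ \<Rightarrow> 0)}"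
      by (auto simp: edge_point_def real_len split: if_splits)
  qed simp
  ultimately have "finite (Sigma ?F (\<lambda>e. {s. ep e s = p}))" by (intro finite_SigmaI) auto
  moreover have "places p \<subseteq> Sigma ?F (\<lambda>e. {s. ep e s = p})" by (auto simp: places_def)
  ultimately show ?thesis by (rule finite_subset[rotated])
qed

text \<open>
  Choose \<open>r\<close> at most the distance from every place of \<open>p\<close> to the ends of its edge, the place itself
  excluded. A path that starts at \<open>p\<close> and is shorter than \<open>r\<close> can then change the edge only at \<open>p\<close>, so it
  ends on an edge through \<open>p\<close>, no farther along that edge than the length of the path.
\<close>

lemma star:
  assumes p: "p \<in> points G"
  obtains r where "0 < r"
    "\<And>q l. path_len G p q l \<Longrightarrow> l < r \<Longrightarrow> q = p \<or> (\<exists>(e, s)\<in>places p. \<exists>t\<in>I e. ep e t = q \<and> \<bar>s - t\<bar> \<le> l)"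
proof -
  have "\<exists>r>0. \<forall>z\<in>places p. \<forall>t. t \<in> {0, real_of_ereal (len G (fst z))} - {snd z} \<longrightarrow> r \<le> \<bar>snd z - t\<bar>"
  proof (rule finite_uniform_pos[OF finite_places[OF p]])
    fix z assume "z \<in> places p"
    have "\<exists>r>0. \<forall>t\<in>{0, real_of_ereal (len G (fst z))} - {snd z}. r \<le> \<bar>snd z - t\<bar>"
    proof (rule finite_uniform_pos)
      fix t assume "t \<in> {0, real_of_ereal (len G (fst z))} - {snd z}"
      then show "\<exists>r>0. r \<le> \<bar>snd z - t\<bar>" by (intro exI[of _ "\<bar>snd z - t\<bar>"]) auto
    qed auto
    then show "\<exists>r>0. \<forall>t. t \<in> {0, real_of_ereal (len G (fst z))} - {snd z} \<longrightarrow> r \<le> \<bar>snd z - t\<bar>" by blast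
  qed (meson order_trans)
  then obtain r where r: "0 < r"
    and far: "\<And>e s t. (e, s) \<in> places p \<Longrightarrow> t \<in> {0, real_of_ereal (len G e)} \<Longrightarrow> t \<noteq> s \<Longrightarrow> r \<le> \<bar>s - t\<bar>"
    by fastforce
  have "q = p \<or> (\<exists>(e, s)\<in>places p. \<exists>t\<in>I e. ep e t = q \<and> \<bar>s - t\<bar> \<le> l)"
    if "path_len G p' q l" "p' = p" "l < r" for p' q l
    using that
  proof (induction rule: path_len.induct)
    case (step p' e s l t)
    then have l: "l < r" by linarith
    from step.IH[OF step.prems(1) l] show ?case
    proof
      assume "ep e s = p"
      then have "(e, s) \<in> places p" using step by (simp add: places_def)
      moreover have "\<bar>s - t\<bar> \<le> l + \<bar>s - t\<bar>" using path_len_nonneg[OF step.hyps(1)] by simp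
      ultimately show ?thesis using step.hyps by blast
    next
      assume "\<exists>(e', s')\<in>places p. \<exists>t'\<in>I e'. ep e' t' = ep e s \<and> \<bar>s' - t'\<bar> \<le> l"
      then obtain e' s' t' where *: "(e', s') \<in> places p" "t' \<in> I e'" "ep e' t' = ep e s" "\<bar>s' - t'\<bar> \<le> l"
        by auto
      show ?thesis
      proof (cases "ep e s")
        case (Vertex v)
        then have "t' \<in> {0, real_of_ereal (len G e')}"
          using *(3) by (auto simp: edge_point_def real_len split: if_splits)
        \<comment> \<open>A path shorter than \<open>r\<close> reaches no end of an edge that is not a place of \<open>p\<close>.\<close>
        then have "t' = s'" using far[OF *(1)] *(4) l by force
        then have "ep e s = p" using * by (simp add: places_def)
        then have "(e, s) \<in> places p" using step by (simp add: places_def)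
        moreover have "\<bar>s - t\<bar> \<le> l + \<bar>s - t\<bar>" using path_len_nonneg[OF step.hyps(1)] by simp
        ultimately show ?thesis using step.hyps by blast
      next
        case (Inner e0 x)
        then have "e' = e" "t' = s" using *(3) by (auto simp: edge_point_def split: if_splits)
        moreover then have "\<bar>s' - t\<bar> \<le> l + \<bar>s - t\<bar>" using *(4) by linarith
        ultimately show ?thesis using *(1) step.hyps by blast
      qed
    qed
  qed simp
  then show ?thesis using that[OF r] by blast
qed

text \<open>
  If distinct points \<open>p\<close> and \<open>q\<close> had distance \<open>0\<close>, then by \<open>star\<close> some edge would carry places of \<open>p\<close> and
  of \<open>q\<close> arbitrarily close to each other; both have only finitely many places.
\<close>

sublocale Metric_space "points G" "graph_dist G"
proof
  show "0 \<le> graph_dist G p q" for p q by (rule graph_dist_nonneg)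
  show "graph_dist G p q = graph_dist G q p" for p q by (rule graph_dist_commute)
  show "graph_dist G p r \<le> graph_dist G p q + graph_dist G q r"
    if "p \<in> points G" "q \<in> points G" "r \<in> points G" for p q r
    using that by (rule graph_dist_triangle)
  fix p q assume p: "p \<in> points G" and q: "q \<in> points G"
  show "graph_dist G p q = 0 \<longleftrightarrow> p = q"
  proof
    assume "p = q"
    then show "graph_dist G p q = 0"
      using graph_dist_le[OF path_len.refl[OF p]] graph_dist_nonneg[of p q] by simp
  next
    assume d: "graph_dist G p q = 0"
    show "p = q"
    proof (rule ccontr)
      assume "p \<noteq> q"
      obtain r where r: "0 < r" and star: "\<And>q l. path_len G p q l \<Longrightarrow> l < r \<Longrightarrow>
          q = p \<or> (\<exists>(e, s)\<in>places p. \<exists>t\<in>I e. ep e t = q \<and> \<bar>s - t\<bar> \<le> l)"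
        using star[OF p] by blast
      have "\<exists>\<delta>>0. \<forall>z\<in>places p \<times> places q. fst (fst z) = fst (snd z) \<longrightarrow> \<delta> \<le> \<bar>snd (fst z) - snd (snd z)\<bar>"
      proof (rule finite_uniform_pos)
        show "finite (places p \<times> places q)" using p q finite_places by blast
        fix z assume "z \<in> places p \<times> places q"
        then show "\<exists>\<delta>>0. fst (fst z) = fst (snd z) \<longrightarrow> \<delta> \<le> \<bar>snd (fst z) - snd (snd z)\<bar>"
          using \<open>p \<noteq> q\<close> by (intro exI[of _ "if fst (fst z) = fst (snd z) then \<bar>snd (fst z) - snd (snd z)\<bar> else 1"])
            (auto simp: places_def)
      qed (meson order_trans)
      then obtain \<delta> where \<delta>: "\<delta> > 0"
        and sep: "\<And>e s t. (e, s) \<in> places p \<Longrightarrow> (e, t) \<in> places q \<Longrightarrow> \<delta> \<le> \<bar>s - t\<bar>" by fastforce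
      obtain l where l: "path_len G p q l" "l < min r \<delta>"
        using short_path[OF p q, of "min r \<delta>"] d r \<delta> by auto
      then obtain e s t where "(e, s) \<in> places p" "t \<in> I e" "ep e t = q" "\<bar>s - t\<bar> \<le> l"
        using star[OF l(1)] \<open>p \<noteq> q\<close> by auto
      then show False using sep[of e s t] l(2) by (auto simp: places_def)
    qed
  qed
qed

text \<open>
  The map \<open>edge_point\<close> contracts distances, which gives one direction. Conversely, near \<open>p\<close> the graph is a
  star with finitely many branches, and one \<open>\<delta>\<close> serves all of them.
\<close>

lemma continuous_fam_iff:
  "continuous_fam G u \<longleftrightarrow>
     (\<forall>e\<in>E. continuous_on (I e) (u e)) \<and> (\<exists>g. \<forall>e\<in>E. \<forall>x\<in>I e. u e x = g (ep e x))"
proof -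
  have cont_map: "continuous_map mtopology euclidean g \<longleftrightarrow>
      (\<forall>p\<in>points G. \<forall>\<epsilon>>0. \<exists>\<delta>>0. \<forall>q. q \<in> points G \<and> graph_dist G p q < \<delta> \<longrightarrow> dist (g p) (g q) < \<epsilon>)"
    for g :: "('v, 'e) point \<Rightarrow> complex"
    using metric_continuous_map[OF Met_TC.Metric_space_axioms, of g] by (simp add: mtopology_is_euclidean)
  show ?thesis
  proof
    assume "continuous_fam G u"
    then obtain g where g: "continuous_map mtopology euclidean g"
      and u: "\<And>e x. e \<in> E \<Longrightarrow> x \<in> I e \<Longrightarrow> u e x = g (ep e x)"
      by (auto simp: continuous_fam_def)
    have "continuous_on (I e) (u e)" if e: "e \<in> E" for e
      unfolding continuous_on_iff
    proof (intro ballI allI impI)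
      fix s and \<epsilon> :: real assume s: "s \<in> I e" and "0 < \<epsilon>"
      then obtain \<delta> where \<delta>: "\<delta> > 0" "\<And>q. q \<in> points G \<Longrightarrow> graph_dist G (ep e s) q < \<delta> \<Longrightarrow> dist (g (ep e s)) (g q) < \<epsilon>"
        using g edge_point_in[OF e s] unfolding cont_map by meson
      have "dist (u e t) (u e s) < \<epsilon>" if t: "t \<in> I e" "dist t s < \<delta>" for t
      proof -
        have "graph_dist G (ep e s) (ep e t) < \<delta>"
          using graph_dist_segment[OF e s t(1)] t(2) by (simp add: dist_real_def abs_minus_commute)
        then show ?thesis
          using \<delta>(2)[OF edge_point_in[OF e t(1)]] by (simp add: u[OF e s] u[OF e t(1)] dist_commute)
      qed
      then show "\<exists>d>0. \<forall>t\<in>I e. dist t s < d \<longrightarrow> dist (u e t) (u e s) < \<epsilon>" using \<delta>(1) by blast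
    qed
    then show "(\<forall>e\<in>E. continuous_on (I e) (u e)) \<and> (\<exists>g. \<forall>e\<in>E. \<forall>x\<in>I e. u e x = g (ep e x))"
      using u by blast
  next
    assume "(\<forall>e\<in>E. continuous_on (I e) (u e)) \<and> (\<exists>g. \<forall>e\<in>E. \<forall>x\<in>I e. u e x = g (ep e x))"
    then obtain g where cont: "\<And>e. e \<in> E \<Longrightarrow> continuous_on (I e) (u e)"
      and u: "\<And>e x. e \<in> E \<Longrightarrow> x \<in> I e \<Longrightarrow> u e x = g (ep e x)" by blast
    have "continuous_map mtopology euclidean g"
      unfolding cont_map
    proof (intro ballI allI impI)
      fix p and \<epsilon> :: real assume p: "p \<in> points G" and \<epsilon>: "0 < \<epsilon>"
      obtain r where r: "0 < r" and star: "\<And>q l. path_len G p q l \<Longrightarrow> l < r \<Longrightarrow>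
          q = p \<or> (\<exists>(e, s)\<in>places p. \<exists>t\<in>I e. ep e t = q \<and> \<bar>s - t\<bar> \<le> l)"
        using star[OF p] by blast
      have "\<exists>\<delta>>0. \<forall>z\<in>places p. \<forall>t\<in>I (fst z). \<bar>t - snd z\<bar> < \<delta> \<longrightarrow> dist (u (fst z) t) (u (fst z) (snd z)) < \<epsilon>"
      proof (rule finite_uniform_pos[OF finite_places[OF p]])
        fix z assume "z \<in> places p"
        then have "continuous_on (I (fst z)) (u (fst z))" "snd z \<in> I (fst z)" by (auto simp: places_def cont)
        then show "\<exists>\<delta>>0. \<forall>t\<in>I (fst z). \<bar>t - snd z\<bar> < \<delta> \<longrightarrow> dist (u (fst z) t) (u (fst z) (snd z)) < \<epsilon>"
          using \<epsilon> unfolding continuous_on_iff dist_real_def by blast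
      qed auto
      then obtain \<delta> where \<delta>: "\<delta> > 0"
        and close: "\<And>e s t. (e, s) \<in> places p \<Longrightarrow> t \<in> I e \<Longrightarrow> \<bar>t - s\<bar> < \<delta> \<Longrightarrow> dist (u e t) (u e s) < \<epsilon>"
        by fastforce
      have "dist (g p) (g q) < \<epsilon>" if q: "q \<in> points G" "graph_dist G p q < min r \<delta>" for q
      proof -
        obtain l where l: "path_len G p q l" "l < min r \<delta>" using short_path[OF p q] .
        show ?thesis
        proof (cases "q = p")
          case False
          then obtain e s t where *: "(e, s) \<in> places p" "t \<in> I e" "ep e t = q" "\<bar>s - t\<bar> \<le> l"
            using star[OF l(1)] l(2) by auto
          then have "dist (u e t) (u e s) < \<epsilon>" using l(2) by (intro close) auto
          moreover have "u e t = g q" "u e s = g p" using * u by (auto simp: places_def)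
          ultimately show ?thesis by (simp add: dist_commute)
        qed (use \<epsilon> in simp)
      qed
      then show "\<exists>\<delta>>0. \<forall>q. q \<in> points G \<and> graph_dist G p q < \<delta> \<longrightarrow> dist (g p) (g q) < \<epsilon>"
        using r \<delta> by (intro exI[of _ "min r \<delta>"]) auto
    qed
    then show "continuous_fam G u" unfolding continuous_fam_def using u by blast
  qed
qed

text \<open>
  A bounded piece of an open edge. Without the vertices, its trace on all other edges is empty.
\<close>

definition seg :: "'e \<Rightarrow> real \<Rightarrow> real set" where
  "seg e R = {x. 0 < x \<and> x < R \<and> ereal x < len G e}"

lemma seg_part:
  assumes e: "e \<in> E"
  shows "bounded_part G (Inner e ` seg e R)" "measurable_part G (Inner e ` seg e R)"
    "edge_trace G (Inner e ` seg e R) e = seg e R"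
proof -
  have sub: "seg e R \<subseteq> I e" by (auto simp: seg_def edge_interval_def)
  have ep: "ep e x = Inner e x" if "x \<in> seg e R" for x
    using that by (auto simp: seg_def edge_point_def)
  show tr: "edge_trace G (Inner e ` seg e R) e = seg e R"
  proof
    show "seg e R \<subseteq> edge_trace G (Inner e ` seg e R) e"
      using sub ep by (force simp: edge_trace_def)
    show "edge_trace G (Inner e ` seg e R) e \<subseteq> seg e R"
      by (auto simp: edge_trace_def edge_point_def split: if_splits)
  qed
  have tr': "edge_trace G (Inner e ` seg e R) e' = {}" if "e' \<noteq> e" for e'
    using that by (auto simp: edge_trace_def edge_point_def split: if_splits)
  have "graph_dist G (Inner e s) (Inner e t) \<le> \<bar>R\<bar>" if "s \<in> seg e R" "t \<in> seg e R" for s t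
  proof -
    have "graph_dist G (ep e s) (ep e t) \<le> \<bar>s - t\<bar>" using that sub by (intro graph_dist_segment e) auto
    also have "\<dots> \<le> \<bar>R\<bar>" using that by (auto simp: seg_def)
    finally show ?thesis using that ep by simp
  qed
  moreover have "Inner e ` seg e R \<subseteq> points G" using e by (auto simp: points_def seg_def)
  ultimately show "bounded_part G (Inner e ` seg e R)" unfolding bounded_part_def by blast
  have "seg e R = {0<..<R} \<inter> interior (I e)" by (auto simp: seg_def interior_edge_interval)
  then have "open (seg e R)" by auto
  then have "seg e R \<in> sets lebesgue" by simp
  then show "measurable_part G (Inner e ` seg e R)"
    unfolding measurable_part_def using tr tr' by (metis sets.empty_sets)
qed

lemma seg_open: "open (seg e R)"
proof -
  have "seg e R = {0<..<R} \<inter> interior (I e)" by (auto simp: seg_def interior_edge_interval)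
  then show ?thesis by auto
qed

lemma L1_loc_seg:
  "L1_loc G f \<Longrightarrow> e \<in> E \<Longrightarrow> set_integrable lebesgue (seg e R) (f e)"
  using seg_part[of e R] unfolding L1_loc_def L1_on_def by metis

lemma L2_loc_seg:
  assumes "L2_loc G f" "e \<in> E"
  shows "set_borel_measurable lebesgue (seg e R) (f e)" "set_integrable lebesgue (seg e R) (\<lambda>x. (norm (f e x))\<^sup>2)"
  using assms seg_part[of e R] unfolding L2_loc_def L2_on_def L1_on_def by metis+

end

section \<open>The Hilbert space of a metric graph\<close>

lemma square_integrable_AE:
  assumes "square_integrable M G" "F \<in> borel_measurable M" "AE x in M. F x = G x"
  shows "square_integrable M F"
proof -
  have [measurable]: "F \<in> borel_measurable M" "G \<in> borel_measurable M"
    and i: "integrable M (\<lambda>x. (cmod (G x))\<^sup>2)" using assms by (auto simp: square_integrable_def)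
  have "integrable M (\<lambda>x. (cmod (F x))\<^sup>2)"
    by (rule integrable_cong_AE_imp[OF i]) (measurable, use assms(3) in auto)
  then show ?thesis using assms(2) by (simp add: square_integrable_def)
qed

lemma square_integrable_null:
  assumes "square_integrable M F" "sqnorm M F = 0"
  shows "AE x in M. F x = 0"
  using integral_nonneg_eq_0_iff_AE[of M "\<lambda>x. (cmod (F x))\<^sup>2"] assms
  by (auto simp: square_integrable_def)

lemma ip_self: "(LINT x|M. F x * cnj (F x)) = complex_of_real (sqnorm M F)"
  by (subst integral_complex_of_real[symmetric]) (simp only: complex_norm_square)

context mgraph
begin

sublocale edge_family "edges G" "edge_interval G"
  using lf by unfold_locales (auto simp: locally_finite_graph_def edge_interval_lebesgue)

lemma L1_on_points_iff:
  fixes f :: "('e, 'a::{banach, second_countable_topology}) fam"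
  shows "L1_on G (points G) f \<longleftrightarrow> integrable M (\<lambda>z. f (fst z) (snd z))"
proof -
  have "(\<lambda>e. LINT x:edge_trace G (points G) e|lebesgue. norm (f e x)) summable_on E \<longleftrightarrow>
        (\<lambda>e. LINT x:I e|lebesgue. norm (f e x)) summable_on E"
    by (rule summable_on_cong) (simp add: edge_trace_points)
  then show ?thesis by (simp add: L1_on_def integrable_M_iff edge_trace_points)
qed

lemma L2_on_points_iff:
  fixes u :: "('e, complex) fam"
  shows "L2_on G (points G) u \<longleftrightarrow> square_integrable M (\<lambda>z. u (fst z) (snd z))"
  by (simp add: L2_on_def square_integrable_def L1_on_points_iff measurable_M_iff edge_trace_points)

lemma graph_integral_eq:
  "integrable M (\<lambda>z. f (fst z) (snd z)) \<Longrightarrow> graph_integral G f = (LINT z|M. f (fst z) (snd z))"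
  by (simp add: graph_integral_def integral_M)

text \<open>
  Functions on the disjoint union of the edges take the place of families; \<open>cls F\<close> is the element of
  \<open>L\<^sup>2\<close> that \<open>F\<close> represents, and \<open>rp\<close> chooses a representative.
\<close>

definition cls :: "('e \<times> real \<Rightarrow> complex) \<Rightarrow> ('e, complex) fam set" where
  "cls F = L2_class G (\<lambda>e x. F (e, x))"

definition rp :: "('e, complex) fam set \<Rightarrow> 'e \<times> real \<Rightarrow> complex" where
  "rp a z = rep a (fst z) (snd z)"

lemma L2_class_eq_cls: "L2_class G u = cls (\<lambda>z. u (fst z) (snd z))"
  by (simp add: cls_def)

lemma mem_cls: "w \<in> cls F \<longleftrightarrow> square_integrable M (\<lambda>z. w (fst z) (snd z)) \<and> (AE z in M. w (fst z) (snd z) = F z)"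
  by (simp add: cls_def L2_class_def L2_on_points_iff AE_M_iff)

lemma cls_cong: assumes "AE z in M. F z = F' z" shows "cls F = cls F'"
proof -
  have "(AE z in M. w z = F z) \<longleftrightarrow> (AE z in M. w z = F' z)" for w
    using assms by (auto elim: eventually_elim2)
  then show ?thesis by (auto simp: mem_cls)
qed

lemma cls_eqD:
  assumes "square_integrable M F" "cls F = cls F'" shows "AE z in M. F z = F' z"
proof -
  have "(\<lambda>e x. F (e, x)) \<in> cls F" using assms(1) by (simp add: mem_cls)
  then have "(\<lambda>e x. F (e, x)) \<in> cls F'" using assms(2) by simp
  then show ?thesis by (simp add: mem_cls)
qed

lemma vectors_L2: "vectors (L2 G) = cls ` {F. square_integrable M F}"
proof -
  have "L2_class G ` {u. L2_on G (points G) u} = cls ` {F. square_integrable M F}"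
  proof (intro set_eqI iffI)
    fix a assume "a \<in> L2_class G ` {u. L2_on G (points G) u}"
    then show "a \<in> cls ` {F. square_integrable M F}" by (auto simp: L2_on_points_iff L2_class_eq_cls)
  next
    fix a assume "a \<in> cls ` {F. square_integrable M F}"
    then obtain F where "square_integrable M F" "a = cls F" by auto
    then show "a \<in> L2_class G ` {u. L2_on G (points G) u}"
      by (intro image_eqI[of _ _ "\<lambda>e x. F (e, x)"]) (auto simp: L2_on_points_iff cls_def)
  qed
  then show ?thesis by (simp add: L2_def)
qed

lemma rp_cls: assumes "square_integrable M F"
  shows "square_integrable M (rp (cls F))" "AE z in M. rp (cls F) z = F z"
proof -
  have "(\<lambda>e x. F (e, x)) \<in> cls F" using assms by (simp add: mem_cls)
  then have "rep (cls F) \<in> cls F" unfolding rep_def by (rule someI[of "\<lambda>w. w \<in> cls F"])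
  then show "square_integrable M (rp (cls F))" "AE z in M. rp (cls F) z = F z"
    by (simp_all add: mem_cls rp_def[abs_def])
qed

lemma vadd_cls:
  assumes "square_integrable M F" "square_integrable M F'"
  shows "vadd (L2 G) (cls F) (cls F') = cls (\<lambda>z. F z + F' z)"
proof -
  have "vadd (L2 G) (cls F) (cls F') = cls (\<lambda>z. rp (cls F) z + rp (cls F') z)"
    by (simp add: L2_def cls_def rp_def)
  also have "\<dots> = cls (\<lambda>z. F z + F' z)"
    using rp_cls(2)[OF assms(1)] rp_cls(2)[OF assms(2)] by (intro cls_cong) (auto elim: eventually_elim2)
  finally show ?thesis .
qed

lemma vscale_cls:
  assumes "square_integrable M F" shows "vscale (L2 G) c (cls F) = cls (\<lambda>z. c * F z)"
proof -
  have "vscale (L2 G) c (cls F) = cls (\<lambda>z. c * rp (cls F) z)"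
    by (simp add: L2_def cls_def rp_def)
  also have "\<dots> = cls (\<lambda>z. c * F z)"
    using rp_cls(2)[OF assms(1)] by (intro cls_cong) (auto elim: eventually_mono)
  finally show ?thesis .
qed

lemma vinner_cls:
  assumes F: "square_integrable M F" "square_integrable M F'"
  shows "vinner (L2 G) (cls F) (cls F') = (LINT z|M. F z * cnj (F' z))"
proof -
  have i: "integrable M (\<lambda>z. rp (cls F) z * cnj (rp (cls F') z))"
    using F by (intro square_integrable_prod rp_cls)
  have "vinner (L2 G) (cls F) (cls F') = graph_integral G (\<lambda>e x. rp (cls F) (e, x) * cnj (rp (cls F') (e, x)))"
    by (simp add: L2_def rp_def)
  also have "\<dots> = (LINT z|M. rp (cls F) z * cnj (rp (cls F') z))"
    using i by (subst graph_integral_eq) auto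
  also have "\<dots> = (LINT z|M. F z * cnj (F' z))"
  proof (rule integral_cong_AE)
    show "AE z in M. rp (cls F) z * cnj (rp (cls F') z) = F z * cnj (F' z)"
      using rp_cls(2)[OF F(1)] rp_cls(2)[OF F(2)] by eventually_elim simp
  qed (use i square_integrable_prod[OF F] in \<open>auto intro: borel_measurable_integrable\<close>)
  finally show ?thesis .
qed

lemma square_integrable_add: "square_integrable M F \<Longrightarrow> square_integrable M F' \<Longrightarrow> square_integrable M (\<lambda>z. F z + F' z)"
  using square_integrable_lincomb[of M F F' 1 1] by simp

lemma square_integrable_mult: "square_integrable M F \<Longrightarrow> square_integrable M (\<lambda>z. c * F z)"
  using square_integrable_lincomb[of M F F c 0] by simp

lemma L2_form: "pos_form (vectors (L2 G)) (vadd (L2 G)) (vscale (L2 G)) (vinner (L2 G))"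
proof -
  interpret S: pos_form "{F. square_integrable M F}" "\<lambda>f g x. f x + g x" "\<lambda>c f x. c * f x"
     "\<lambda>f g. LINT x|M. f x * cnj (g x)" by (rule square_integrable_form)
  show ?thesis
  proof
    show "vectors (L2 G) \<noteq> {}" using S.nonempty by (simp add: vectors_L2)
  next
    fix a b c assume "a \<in> vectors (L2 G)" "b \<in> vectors (L2 G)" "c \<in> vectors (L2 G)"
    then obtain F F' K where "square_integrable M F" "square_integrable M F'" "square_integrable M K"
      and "a = cls F" "b = cls F'" "c = cls K" by (auto simp: vectors_L2)
    then show "vinner (L2 G) (vadd (L2 G) a b) c = vinner (L2 G) a c + vinner (L2 G) b c"
      using S.q_add[of F F' K] by (simp add: vadd_cls vinner_cls square_integrable_add)
  next
    fix a b assume "a \<in> vectors (L2 G)" "b \<in> vectors (L2 G)"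
    then show "vadd (L2 G) a b \<in> vectors (L2 G)" by (auto simp: vectors_L2 vadd_cls square_integrable_add)
  next
    fix a c assume "a \<in> vectors (L2 G)"
    then show "vscale (L2 G) c a \<in> vectors (L2 G)" by (auto simp: vectors_L2 vscale_cls square_integrable_mult)
  next
    fix a b c assume "a \<in> vectors (L2 G)" "b \<in> vectors (L2 G)"
    then obtain F F' where "square_integrable M F" "square_integrable M F'" "a = cls F" "b = cls F'"
      by (auto simp: vectors_L2)
    then show "vinner (L2 G) (vscale (L2 G) c a) b = c * vinner (L2 G) a b"
      using S.q_scale[of F F' c] by (simp add: vscale_cls vinner_cls square_integrable_mult)
  next
    fix a b assume "a \<in> vectors (L2 G)" "b \<in> vectors (L2 G)"
    then obtain F F' where "square_integrable M F" "square_integrable M F'" "a = cls F" "b = cls F'"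
      by (auto simp: vectors_L2)
    then show "vinner (L2 G) b a = cnj (vinner (L2 G) a b)"
      using S.q_herm[of F F'] by (simp add: vinner_cls)
  next
    fix a assume "a \<in> vectors (L2 G)"
    then obtain F where "square_integrable M F" "a = cls F" by (auto simp: vectors_L2)
    then show "0 \<le> Re (vinner (L2 G) a a)"
      using S.q_pos[of F] by (simp add: vinner_cls)
  qed
qed

interpretation H: pos_form "vectors (L2 G)" "vadd (L2 G)" "vscale (L2 G)" "vinner (L2 G)"
  by (rule L2_form)

lemma diff_cls:
  assumes "square_integrable M F" "square_integrable M F'"
  shows "H.diff (cls F) (cls F') = cls (\<lambda>z. F z - F' z)"
  using assms vadd_cls[OF assms(1) square_integrable_mult[OF assms(2), of "-1"]]
  by (simp add: H.diff_def vscale_cls)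

lemma norm_diff_cls:
  assumes "square_integrable M F" "square_integrable M F'"
  shows "Re (vinner (L2 G) (H.diff (cls F) (cls F')) (H.diff (cls F) (cls F'))) = sqdist M F F'"
  using assms by (simp add: diff_cls vinner_cls square_integrable_diff ip_self del: complex_cnj_diff)

lemma L2_complete: "H.complete_form"
  unfolding H.complete_form_def
proof (intro allI impI)
  fix s :: "nat \<Rightarrow> _" assume s: "\<forall>n. s n \<in> vectors (L2 G)"
    and C: "\<forall>\<epsilon>>0. \<exists>N. \<forall>m\<ge>N. \<forall>n\<ge>N. Re (vinner (L2 G) (H.diff (s m) (s n)) (H.diff (s m) (s n))) < \<epsilon>"
  have "\<forall>n. \<exists>F. square_integrable M F \<and> s n = cls F" using s by (auto simp: vectors_L2)
  then obtain F where F: "\<And>n. square_integrable M (F n)" and sF: "\<And>n. s n = cls (F n)" by metis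
  have "L2_Cauchy M F" using C F by (simp add: L2_Cauchy_def sF norm_diff_cls)
  then obtain L where "square_integrable M L" "(\<lambda>n. sqdist M (F n) L) \<longlonglongrightarrow> 0"
    using Riesz_Fischer by blast
  then show "\<exists>x\<in>vectors (L2 G). (\<lambda>n. Re (vinner (L2 G) (H.diff (s n) x) (H.diff (s n) x))) \<longlonglongrightarrow> 0"
    by (intro bexI[of _ "cls L"]) (auto simp: sF norm_diff_cls F vectors_L2)
qed

lemma L2_definite:
  assumes "a \<in> vectors (L2 G)" "b \<in> vectors (L2 G)" "vdist (L2 G) a b = 0"
  shows "a = b"
proof -
  obtain F F' where F: "square_integrable M F" "square_integrable M F'" and ab: "a = cls F" "b = cls F'"
    using assms by (auto simp: vectors_L2)
  have "sqdist M F F' = 0"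
    using assms(3) norm_diff_cls[OF F] by (simp add: vdist_def ab H.diff_def)
  then have "AE z in M. F z - F' z = 0" by (rule square_integrable_null[OF square_integrable_diff[OF F]])
  then show ?thesis unfolding ab by (intro cls_cong) (auto elim: eventually_mono)
qed

end

section \<open>The magnetic Sobolev space as a subspace\<close>

lemma locally_integrable_measurable:
  assumes "open S" "locally_integrable S f"
  shows "set_borel_measurable lebesgue S f"
proof -
  obtain C where C: "\<And>n::nat. compact (C n)" "\<And>n. C n \<subseteq> S" "\<And>n. C n \<subseteq> interior (C (Suc n))" "\<Union> (range C) = S"
    using open_Union_compact_subsets[OF \<open>open S\<close>] by metis
  have mono: "C m \<subseteq> C n" if "m \<le> n" for m n
    using that by (induction n rule: dec_induct) (use C(3) interior_subset in blast)+
  show ?thesis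
    unfolding set_borel_measurable_def
  proof (rule borel_measurable_LIMSEQ_metric)
    show "(\<lambda>x. indicator (C n) x *\<^sub>R f x) \<in> borel_measurable lebesgue" for n
      using assms(2) C(1,2) unfolding locally_integrable_def set_integrable_def
      by (blast intro: borel_measurable_integrable)
    show "(\<lambda>n. indicator (C n) x *\<^sub>R f x) \<longlonglongrightarrow> indicator S x *\<^sub>R f x" for x
    proof (cases "x \<in> S")
      case True
      then obtain m where "x \<in> C m" using C(4) by blast
      then have "\<forall>n\<ge>m. x \<in> C n" using mono by blast
      then have "\<forall>\<^sub>F n in sequentially. indicator S x *\<^sub>R f x = indicator (C n) x *\<^sub>R f x"
        using True unfolding eventually_sequentially by (intro exI[of _ m]) simp
      then show ?thesis by (rule Lim_transform_eventually[OF tendsto_const])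
    next
      case False
      then have "x \<notin> C n" for n using C(2) by blast
      then show ?thesis using False by simp
    qed
  qed
qed

locale magnetic = mgraph G for G :: "('v, 'e) metric_graph" +
  fixes A V :: "('e, real) fam"
  assumes V_ge: "\<And>e x. e \<in> edges G \<Longrightarrow> x \<in> edge_interval G e \<Longrightarrow> 1 \<le> V e x"
    and A_loc: "L2_loc G A" and V_loc: "L1_loc G V"
begin

abbreviation "J e \<equiv> interior (edge_interval G e)"

lemma J_eq: "J e = {x. 0 < x \<and> ereal x < len G e}" by (rule interior_edge_interval)

lemma J_sub: "J e \<subseteq> I e" by (rule interior_subset)

lemma finite_ends: "finite (I e - J e)"
proof (rule finite_subset)
  show "I e - J e \<subseteq> {0, real_of_ereal (len G e)}"
    unfolding J_eq by (auto simp: edge_interval_def less_le real_len)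
qed simp

lemma AE_J: "AE x in lebesgue. x \<in> I e \<longrightarrow> x \<in> J e"
proof -
  have "I e - J e \<in> null_sets lebesgue"
    using finite_ends[of e] by (intro null_sets_completionI finite_imp_null_set_lborel)
  then have "AE x in lebesgue. x \<notin> I e - J e" by (rule AE_not_in)
  then show ?thesis by (rule eventually_mono) auto
qed

lemma seg_J: "seg e R \<subseteq> J e" by (auto simp: seg_def J_eq)

lemma seg_sets: "seg e R \<in> sets lebesgue" using seg_open by simp

text \<open>
  A closed edge differs from its interior by at most two points.
\<close>

lemma measurable_I_of_J:
  fixes f :: "real \<Rightarrow> 'b::{real_normed_vector, second_countable_topology}"
  assumes "set_borel_measurable lebesgue (J e) f"
  shows "set_borel_measurable lebesgue (I e) f"
proof -
  have "indicator (I e) x *\<^sub>R f x = indicator (J e) x *\<^sub>R f x + (\<Sum>p\<in>I e - J e. indicator {p} x *\<^sub>R f p)" for x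
  proof (cases "x \<in> I e - J e")
    case True
    then have "(\<Sum>p\<in>I e - J e. indicator {p} x *\<^sub>R f p) = indicator {x} x *\<^sub>R f x"
      using finite_ends by (subst sum.remove[of _ x]) (auto intro!: sum.neutral)
    then show ?thesis using True by simp
  next
    case False
    then have "(\<Sum>p\<in>I e - J e. indicator {p} x *\<^sub>R f p) = 0"
      by (intro sum.neutral) (use False J_sub in \<open>auto simp: indicator_def\<close>)
    then show ?thesis using False J_sub[of e] by (auto simp: indicator_def)
  qed
  moreover have "(\<lambda>x. indicator (J e) x *\<^sub>R f x + (\<Sum>p\<in>I e - J e. indicator {p} x *\<^sub>R f p)) \<in> borel_measurable lebesgue"
  proof (intro borel_measurable_add borel_measurable_sum)
    show "(\<lambda>x. indicator (J e) x *\<^sub>R f x) \<in> borel_measurable lebesgue"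
      using assms by (simp add: set_borel_measurable_def)
    show "(\<lambda>x. indicator {p} x *\<^sub>R f p) \<in> borel_measurable lebesgue" for p
      by (intro borel_measurable_scaleR borel_measurable_indicator) auto
  qed
  ultimately show ?thesis unfolding set_borel_measurable_def by simp
qed

lemma measurable_J_of_seg:
  fixes f :: "real \<Rightarrow> 'b::{real_normed_vector, second_countable_topology}"
  assumes "\<And>R. set_borel_measurable lebesgue (seg e R) f"
  shows "set_borel_measurable lebesgue (J e) f"
  unfolding set_borel_measurable_def
proof (rule borel_measurable_LIMSEQ_metric)
  show "(\<lambda>x. indicator (seg e (real n)) x *\<^sub>R f x) \<in> borel_measurable lebesgue" for n
    using assms unfolding set_borel_measurable_def .
  show "(\<lambda>n. indicator (seg e (real n)) x *\<^sub>R f x) \<longlonglongrightarrow> indicator (J e) x *\<^sub>R f x" for x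
  proof (rule Lim_transform_eventually[OF tendsto_const])
    obtain m :: nat where "x < real m" using reals_Archimedean2 by blast
    then show "\<forall>\<^sub>F n in sequentially. indicator (J e) x *\<^sub>R f x = indicator (seg e (real n)) x *\<^sub>R f x"
      by (auto simp: eventually_sequentially seg_def J_eq indicator_def intro!: exI[of _ m])
  qed
qed

lemma A_measurable: "e \<in> E \<Longrightarrow> set_borel_measurable lebesgue (I e) (A e)"
  by (intro measurable_I_of_J measurable_J_of_seg L2_loc_seg(1)[OF A_loc])

lemma V_measurable: assumes "e \<in> E" shows "set_borel_measurable lebesgue (I e) (V e)"
proof (intro measurable_I_of_J measurable_J_of_seg)
  show "set_borel_measurable lebesgue (seg e R) (V e)" for R
    using L1_loc_seg[OF V_loc assms, of R] unfolding set_integrable_def set_borel_measurable_def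
    by (rule borel_measurable_integrable)
qed

lemma continuous_measurable:
  fixes u :: "real \<Rightarrow> complex"
  assumes "continuous_on (I e) u" shows "set_borel_measurable lebesgue (I e) u"
proof -
  have "I e \<in> sets borel" by (simp add: edge_interval_eq)
  then have "(\<lambda>x. indicator (I e) x *\<^sub>R u x) \<in> borel_measurable borel"
    by (rule borel_measurable_continuous_on_indicator[OF _ assms])
  then show ?thesis unfolding set_borel_measurable_def by (intro measurable_completion) simp
qed

lemma A_M [measurable]: "(\<lambda>z. A (fst z) (snd z)) \<in> borel_measurable M"
  by (simp add: measurable_M_iff A_measurable)

lemma V_M [measurable]: "(\<lambda>z. V (fst z) (snd z)) \<in> borel_measurable M"
  by (simp add: measurable_M_iff V_measurable)

lemma continuous_M: "(\<And>e. e \<in> E \<Longrightarrow> continuous_on (I e) (u e)) \<Longrightarrow> (\<lambda>z. u (fst z) (snd z) :: complex) \<in> borel_measurable M"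
  by (simp add: measurable_M_iff continuous_measurable)

lemma loc_int_M:
  assumes "\<And>e. e \<in> E \<Longrightarrow> locally_integrable (J e) (g e)"
  shows "(\<lambda>z. g (fst z) (snd z)) \<in> borel_measurable M"
  using assms by (auto simp: measurable_M_iff intro!: measurable_I_of_J locally_integrable_measurable)

text \<open>
  The square root of the potential turns \<open>\<integral> V u v\<^sup>*\<close> into an inner product in \<open>L\<^sup>2\<close>, so that \<open>Q u v\<close> becomes
  \<open>(D\<^sub>A u, D\<^sub>A v) + (W u, W v)\<close>.
\<close>

definition W :: "('e, complex) fam \<Rightarrow> 'e \<times> real \<Rightarrow> complex" where
  "W u z = of_real (sqrt (V (fst z) (snd z))) * u (fst z) (snd z)"

definition DA :: "('e, complex) fam \<Rightarrow> 'e \<times> real \<Rightarrow> complex" where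
  "DA u z = mag_deriv G A u (fst z) (snd z)"

abbreviation fn :: "('e, complex) fam \<Rightarrow> 'e \<times> real \<Rightarrow> complex" where
  "fn u z \<equiv> u (fst z) (snd z)"

abbreviation "H1 \<equiv> H1_mag G A V"

lemma W_measurable:
  assumes [measurable]: "fn u \<in> borel_measurable M" shows "W u \<in> borel_measurable M"
  unfolding W_def[abs_def] by (intro borel_measurable_times measurable_compose[OF _ borel_measurable_of_real]) measurable

lemma V_ge_M: "z \<in> space M \<Longrightarrow> 1 \<le> V (fst z) (snd z)"
  using V_ge by (auto simp: space_M \<Omega>_def)

lemma W_sq: "z \<in> space M \<Longrightarrow> (cmod (W u z))\<^sup>2 = V (fst z) (snd z) * (cmod (fn u z))\<^sup>2"
  using V_ge_M[of z] by (simp add: W_def norm_mult power_mult_distrib)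

lemma W_mult: "z \<in> space M \<Longrightarrow> W u z * cnj (W v z) = of_real (V (fst z) (snd z)) * fn u z * cnj (fn v z)"
  using V_ge_M[of z] by (simp add: W_def mult.assoc mult.left_commute flip: of_real_mult)

lemma fn_le_W: "z \<in> space M \<Longrightarrow> (cmod (fn u z))\<^sup>2 \<le> (cmod (W u z))\<^sup>2"
  using mult_right_mono[OF V_ge_M[of z], of "(cmod (fn u z))\<^sup>2"] by (simp add: W_sq)

lemma V_integrable_iff:
  assumes "fn u \<in> borel_measurable M"
  shows "L1_on G (points G) (\<lambda>e x. V e x * (norm (u e x))\<^sup>2) \<longleftrightarrow> square_integrable M (W u)"
proof -
  have "integrable M (\<lambda>z. V (fst z) (snd z) * (cmod (fn u z))\<^sup>2) \<longleftrightarrow> integrable M (\<lambda>z. (cmod (W u z))\<^sup>2)"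
    by (rule Bochner_Integration.integrable_cong) (simp_all add: W_sq)
  then show ?thesis using W_measurable[OF assms] by (simp add: L1_on_points_iff square_integrable_def)
qed

lemma fn_square_integrable:
  assumes "fn u \<in> borel_measurable M" "square_integrable M (W u)"
  shows "square_integrable M (fn u)" "(LINT z|M. (cmod (fn u z))\<^sup>2) \<le> (LINT z|M. (cmod (W u z))\<^sup>2)"
proof -
  have i: "integrable M (\<lambda>z. (cmod (W u z))\<^sup>2)" using assms by (simp add: square_integrable_def)
  have [measurable]: "fn u \<in> borel_measurable M" by fact
  have i': "integrable M (\<lambda>z. (cmod (fn u z))\<^sup>2)"
    by (rule Bochner_Integration.integrable_bound[OF i]) (measurable, intro AE_I2, simp only: real_norm_def abs_power2 fn_le_W)
  then show "square_integrable M (fn u)" using assms by (simp add: square_integrable_def)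
  show "(LINT z|M. (cmod (fn u z))\<^sup>2) \<le> (LINT z|M. (cmod (W u z))\<^sup>2)"
    by (rule integral_mono[OF i' i]) (rule fn_le_W)
qed

lemma H1_D:
  assumes u: "u \<in> H1"
  shows "\<And>e. e \<in> E \<Longrightarrow> continuous_on (I e) (u e)"
    and "\<exists>g. \<forall>e\<in>E. \<forall>x\<in>I e. u e x = g (ep e x)"
    and "\<And>e. e \<in> E \<Longrightarrow> has_weak_deriv (J e) (u e) (weak_deriv G u e)"
    and "square_integrable M (DA u)" and "square_integrable M (W u)"
    and "square_integrable M (fn u)" and "fn u \<in> borel_measurable M"
    and "(LINT z|M. (cmod (fn u z))\<^sup>2) \<le> (LINT z|M. (cmod (W u z))\<^sup>2)"
proof -
  have c: "continuous_fam G u" and wd: "weakly_differentiable G u"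
    and D: "L2_on G (points G) (mag_deriv G A u)"
    and VL: "L1_on G (points G) (\<lambda>e x. V e x * (norm (u e x))\<^sup>2)"
    using u by (auto simp: H1_mag_def)
  show c1: "\<And>e. e \<in> E \<Longrightarrow> continuous_on (I e) (u e)" and "\<exists>g. \<forall>e\<in>E. \<forall>x\<in>I e. u e x = g (ep e x)"
    using c unfolding continuous_fam_iff by blast+
  show "has_weak_deriv (J e) (u e) (weak_deriv G u e)" if "e \<in> E" for e
    using wd that unfolding weakly_differentiable_def weak_deriv_def by (metis (mono_tags) someI_ex)
  show m: "fn u \<in> borel_measurable M" using c1 by (rule continuous_M)
  show "square_integrable M (DA u)"
    using D by (simp add: L2_on_points_iff DA_def[abs_def])
  show W: "square_integrable M (W u)" using VL V_integrable_iff[OF m] by blast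
  show "square_integrable M (fn u)" "(LINT z|M. (cmod (fn u z))\<^sup>2) \<le> (LINT z|M. (cmod (W u z))\<^sup>2)"
    by (rule fn_square_integrable[OF m W])+
qed

text \<open>
  Membership can be checked with any weak derivative in place of the chosen one, and then determines
  the magnetic derivative up to a null set.
\<close>

lemma H1_I:
  assumes c: "\<And>e. e \<in> E \<Longrightarrow> continuous_on (I e) (u e)"
    and g: "\<And>e x. e \<in> E \<Longrightarrow> x \<in> I e \<Longrightarrow> u e x = g (ep e x)"
    and wd: "\<And>e. e \<in> E \<Longrightarrow> has_weak_deriv (J e) (u e) (u' e)"
    and F: "square_integrable M F"
    and D: "AE z in M. (1 / \<i>) * u' (fst z) (snd z) - of_real (A (fst z) (snd z)) * fn u z = F z"
    and W: "square_integrable M (W u)"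
  shows "u \<in> H1" "AE z in M. DA u z = F z"
proof -
  have wdf: "weakly_differentiable G u" using wd by (auto simp: weakly_differentiable_def)
  have wd2: "has_weak_deriv (J e) (u e) (weak_deriv G u e)" if "e \<in> E" for e
    using wdf that unfolding weakly_differentiable_def weak_deriv_def by (metis (mono_tags) someI_ex)
  have "AE x in lebesgue. x \<in> I e \<longrightarrow> weak_deriv G u e x = u' e x" if "e \<in> E" for e
  proof -
    have "AE x in lebesgue. x \<in> J e \<longrightarrow> weak_deriv G u e x = u' e x"
      by (rule has_weak_deriv_unique[OF open_interior wd2[OF that] wd[OF that]]) simp
    then show ?thesis using AE_J[of e] by eventually_elim auto
  qed
  then have "AE z in M. weak_deriv G u (fst z) (snd z) = u' (fst z) (snd z)" by (simp add: AE_M_iff)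
  then show DF: "AE z in M. DA u z = F z"
    using D by eventually_elim (simp add: DA_def mag_deriv_def)
  have m: "fn u \<in> borel_measurable M" using c by (rule continuous_M)
  have mg: "(\<lambda>z. weak_deriv G u (fst z) (snd z)) \<in> borel_measurable M"
    using wd2 by (intro loc_int_M) (simp add: has_weak_deriv_def)
  have "DA u \<in> borel_measurable M"
    unfolding DA_def[abs_def] mag_deriv_def
    by (intro borel_measurable_diff borel_measurable_times borel_measurable_const mg m measurable_compose[OF A_M borel_measurable_of_real])
  then have "square_integrable M (DA u)" by (rule square_integrable_AE[OF F _ DF])
  then have "L2_on G (points G) (mag_deriv G A u)" by (simp add: L2_on_points_iff DA_def[abs_def])
  moreover have "continuous_fam G u" using c g by (auto simp: continuous_fam_iff)
  moreover have "L1_on G (points G) (\<lambda>e x. V e x * (norm (u e x))\<^sup>2)"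
    using V_integrable_iff[OF m] W by blast
  ultimately show "u \<in> H1" using wdf by (simp add: H1_mag_def)
qed

text \<open>
  The chosen weak derivative is not linear on the nose, only almost everywhere.
\<close>

lemma H1_lincomb:
  assumes u: "u \<in> H1" and v: "v \<in> H1"
  shows "(\<lambda>e x. s * u e x + t * v e x) \<in> H1" (is "?w \<in> _")
    and "AE z in M. DA (\<lambda>e x. s * u e x + t * v e x) z = s * DA u z + t * DA v z"
proof -
  obtain gu gv where g: "\<And>e x. e \<in> E \<Longrightarrow> x \<in> I e \<Longrightarrow> u e x = gu (ep e x)"
    "\<And>e x. e \<in> E \<Longrightarrow> x \<in> I e \<Longrightarrow> v e x = gv (ep e x)"
    using H1_D(2)[OF u] H1_D(2)[OF v] by blast
  have W: "W ?w = (\<lambda>z. s * W u z + t * W v z)"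
    by (auto simp: W_def algebra_simps)
  have 1: "continuous_on (I e) (?w e)" if "e \<in> E" for e
    using H1_D(1)[OF u that] H1_D(1)[OF v that] by (intro continuous_intros)
  have 2: "?w e x = s * gu (ep e x) + t * gv (ep e x)" if "e \<in> E" "x \<in> I e" for e x
    using g that by simp
  have 3: "has_weak_deriv (J e) (?w e) (\<lambda>x. s * weak_deriv G u e x + t * weak_deriv G v e x)" if "e \<in> E" for e
    using H1_D(3)[OF u that] H1_D(3)[OF v that] by (rule has_weak_deriv_lincomb)
  have 4: "square_integrable M (\<lambda>z. s * DA u z + t * DA v z)"
    using H1_D(4)[OF u] H1_D(4)[OF v] by (rule square_integrable_lincomb)
  have 5: "AE z in M. (1 / \<i>) * (s * weak_deriv G u (fst z) (snd z) + t * weak_deriv G v (fst z) (snd z))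
       - of_real (A (fst z) (snd z)) * fn ?w z = s * DA u z + t * DA v z"
    by (rule AE_I2) (simp add: DA_def mag_deriv_def algebra_simps)
  have 6: "square_integrable M (W ?w)"
    unfolding W using H1_D(5)[OF u] H1_D(5)[OF v] by (rule square_integrable_lincomb)
  show "?w \<in> H1" "AE z in M. DA ?w z = s * DA u z + t * DA v z"
    using H1_I[OF 1 2 3 4 5 6] by blast+
qed

lemma DA_cong:
  assumes u: "u \<in> H1" and v: "v \<in> H1" and eq: "AE z in M. fn u z = fn v z"
  shows "AE z in M. DA u z = DA v z"
proof -
  have "AE x in lebesgue. x \<in> I e \<longrightarrow> DA u (e, x) = DA v (e, x)" if e: "e \<in> E" for e
  proof -
    have ae: "AE x in lebesgue. x \<in> I e \<longrightarrow> u e x = v e x" using eq e by (simp add: AE_M_iff)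
    then have "AE x in lebesgue. x \<in> J e \<longrightarrow> u e x = v e x"
      by (rule eventually_mono) (use J_sub in blast)
    then have "AE x in lebesgue. x \<in> J e \<longrightarrow> weak_deriv G u e x = weak_deriv G v e x"
      by (rule has_weak_deriv_unique[OF open_interior H1_D(3)[OF u e] H1_D(3)[OF v e]])
    then show ?thesis using ae AE_J[of e] by eventually_elim (simp add: DA_def mag_deriv_def)
  qed
  then show ?thesis by (simp add: AE_M_iff)
qed

lemma Q_form_eq:
  assumes u: "u \<in> H1" and v: "v \<in> H1"
  shows "Q_form G A V u v = (LINT z|M. DA u z * cnj (DA v z)) + (LINT z|M. W u z * cnj (W v z))"
proof -
  have i: "integrable M (\<lambda>z. DA u z * cnj (DA v z))" "integrable M (\<lambda>z. W u z * cnj (W v z))"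
    using H1_D[OF u] H1_D[OF v] by (auto intro: square_integrable_prod)
  let ?f = "\<lambda>z. mag_deriv G A u (fst z) (snd z) * cnj (mag_deriv G A v (fst z) (snd z))
      + of_real (V (fst z) (snd z)) * fn u z * cnj (fn v z)"
  have eq: "DA u z * cnj (DA v z) + W u z * cnj (W v z) = ?f z" if "z \<in> space M" for z
    using W_mult[OF that] by (simp add: DA_def)
  have "integrable M ?f"
    using Bochner_Integration.integrable_add[OF i]
    by (subst Bochner_Integration.integrable_cong[OF HOL.refl eq[symmetric]])
  then have "Q_form G A V u v = (LINT z|M. ?f z)"
    unfolding Q_form_def by (subst graph_integral_eq) auto
  also have "\<dots> = (LINT z|M. DA u z * cnj (DA v z) + W u z * cnj (W v z))"
    by (rule Bochner_Integration.integral_cong[OF HOL.refl eq[symmetric]])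
  also have "\<dots> = (LINT z|M. DA u z * cnj (DA v z)) + (LINT z|M. W u z * cnj (W v z))"
    by (rule Bochner_Integration.integral_add[OF i])
  finally show ?thesis .
qed

lemma Q_form_cong:
  assumes u: "u \<in> H1" "u' \<in> H1" and v: "v \<in> H1" "v' \<in> H1"
    and eq: "AE z in M. fn u z = fn u' z" "AE z in M. fn v z = fn v' z"
  shows "Q_form G A V u v = Q_form G A V u' v'"
proof -
  note m = H1_D(4,5)[OF u(1)] H1_D(4,5)[OF u(2)] H1_D(4,5)[OF v(1)] H1_D(4,5)[OF v(2)]
  have "(LINT z|M. DA u z * cnj (DA v z)) = (LINT z|M. DA u' z * cnj (DA v' z))"
  proof (rule integral_cong_AE)
    show "AE z in M. DA u z * cnj (DA v z) = DA u' z * cnj (DA v' z)"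
      using DA_cong[OF u eq(1)] DA_cong[OF v eq(2)] by eventually_elim simp
  qed (use m in \<open>auto intro!: borel_measurable_integrable square_integrable_prod\<close>)
  moreover have "(LINT z|M. W u z * cnj (W v z)) = (LINT z|M. W u' z * cnj (W v' z))"
  proof (rule integral_cong_AE)
    show "AE z in M. W u z * cnj (W v z) = W u' z * cnj (W v' z)"
      using eq by eventually_elim (simp add: W_def)
  qed (use m in \<open>auto intro!: borel_measurable_integrable square_integrable_prod\<close>)
  ultimately show ?thesis using u v by (simp add: Q_form_eq)
qed

end

section \<open>The Sobolev inequality and completeness of the form domain\<close>

lemma (in edge_family) slice_integral_le:
  assumes e: "e \<in> E" and f: "integrable M f" and nn: "\<And>z. 0 \<le> (f z :: real)"
    and S: "S \<in> sets lebesgue" "S \<subseteq> I e"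
  shows "set_integrable lebesgue S (\<lambda>x. f (e, x))" "(LINT x:S|lebesgue. f (e, x)) \<le> (LINT z|M. f z)"
proof -
  have i: "set_integrable lebesgue (I e) (\<lambda>x. f (e, x))" and sum: "(\<lambda>e. LINT x:I e|lebesgue. f (e, x)) summable_on E"
    using f e nn by (simp_all add: integrable_M_iff)
  show iS: "set_integrable lebesgue S (\<lambda>x. f (e, x))" by (rule set_integrable_subset[OF i S])
  have nonneg: "0 \<le> (LINT x:I e'|lebesgue. f (e', x))" for e'
    unfolding set_lebesgue_integral_def by (rule Bochner_Integration.integral_nonneg) (simp add: nn)
  have "(LINT x:S|lebesgue. f (e, x)) \<le> (LINT x:I e|lebesgue. f (e, x))"
    unfolding set_lebesgue_integral_def
    by (rule integral_mono) (use i iS S nn in \<open>auto simp: set_integrable_def indicator_def\<close>)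
  also have "\<dots> = (\<Sum>e\<in>{e}. LINT x:I e|lebesgue. f (e, x))" by simp
  also have "\<dots> \<le> (\<Sum>\<^sub>\<infinity>e\<in>E. LINT x:I e|lebesgue. f (e, x))"
    by (rule finite_sum_le_infsum[OF sum]) (use e nonneg in auto)
  also have "\<dots> = (LINT z|M. f z)" by (rule integral_M[OF f, symmetric])
  finally show "(LINT x:S|lebesgue. f (e, x)) \<le> (LINT z|M. f z)" .
qed

lemma square_sum_le: "((x::real) + y)\<^sup>2 \<le> 2 * x\<^sup>2 + 2 * y\<^sup>2"
  using zero_le_power2[of "x - y"] by (simp add: power2_eq_square algebra_simps)

context magnetic
begin

lemma seg_eq:
  assumes "e \<in> E" "0 < R"
  obtains r where "0 < r" "r \<le> R" "seg e R = {0<..<r}" "{0..r} \<subseteq> I e" "\<And>x. x \<in> I e \<Longrightarrow> x < R \<Longrightarrow> x \<in> {0..r}"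
proof (cases "len G e")
  case (real l)
  then have "0 < l" using metric assms(1) by (auto simp: metric_graph_def)
  then show ?thesis
    by (intro that[of "min R l"]) (use real assms(2) in \<open>auto simp: seg_def edge_interval_def\<close>)
next
  case PInf
  then show ?thesis
    by (intro that[of R]) (use assms(2) in \<open>auto simp: seg_def edge_interval_def\<close>)
next
  case MInf
  then show ?thesis using metric assms(1) by (auto simp: metric_graph_def)
qed

lemma slice_square_integrable:
  assumes e: "e \<in> E" and F: "square_integrable M F"
  shows "square_integrable lebesgue (\<lambda>x. indicator (seg e R) x *\<^sub>R F (e, x))"
    and "(LINT x|lebesgue. (cmod (indicator (seg e R) x *\<^sub>R F (e, x)))\<^sup>2) \<le> sqnorm M F"
proof -
  have eq: "(cmod (indicator (seg e R) x *\<^sub>R F (e, x)))\<^sup>2 = indicator (seg e R) x *\<^sub>R (cmod (F (e, x)))\<^sup>2" for x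
    by (simp add: indicator_def)
  have sub: "seg e R \<subseteq> I e" using seg_J J_sub by blast
  have i: "integrable M (\<lambda>z. (cmod (F z))\<^sup>2)" and m: "F \<in> borel_measurable M"
    using F by (auto simp: square_integrable_def)
  have "set_borel_measurable lebesgue (seg e R) (\<lambda>x. F (e, x))"
    using m e by (intro set_borel_measurable_subset[OF _ _ sub]) (auto simp: measurable_M_iff seg_sets)
  then show "square_integrable lebesgue (\<lambda>x. indicator (seg e R) x *\<^sub>R F (e, x))"
    using slice_integral_le(1)[OF e i _ seg_sets sub]
    unfolding square_integrable_def eq by (simp add: set_borel_measurable_def set_integrable_def)
  show "(LINT x|lebesgue. (cmod (indicator (seg e R) x *\<^sub>R F (e, x)))\<^sup>2) \<le> sqnorm M F"
    using slice_integral_le(2)[OF e i _ seg_sets sub] unfolding eq by (simp add: set_lebesgue_integral_def)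
qed

definition A_norm :: "'e \<Rightarrow> real \<Rightarrow> real" where
  "A_norm e R = sqrt (LINT x:seg e R|lebesgue. (A e x)\<^sup>2)"

lemma A_norm_nonneg: "0 \<le> A_norm e R"
  unfolding A_norm_def set_lebesgue_integral_def by (simp add: Bochner_Integration.integral_nonneg)

lemma Holder_sqrt:
  assumes "square_integrable N p" "square_integrable N k"
    and "sqnorm N p \<le> a\<^sup>2" "0 \<le> a" "sqnorm N k \<le> b"
  shows "(LINT x|N. cmod (p x) * cmod (k x)) \<le> a * sqrt b"
proof -
  have nn: "0 \<le> sqnorm N p" "0 \<le> sqnorm N k" by (simp_all add: Bochner_Integration.integral_nonneg)
  have b: "0 \<le> b" using assms(5) nn(2) by linarith
  have "(LINT x|N. cmod (p x) * cmod (k x))\<^sup>2 \<le> sqnorm N p * sqnorm N k"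
    by (rule Holder_2(2)[OF assms(1,2)])
  also have "\<dots> \<le> a\<^sup>2 * b" using assms nn by (intro mult_mono) auto
  also have "\<dots> = (a * sqrt b)\<^sup>2" using b by (simp add: power_mult_distrib)
  finally show ?thesis by (rule power2_le_imp_le) (use assms(4) b in simp)
qed

text \<open>
  The first term pairs \<open>F\<close> with the constant \<open>1\<close> and the second one pairs \<open>A\<close> with \<open>K\<close>; the bounded length
  of the segment and the local square integrability of \<open>A\<close> enter here. With \<open>F\<close> the magnetic derivative
  of \<open>u\<close> and \<open>K = u\<close>, the function \<open>h\<close> is \<open>u'\<close>; the case \<open>K = 0\<close> compares \<open>L\<^sup>1\<close> with \<open>L\<^sup>2\<close>.
\<close>

lemma seg_bound:
  assumes e: "e \<in> E" and R: "0 < R" and F: "square_integrable M F" and K: "square_integrable M K"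
  defines "h \<equiv> \<lambda>x. \<i> * (F (e, x) + of_real (A e x) * K (e, x))"
  shows "set_integrable lebesgue (seg e R) h"
    and "(LINT x:seg e R|lebesgue. cmod (h x)) \<le> sqrt R * sqrt (sqnorm M F) + A_norm e R * sqrt (sqnorm M K)"
proof -
  let ?S = "seg e R"
  let ?f = "\<lambda>x. indicator ?S x *\<^sub>R F (e, x)" and ?k = "\<lambda>x. indicator ?S x *\<^sub>R K (e, x)"
  let ?a = "\<lambda>x. complex_of_real (indicator ?S x *\<^sub>R A e x)" and ?o = "\<lambda>x. complex_of_real (indicator ?S x)"
  obtain r where r: "0 < r" "r \<le> R" "?S = {0<..<r}" using seg_eq[OF e R] by metis
  have o: "square_integrable lebesgue ?o" "(LINT x|lebesgue. (cmod (?o x))\<^sup>2) \<le> (sqrt R)\<^sup>2"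
  proof -
    have eq: "(cmod (?o x))\<^sup>2 = indicator ?S x" for x by (simp add: indicator_def)
    have m: "integrable lebesgue (indicator ?S :: real \<Rightarrow> real)" using r by (simp add: integrable_indicator_iff)
    then show "square_integrable lebesgue ?o"
      unfolding square_integrable_def eq
      by (intro conjI measurable_compose[OF _ borel_measurable_of_real] borel_measurable_integrable)
    show "(LINT x|lebesgue. (cmod (?o x))\<^sup>2) \<le> (sqrt R)\<^sup>2" unfolding eq using r R by simp
  qed
  have a: "square_integrable lebesgue ?a" "(LINT x|lebesgue. (cmod (?a x))\<^sup>2) \<le> (A_norm e R)\<^sup>2"
  proof -
    have eq: "(cmod (?a x))\<^sup>2 = indicator ?S x *\<^sub>R (norm (A e x))\<^sup>2" for x by (simp add: indicator_def)
    note m = L2_loc_seg[OF A_loc e, of R]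
    then show "square_integrable lebesgue ?a"
      unfolding square_integrable_def eq set_borel_measurable_def set_integrable_def
      by (intro conjI measurable_compose[OF _ borel_measurable_of_real])
    have "0 \<le> (LINT x:?S|lebesgue. (A e x)\<^sup>2)"
      unfolding set_lebesgue_integral_def by (simp add: Bochner_Integration.integral_nonneg)
    then show "(LINT x|lebesgue. (cmod (?a x))\<^sup>2) \<le> (A_norm e R)\<^sup>2"
      unfolding eq A_norm_def by (simp add: set_lebesgue_integral_def)
  qed
  note f = slice_square_integrable[OF e F, of R] and k = slice_square_integrable[OF e K, of R]
  have heq: "indicator ?S x *\<^sub>R h x = \<i> * (?f x + ?a x * ?k x)" for x by (simp add: h_def indicator_def)
  have mf: "?f \<in> borel_measurable lebesgue" "?a \<in> borel_measurable lebesgue" "?k \<in> borel_measurable lebesgue"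
    using f(1) a(1) k(1) by (auto simp: square_integrable_def)
  have m: "(\<lambda>x. indicator ?S x *\<^sub>R h x) \<in> borel_measurable lebesgue"
    unfolding heq using mf by (intro borel_measurable_times borel_measurable_add borel_measurable_const)
  note b1 = Holder_2(1)[OF o(1) f(1)] and b2 = Holder_2(1)[OF a(1) k(1)]
  have bi: "integrable lebesgue (\<lambda>x. cmod (?o x) * cmod (?f x) + cmod (?a x) * cmod (?k x))"
    using b1 b2 by (rule Bochner_Integration.integrable_add)
  have le: "cmod (indicator ?S x *\<^sub>R h x) \<le> cmod (?o x) * cmod (?f x) + cmod (?a x) * cmod (?k x)" for x
  proof -
    have "cmod (indicator ?S x *\<^sub>R h x) = cmod (?f x + ?a x * ?k x)" unfolding heq by (simp add: norm_mult)
    also have "\<dots> \<le> cmod (?f x) + cmod (?a x * ?k x)" by (rule norm_triangle_ineq)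
    also have "cmod (?f x) = cmod (?o x) * cmod (?f x)" by (simp add: indicator_def)
    finally show ?thesis by (simp only: norm_mult)
  qed
  show hi: "set_integrable lebesgue ?S h"
    unfolding set_integrable_def
    by (rule Bochner_Integration.integrable_bound[OF bi m], rule AE_I2, rule order_trans[OF le]) simp
  have "(LINT x:?S|lebesgue. cmod (h x)) = (LINT x|lebesgue. cmod (indicator ?S x *\<^sub>R h x))"
    by (simp add: set_lebesgue_integral_def)
  also have "\<dots> \<le> (LINT x|lebesgue. cmod (?o x) * cmod (?f x) + cmod (?a x) * cmod (?k x))"
    by (rule integral_mono[OF _ bi le]) (use hi in \<open>simp only: set_integrable_def integrable_norm\<close>)
  also have "\<dots> = (LINT x|lebesgue. cmod (?o x) * cmod (?f x)) + (LINT x|lebesgue. cmod (?a x) * cmod (?k x))"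
    by (rule Bochner_Integration.integral_add[OF b1 b2])
  also have "\<dots> \<le> sqrt R * sqrt (sqnorm M F) + A_norm e R * sqrt (sqnorm M K)"
    using R A_norm_nonneg by (intro add_mono Holder_sqrt o a f k) auto
  finally show "(LINT x:?S|lebesgue. cmod (h x)) \<le> sqrt R * sqrt (sqnorm M F) + A_norm e R * sqrt (sqnorm M K)" .
qed

lemma weak_deriv_eq: "weak_deriv G u e x = \<i> * (DA u (e, x) + of_real (A e x) * fn u (e, x))"
  by (simp add: DA_def mag_deriv_def algebra_simps)

text \<open>
  On a segment, \<open>|u x| \<le> |u y| + \<integral> |u'|\<close>, and the integral is controlled by \<open>seg_bound\<close>. Squaring and
  averaging over \<open>y\<close> replaces \<open>|u y|\<close> by the \<open>L\<^sup>2\<close> norm of \<open>u\<close>, which is at most that of \<open>W u\<close> because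
  \<open>V \<ge> 1\<close>. Continuity extends the bound to the end points.
\<close>

lemma Sobolev:
  assumes e: "e \<in> E" and R: "0 < R"
  shows "\<exists>C\<ge>0. \<forall>u\<in>H1. \<forall>x\<in>I e. x < R \<longrightarrow>
           (cmod (u e x))\<^sup>2 \<le> C * (sqnorm M (DA u) + sqnorm M (W u))"
proof -
  let ?S = "seg e R" and ?b = "A_norm e R"
  obtain r where r: "0 < r" "r \<le> R" "?S = {0<..<r}" "{0..r} \<subseteq> I e" "\<And>x. x \<in> I e \<Longrightarrow> x < R \<Longrightarrow> x \<in> {0..r}"
    using seg_eq[OF e R] by metis
  \<comment> \<open>Let \<open>g\<close> be the \<open>L\<^sup>1\<close> norm of \<open>u'\<close> on the segment. Then \<open>|u x|\<^sup>2\<close> is at most \<open>(2 / r) |u|\<^sup>2 + 2 g\<^sup>2\<close>,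
    and \<open>g\<^sup>2 \<le> 2 R |D\<^sub>A u|\<^sup>2 + 2 |A|\<^sup>2 |u|\<^sup>2\<close>, with \<open>L\<^sup>2\<close> norms on the right.\<close>
  define C where "C = 2 / r + 4 * R + 4 * ?b\<^sup>2"
  have "0 \<le> C" using r R by (simp add: C_def)
  moreover have "(cmod (u e x))\<^sup>2 \<le> C * (sqnorm M (DA u) + sqnorm M (W u))"
    if u: "u \<in> H1" and x: "x \<in> I e" "x < R" for u x
  proof -
    define d w n where "d = sqnorm M (DA u)" and "w = sqnorm M (W u)"
      and "n = sqnorm M (fn u)"
    have nn: "0 \<le> d" "0 \<le> w" "0 \<le> n" unfolding d_def w_def n_def by (simp_all add: Bochner_Integration.integral_nonneg)
    have nw: "n \<le> w" unfolding n_def w_def by (rule H1_D(8)[OF u])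
    define g where "g = weak_deriv G u e"
    define Gm where "Gm = (LINT x:?S|lebesgue. cmod (g x))"
    have g_eq: "g = (\<lambda>x. \<i> * (DA u (e, x) + of_real (A e x) * fn u (e, x)))"
      by (rule ext) (simp only: g_def weak_deriv_eq)
    have gi: "set_integrable lebesgue ?S g"
      unfolding g_eq by (rule seg_bound(1)[OF e R H1_D(4)[OF u] H1_D(6)[OF u]])
    have Gm_le: "Gm \<le> sqrt R * sqrt d + ?b * sqrt n"
      unfolding Gm_def g_eq d_def n_def by (rule seg_bound(2)[OF e R H1_D(4)[OF u] H1_D(6)[OF u]])
    have Gm_nn: "0 \<le> Gm"
      unfolding Gm_def set_lebesgue_integral_def by (simp add: Bochner_Integration.integral_nonneg)
    have Gm2: "Gm\<^sup>2 \<le> 2 * R * d + 2 * ?b\<^sup>2 * n"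
    proof -
      have "Gm\<^sup>2 \<le> (sqrt R * sqrt d + ?b * sqrt n)\<^sup>2" using Gm_le Gm_nn by (rule power_mono)
      also have "\<dots> \<le> 2 * (sqrt R * sqrt d)\<^sup>2 + 2 * (?b * sqrt n)\<^sup>2" by (rule square_sum_le)
      finally show ?thesis using nn R by (simp add: power_mult_distrib)
    qed
    have less: "cmod (u e y - u e x) \<le> Gm" if "x \<in> ?S" "y \<in> ?S" "x < y" for x y
    proof -
      have xy: "0 < x" "y < r" using that(1,2) unfolding r(3) by simp_all
      have "{x..y} \<subseteq> ?S" unfolding r(3) using xy by auto
      then have sub: "{x..y} \<subseteq> J e" using seg_J by blast
      have sub': "{x<..<y} \<subseteq> ?S" unfolding r(3) using xy by auto
      have cont: "continuous_on (J e) (u e)" using H1_D(1)[OF u e] J_sub continuous_on_subset by blast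
      have i: "set_integrable lebesgue {x<..<y} g" by (rule set_integrable_subset[OF gi _ sub']) simp
      have "u e y - u e x = (LINT t:{x<..<y}|lebesgue. g t)"
        unfolding g_def by (rule weak_deriv_imp_integral[OF H1_D(3)[OF u e] cont sub \<open>x < y\<close>])
      then have "cmod (u e y - u e x) \<le> (LINT t:{x<..<y}|lebesgue. cmod (g t))"
        using set_integral_norm_bound[OF i] by simp
      also have "\<dots> \<le> Gm"
        unfolding Gm_def set_lebesgue_integral_def
        by (rule integral_mono)
           (use set_integrable_norm[OF i] set_integrable_norm[OF gi] sub' in \<open>auto simp: set_integrable_def indicator_def\<close>)
      finally show ?thesis .
    qed
    have dist: "cmod (u e x) \<le> cmod (u e y) + Gm" if "x \<in> ?S" "y \<in> ?S" for x y
    proof -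
      have "cmod (u e x - u e y) \<le> Gm"
        using less[of x y] less[of y x] that Gm_nn by (cases x y rule: linorder_cases) (auto simp: norm_minus_commute)
      then show ?thesis using norm_triangle_sub[of "u e x" "u e y"] by linarith
    qed
    have on_seg: "(cmod (u e x))\<^sup>2 \<le> C * (d + w)" if x: "x \<in> ?S" for x
    proof -
      have pt: "(cmod (u e x))\<^sup>2 \<le> 2 * (cmod (u e y))\<^sup>2 + 2 * Gm\<^sup>2" if y: "y \<in> ?S" for y
        using order_trans[OF power_mono[OF dist[OF x y] norm_ge_zero] square_sum_le] .
      have iu: "set_integrable lebesgue ?S (\<lambda>y. (cmod (u e y))\<^sup>2)" "(LINT y:?S|lebesgue. (cmod (u e y))\<^sup>2) \<le> n"
        using slice_integral_le[OF e _ _ seg_sets[of e R], of "\<lambda>z. (cmod (fn u z))\<^sup>2"] H1_D(6)[OF u] seg_J[of e R] J_sub[of e]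
        by (auto simp: square_integrable_def n_def)
      have ic: "set_integrable lebesgue ?S (\<lambda>y. c)" for c :: real
        using r by (simp add: set_integrable_def)
      have cst: "(LINT y:?S|lebesgue. c) = r * c" for c :: real
        using r by (simp add: set_lebesgue_integral_def)
      have "r * (cmod (u e x))\<^sup>2 = (LINT y:?S|lebesgue. (cmod (u e x))\<^sup>2)" by (simp add: cst)
      also have "\<dots> \<le> (LINT y:?S|lebesgue. 2 * (cmod (u e y))\<^sup>2 + 2 * Gm\<^sup>2)"
        by (rule set_integral_mono) (intro ic set_integral_add(1) set_integrable_mult_right iu pt)+
      also have "\<dots> = 2 * (LINT y:?S|lebesgue. (cmod (u e y))\<^sup>2) + r * (2 * Gm\<^sup>2)"
        by (subst set_integral_add(2)) (intro ic set_integrable_mult_right iu | simp add: cst)+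
      also have "\<dots> \<le> 2 * n + r * (2 * Gm\<^sup>2)" using iu(2) by simp
      finally have "(cmod (u e x))\<^sup>2 \<le> (2 / r) * n + 2 * Gm\<^sup>2" using r(1) by (simp add: field_simps)
      also have "\<dots> \<le> (2 / r) * w + (4 * R * d + 4 * ?b\<^sup>2 * w)"
      proof (rule add_mono)
        show "(2 / r) * n \<le> (2 / r) * w" using nw r by (intro mult_left_mono) auto
        have "4 * ?b\<^sup>2 * n \<le> 4 * ?b\<^sup>2 * w" using nw by (intro mult_left_mono) auto
        then show "2 * Gm\<^sup>2 \<le> 4 * R * d + 4 * ?b\<^sup>2 * w" using Gm2 by linarith
      qed
      also have "\<dots> \<le> C * (d + w)"
      proof -
        have split: "k * w + (a * d + b * w) \<le> (k + a + b) * (d + w)" if "0 \<le> k" "0 \<le> a" "0 \<le> b" for k a b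
        proof -
          have "0 \<le> k * d" "0 \<le> b * d" "0 \<le> a * w" using nn that by simp_all
          then show ?thesis by (simp add: algebra_simps)
        qed
        show ?thesis unfolding C_def by (rule split) (use r R in auto)
      qed
      finally show ?thesis .
    qed
    have "cmod (u e x) \<le> sqrt (C * (d + w))"
    proof (rule continuous_on_closure_norm_le[of ?S "u e"])
      have cl: "closure ?S = {0..r}" using r by simp
      show "continuous_on (closure ?S) (u e)" unfolding cl using H1_D(1)[OF u e] r(4) continuous_on_subset by blast
      show "x \<in> closure ?S" unfolding cl using r(5)[OF x] .
      show "\<forall>y\<in>?S. cmod (u e y) \<le> sqrt (C * (d + w))" using on_seg real_le_rsqrt by blast
    qed
    then have "(cmod (u e x))\<^sup>2 \<le> (sqrt (C * (d + w)))\<^sup>2" by (rule power_mono) simp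
    then show ?thesis using \<open>0 \<le> C\<close> nn by (simp add: d_def w_def)
  qed
  ultimately show ?thesis by blast
qed


lemma interval_sub_seg:
  assumes "compact K" "K \<subseteq> J e" obtains R where "0 < R" "K \<subseteq> seg e R"
proof -
  obtain B where "\<And>x. x \<in> K \<Longrightarrow> norm x \<le> B" using compact_imp_bounded[OF assms(1)] by (auto simp: bounded_iff)
  then have "K \<subseteq> seg e (max B 0 + 1)" using assms(2) by (fastforce simp: J_eq seg_def)
  then show ?thesis using that[of "max B 0 + 1"] by simp
qed

lemma L2_locally_integrable:
  assumes e: "e \<in> E" and F: "square_integrable M F" and K: "square_integrable M K"
  shows "locally_integrable (J e) (\<lambda>x. \<i> * (F (e, x) + of_real (A e x) * K (e, x)))"
  unfolding locally_integrable_def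
proof (intro allI impI)
  fix S assume S: "compact S \<and> S \<subseteq> J e"
  then obtain R where "0 < R" "S \<subseteq> seg e R" using interval_sub_seg by blast
  moreover have "S \<in> sets lebesgue" using S by (simp add: compact_imp_closed)
  ultimately show "set_integrable lebesgue S (\<lambda>x. \<i> * (F (e, x) + of_real (A e x) * K (e, x)))"
    using seg_bound(1)[OF e _ F K, of R] set_integrable_subset by blast
qed

lemma L2_limit_imp_L1_limit:
  assumes e: "e \<in> E" and S: "compact S" "S \<subseteq> J e"
    and F: "\<And>n. square_integrable M (F n)" and K: "\<And>n. square_integrable M (K n)"
    and limF: "(\<lambda>n. sqnorm M (F n)) \<longlonglongrightarrow> 0"
    and limK: "(\<lambda>n. sqnorm M (K n)) \<longlonglongrightarrow> 0"
  shows "(\<lambda>n. LINT x:S|lebesgue. cmod (\<i> * (F n (e, x) + of_real (A e x) * K n (e, x)))) \<longlonglongrightarrow> 0"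
proof -
  obtain R where R: "0 < R" "S \<subseteq> seg e R" using interval_sub_seg[OF S] .
  have Ss: "S \<in> sets lebesgue" using S by (simp add: compact_imp_closed)
  let ?h = "\<lambda>n x. \<i> * (F n (e, x) + of_real (A e x) * K n (e, x))"
  let ?B = "\<lambda>n. sqrt R * sqrt (sqnorm M (F n)) + A_norm e R * sqrt (sqnorm M (K n))"
  have le: "(LINT x:S|lebesgue. cmod (?h n x)) \<le> ?B n" for n
  proof -
    have i: "set_integrable lebesgue (seg e R) (?h n)" by (rule seg_bound(1)[OF e R(1) F K])
    have i': "set_integrable lebesgue S (?h n)" by (rule set_integrable_subset[OF i Ss R(2)])
    have "(LINT x:S|lebesgue. cmod (?h n x)) \<le> (LINT x:seg e R|lebesgue. cmod (?h n x))"
      unfolding set_lebesgue_integral_def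
    proof (rule integral_mono)
      show "integrable lebesgue (\<lambda>x. indicator S x *\<^sub>R cmod (?h n x))"
        "integrable lebesgue (\<lambda>x. indicator (seg e R) x *\<^sub>R cmod (?h n x))"
        using set_integrable_norm[OF i] set_integrable_norm[OF i'] by (simp_all add: set_integrable_def)
      show "indicator S x *\<^sub>R cmod (?h n x) \<le> indicator (seg e R) x *\<^sub>R cmod (?h n x)" for x
        using R(2) by (auto simp: indicator_def)
    qed
    also have "\<dots> \<le> ?B n" by (rule seg_bound(2)[OF e R(1) F K])
    finally show ?thesis .
  qed
  have nn: "0 \<le> (LINT x:S|lebesgue. cmod (?h n x))" for n
    unfolding set_lebesgue_integral_def by (simp add: Bochner_Integration.integral_nonneg)
  have "?B \<longlonglongrightarrow> sqrt R * sqrt 0 + A_norm e R * sqrt 0"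
    by (intro tendsto_add tendsto_mult_left tendsto_real_sqrt limF limK)
  then have "?B \<longlonglongrightarrow> 0" by simp
  then show ?thesis
    by (rule tendsto_sandwich[OF always_eventually always_eventually tendsto_const, rotated 2])
       (use le nn in auto)
qed

text \<open>
  \<open>Sobolev\<close>, applied to differences, yields a locally uniform limit \<open>U\<close>, which is therefore continuous along
  edges and consistent at vertices. Fatou's lemma identifies the limit of \<open>W (u n)\<close> as \<open>W U\<close>. The limit \<open>F\<close>
  of the magnetic derivatives provides the weak derivative \<open>\<i> (F + A U)\<close> of \<open>U\<close>.
\<close>

lemma H1_complete:
  assumes u: "\<And>n. u n \<in> H1"
    and CD: "L2_Cauchy M (\<lambda>n. DA (u n))" and CW: "L2_Cauchy M (\<lambda>n. W (u n))"
  shows "\<exists>U\<in>H1. (\<lambda>n. sqdist M (DA (u n)) (DA U)) \<longlonglongrightarrow> 0 \<and>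
                (\<lambda>n. sqdist M (W (u n)) (W U)) \<longlonglongrightarrow> 0"
proof -
  let ?w = "\<lambda>m n e x. 1 * u m e x + (-1) * u n e x"
  have w: "?w m n \<in> H1" for m n by (rule H1_lincomb(1)[OF u u])
  have Dw: "sqnorm M (DA (?w m n)) = sqdist M (DA (u m)) (DA (u n))" for m n
  proof (rule integral_cong_AE)
    show "AE z in M. (cmod (DA (?w m n) z))\<^sup>2 = (cmod (DA (u m) z - DA (u n) z))\<^sup>2"
      using H1_lincomb(2)[OF u u, of 1 m "-1" n] by eventually_elim simp
    show "(\<lambda>z. (cmod (DA (?w m n) z))\<^sup>2) \<in> borel_measurable M"
      using H1_D(4)[OF w] by (auto simp: square_integrable_def intro: borel_measurable_integrable)
    show "(\<lambda>z. (cmod (DA (u m) z - DA (u n) z))\<^sup>2) \<in> borel_measurable M"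
      using square_integrable_diff[OF H1_D(4)[OF u] H1_D(4)[OF u]]
      by (auto simp: square_integrable_def intro: borel_measurable_integrable)
  qed
  have Ww: "W (?w m n) = (\<lambda>z. W (u m) z - W (u n) z)" for m n
    by (auto simp: W_def algebra_simps)
  have unif: "uniformly_convergent_on (I e \<inter> {..<R}) (\<lambda>n. u n e)" if e: "e \<in> E" and R: "0 < R" for e R
  proof (rule Cauchy_uniformly_convergent)
    obtain C where C: "0 \<le> C" "\<And>u x. u \<in> H1 \<Longrightarrow> x \<in> I e \<Longrightarrow> x < R \<Longrightarrow>
        (cmod (u e x))\<^sup>2 \<le> C * (sqnorm M (DA u) + sqnorm M (W u))"
      using Sobolev[OF e R] by blast
    have bd: "(cmod (u m e x - u n e x))\<^sup>2 \<le> C * (sqdist M (DA (u m)) (DA (u n)) + sqdist M (W (u m)) (W (u n)))"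
      if "x \<in> I e" "x < R" for x m n
      using C(2)[OF w[of m n] that] unfolding Dw Ww by simp
    show "uniformly_Cauchy_on (I e \<inter> {..<R}) (\<lambda>n. u n e)"
    proof (rule uniformly_Cauchy_onI)
      fix \<epsilon> :: real assume \<epsilon>: "0 < \<epsilon>"
      define c where "c = \<epsilon>\<^sup>2 / 4"
      define \<eta> where "\<eta> = c / (C + 1)"
      have \<eta>: "0 < \<eta>" using \<epsilon> C(1) by (simp add: \<eta>_def c_def)
      obtain N where N: "\<And>m n. N \<le> m \<Longrightarrow> N \<le> n \<Longrightarrow> sqdist M (DA (u m)) (DA (u n)) < \<eta>"
        using CD \<eta> unfolding L2_Cauchy_def by meson
      obtain N' where N': "\<And>m n. N' \<le> m \<Longrightarrow> N' \<le> n \<Longrightarrow> sqdist M (W (u m)) (W (u n)) < \<eta>"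
        using CW \<eta> unfolding L2_Cauchy_def by meson
      have "dist (u m e x) (u n e x) < \<epsilon>" if x: "x \<in> I e \<inter> {..<R}" and mn: "max N N' \<le> m" "max N N' \<le> n" for x m n
      proof -
        have "(cmod (u m e x - u n e x))\<^sup>2 \<le> C * (\<eta> + \<eta>)"
          using bd[of x m n] x mult_left_mono[OF add_mono[OF less_imp_le[OF N[of m n]] less_imp_le[OF N'[of m n]]] C(1)] mn
          by auto
        also have "\<dots> < \<epsilon>\<^sup>2"
        proof -
          have "C * (\<eta> + \<eta>) \<le> (C + 1) * (\<eta> + \<eta>)" using \<eta> by (intro mult_right_mono) auto
          also have "\<dots> = 2 * ((C + 1) * \<eta>)" by simp
          also have "(C + 1) * \<eta> = c" using C(1) by (simp add: \<eta>_def)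
          also have "2 * c = \<epsilon>\<^sup>2 / 2" by (simp add: c_def)
          also have "\<dots> < \<epsilon>\<^sup>2" using \<epsilon> by simp
          finally show ?thesis .
        qed
        finally show ?thesis using \<epsilon> by (simp add: dist_norm power2_less_imp_less)
      qed
      then show "\<exists>M. \<forall>x\<in>I e \<inter> {..<R}. \<forall>m\<ge>M. \<forall>n\<ge>M. dist (u m e x) (u n e x) < \<epsilon>" by blast
    qed
  qed
  define U where "U e x = lim (\<lambda>n. u n e x)" for e x
  have unif: "uniform_limit (I e \<inter> {..<R}) (\<lambda>n. u n e) (U e) sequentially" if "e \<in> E" "0 < R" for e R
    using unif[OF that] unfolding uniformly_convergent_uniform_limit_iff U_def[abs_def] .
  have ptw: "(\<lambda>n. u n e x) \<longlonglongrightarrow> U e x" if "e \<in> E" "x \<in> I e" for e x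
    by (rule tendsto_uniform_limitI[OF unif[of e "\<bar>x\<bar> + 1"]]) (use that in auto)
  have cont: "continuous_on (I e) (U e)" if e: "e \<in> E" for e
    unfolding continuous_on_eq_continuous_within
  proof
    fix x assume x: "x \<in> I e"
    let ?X = "I e \<inter> {..<\<bar>x\<bar> + 1}"
    have "continuous_on ?X (U e)"
    proof (rule uniform_limit_theorem[OF _ unif[OF e]])
      show "\<forall>\<^sub>F n in sequentially. continuous_on ?X (u n e)"
        using H1_D(1)[OF u e] continuous_on_subset by (intro always_eventually allI) blast
    qed auto
    \<comment> \<open>Near \<open>x\<close> the edge coincides with its bounded piece \<open>?X\<close>.\<close>
    then have "continuous (at x within ?X) (U e)" using x by (auto simp: continuous_on_eq_continuous_within)
    moreover have "at x within ?X = at x within I e"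
      by (rule at_within_nhd[of x "{..<\<bar>x\<bar> + 1}"]) auto
    ultimately show "continuous (at x within I e) (U e)" by simp
  qed
  have "\<forall>n. \<exists>g. \<forall>e\<in>E. \<forall>x\<in>I e. u n e x = g (ep e x)" using H1_D(2)[OF u] by blast
  then obtain g where g: "\<And>n e x. e \<in> E \<Longrightarrow> x \<in> I e \<Longrightarrow> u n e x = g n (ep e x)" by metis
  have Ug: "U e x = lim (\<lambda>n. g n (ep e x))" if "e \<in> E" "x \<in> I e" for e x
    using g[OF that] by (simp add: U_def)
  have fnU: "fn U \<in> borel_measurable M" using cont by (rule continuous_M)
  have WU: "W U \<in> borel_measurable M" by (rule W_measurable[OF fnU])
  have limfn: "(\<lambda>n. fn (u n) z) \<longlonglongrightarrow> fn U z" if "z \<in> space M" for z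
    using that ptw by (auto simp: space_M \<Omega>_def)
  have limW: "(\<lambda>n. W (u n) z) \<longlonglongrightarrow> W U z" if "z \<in> space M" for z
    unfolding W_def by (rule tendsto_mult_left[OF limfn[OF that]])
  have id: "strict_mono (\<lambda>n::nat. n)" by (simp add: strict_mono_def)
  have W: "square_integrable M (W U)" "(\<lambda>n. sqdist M (W (u n)) (W U)) \<longlonglongrightarrow> 0"
    using L2_Cauchy_pointwise_limit[OF CW id WU] limW by auto
  have fnsq: "square_integrable M (fn U)" by (rule fn_square_integrable(1)[OF fnU W(1)])
  have fnlim: "(\<lambda>n. sqdist M (fn (u n)) (fn U)) \<longlonglongrightarrow> 0"
  proof -
    have le: "sqdist M (fn (u n)) (fn U) \<le> sqdist M (W (u n)) (W U)" for n
    proof -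
      have eq: "W (\<lambda>e x. u n e x - U e x) = (\<lambda>z. W (u n) z - W U z)" by (auto simp: W_def algebra_simps)
      have "fn (\<lambda>e x. u n e x - U e x) \<in> borel_measurable M"
        using H1_D(7)[OF u] fnU by (intro borel_measurable_diff)
      moreover have "square_integrable M (W (\<lambda>e x. u n e x - U e x))"
        unfolding eq by (rule square_integrable_diff[OF H1_D(5)[OF u] W(1)])
      ultimately show ?thesis using fn_square_integrable(2)[of "\<lambda>e x. u n e x - U e x"] unfolding eq by simp
    qed
    show ?thesis
      by (rule tendsto_sandwich[OF always_eventually always_eventually tendsto_const W(2)])
         (use le in \<open>auto simp: Bochner_Integration.integral_nonneg\<close>)
  qed
  obtain F where F: "square_integrable M F" "(\<lambda>n. sqdist M (DA (u n)) F) \<longlonglongrightarrow> 0"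
    using Riesz_Fischer[OF CD] by blast
  define G' where "G' e x = \<i> * (F (e, x) + of_real (A e x) * fn U (e, x))" for e x
  have wd: "has_weak_deriv (J e) (U e) (G' e)" if e: "e \<in> E" for e
  proof (rule has_weak_deriv_limit)
    show "has_weak_deriv (J e) (u n e) (weak_deriv G (u n) e)" for n by (rule H1_D(3)[OF u e])
    show "locally_integrable (J e) (U e)"
      using cont[OF e] J_sub continuous_on_subset by (blast intro: continuous_imp_locally_integrable)
    show "locally_integrable (J e) (G' e)"
      unfolding G'_def by (rule L2_locally_integrable[OF e F(1) fnsq])
    fix S assume S: "compact S" "S \<subseteq> J e"
    have sq0: "square_integrable M (\<lambda>_. 0)" by (simp add: square_integrable_def)
    have "(\<lambda>n. LINT x:S|lebesgue. cmod (\<i> * ((fn (u n) (e, x) - fn U (e, x)) + of_real (A e x) * 0))) \<longlonglongrightarrow> 0"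
      by (rule L2_limit_imp_L1_limit[OF e S, where F = "\<lambda>n z. fn (u n) z - fn U z" and K = "\<lambda>_ _. 0"])
         (use fnlim sq0 square_integrable_diff[OF H1_D(6)[OF u] fnsq] in auto)
    then show "(\<lambda>n. LINT x:S|lebesgue. cmod (u n e x - U e x)) \<longlonglongrightarrow> 0" by (simp add: norm_mult)
    have "(\<lambda>n. LINT x:S|lebesgue. cmod (\<i> * ((DA (u n) (e, x) - F (e, x)) + of_real (A e x) * (fn (u n) (e, x) - fn U (e, x))))) \<longlonglongrightarrow> 0"
      by (rule L2_limit_imp_L1_limit[OF e S, where F = "\<lambda>n z. DA (u n) z - F z" and K = "\<lambda>n z. fn (u n) z - fn U z"])
         (use F(2) fnlim square_integrable_diff[OF H1_D(4)[OF u] F(1)] square_integrable_diff[OF H1_D(6)[OF u] fnsq] in auto)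
    moreover have "weak_deriv G (u n) e x - G' e x
        = \<i> * ((DA (u n) (e, x) - F (e, x)) + of_real (A e x) * (fn (u n) (e, x) - fn U (e, x)))" for n x
      unfolding weak_deriv_eq G'_def by (simp add: algebra_simps)
    ultimately show "(\<lambda>n. LINT x:S|lebesgue. cmod (weak_deriv G (u n) e x - G' e x)) \<longlonglongrightarrow> 0" by simp
  qed
  have D: "AE z in M. (1 / \<i>) * G' (fst z) (snd z) - of_real (A (fst z) (snd z)) * fn U z = F z"
    by (rule AE_I2) (simp add: G'_def)
  have UH: "U \<in> H1" "AE z in M. DA U z = F z"
    by (rule H1_I[OF cont Ug wd F(1) D W(1)]; assumption)+
  have "sqdist M (DA (u n)) (DA U) = sqdist M (DA (u n)) F" for n
  proof (rule integral_cong_AE)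
    show "AE z in M. (cmod (DA (u n) z - DA U z))\<^sup>2 = (cmod (DA (u n) z - F z))\<^sup>2"
      using UH(2) by eventually_elim simp
  qed (use square_integrable_diff[OF H1_D(4)[OF u] F(1)] square_integrable_diff[OF H1_D(4)[OF u] H1_D(4)[OF UH(1)]]
        in \<open>auto simp: square_integrable_def intro: borel_measurable_integrable\<close>)
  then have "(\<lambda>n. sqdist M (DA (u n)) (DA U)) \<longlonglongrightarrow> 0" using F(2) by simp
  then show ?thesis using UH(1) W(2) by blast
qed

end

section \<open>Test functions in the form domain, and the self-adjoint operator\<close>

context magnetic
begin

lemma zero_in_H1: "(\<lambda>e x. 0) \<in> H1"
proof (rule H1_I(1)[where u' = "\<lambda>_ _. 0" and F = "\<lambda>_. 0" and g = "\<lambda>_. 0"])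
  show "has_weak_deriv (J e) (\<lambda>x. 0) (\<lambda>x. 0)" for e
    by (simp add: has_weak_deriv_def locally_integrable_def set_integrable_def)
qed (simp_all add: square_integrable_def W_def[abs_def])

lemma norm_mono_of_nonneg: "0 \<le> (a::real) \<Longrightarrow> a \<le> b \<Longrightarrow> norm a \<le> norm b"
  by simp

lemma single_edge_integrable:
  fixes h :: "real \<Rightarrow> real"
  assumes e: "e \<in> E" and h: "set_integrable lebesgue (seg e R) h"
  shows "integrable M (\<lambda>z. if fst z = e then indicator (seg e R) (snd z) *\<^sub>R h (snd z) else 0)" (is "integrable M ?f")
  unfolding integrable_M_iff
proof
  show "\<forall>e'\<in>E. set_integrable lebesgue (I e') (\<lambda>x. ?f (e', x))"
  proof
    fix e' assume "e' \<in> E"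
    have "indicator (I e) x *\<^sub>R (indicator (seg e R) x *\<^sub>R h x) = indicator (seg e R) x *\<^sub>R h x" for x
      using seg_J[of e R] J_sub[of e] by (auto simp: indicator_def)
    then show "set_integrable lebesgue (I e') (\<lambda>x. ?f (e', x))"
      using h by (cases "e' = e") (simp_all only: set_integrable_def fst_conv snd_conv if_True if_False
          scaleR_zero_right Bochner_Integration.integrable_zero simp_thms)
  qed
  have "(\<lambda>e'. LINT x:I e'|lebesgue. norm (?f (e', x))) summable_on {e}"
    by simp
  then show "(\<lambda>e'. LINT x:I e'|lebesgue. norm (?f (e', x))) summable_on E"
    by (rule summable_on_cong_neutral[THEN iffD1, rotated -1]) (use e in \<open>auto simp: set_lebesgue_integral_def\<close>)
qed

text \<open>
  The magnetic derivative is bounded by \<open>B + |A|\<close> and the potential term by \<open>V\<close>, on a bounded segment of a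
  single edge, and \<open>A\<^sup>2\<close> and \<open>V\<close> are integrable there.
\<close>

lemma bump_in_H1:
  assumes e: "e \<in> E" and sub: "{a..b} \<subseteq> J e"
  shows "(\<lambda>e' x. if e' = e then of_real (bump n a b x) else 0) \<in> H1" (is "?u \<in> _")
proof -
  obtain R where R: "0 < R" "{a..b} \<subseteq> seg e R" using interval_sub_seg[OF compact_Icc sub] .
  have out: "bump n a b x = 0" "bump' n a b x = 0" if "x \<notin> seg e R" for x
  proof -
    have "x \<notin> {a<..<b}" using that R(2) greaterThanLessThan_subseteq_atLeastAtMost_iff[of a b a b] by auto
    then show "bump n a b x = 0" "bump' n a b x = 0" by (rule bump_outside, rule bump'_outside)
  qed
  define u' where "u' e' x = (if e' = e then complex_of_real (bump' n a b x) else 0)" for e' x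
  define F where "F z = (1 / \<i>) * u' (fst z) (snd z) - of_real (A (fst z) (snd z)) * fn ?u z" for z
  define g where "g p = (case p of Inner e' x \<Rightarrow> ?u e' x | Vertex v \<Rightarrow> 0)" for p :: "('v, 'e) point"
  have cont: "continuous_on (I e') (?u e')" for e'
    by (cases "e' = e") (auto intro!: continuous_intros bump_continuous)
  have gg: "?u e' x = g (ep e' x)" if "e' \<in> E" "x \<in> I e'" for e' x
    using out[of x] by (auto simp: g_def edge_point_def seg_def)
  have wd: "has_weak_deriv (J e') (?u e') (u' e')" for e'
    using bump_has_weak_deriv[OF sub, of n]
    by (cases "e' = e") (auto simp: u'_def[abs_def] has_weak_deriv_def locally_integrable_def set_integrable_def)
  have "bounded (bump' n a b ` {a..b})"
    by (intro compact_imp_bounded compact_continuous_image bump'_continuous compact_Icc)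
  then obtain B where B: "\<And>x. x \<in> {a..b} \<Longrightarrow> \<bar>bump' n a b x\<bar> \<le> B" unfolding bounded_iff by (metis imageI real_norm_def)
  have B': "(bump' n a b x)\<^sup>2 \<le> B\<^sup>2" for x
  proof (cases "x \<in> {a<..<b}")
    case True then show ?thesis using power_mono[OF B[of x] abs_ge_zero, of 2] by simp
  qed (simp add: bump'_outside)
  have bm: "bump n a b \<in> borel_measurable lebesgue" by (rule measurable_completion) simp
  have i1: "set_integrable lebesgue (seg e R) (\<lambda>x. c)" for c :: real
  proof -
    obtain r where "0 < r" "seg e R = {0<..<r}" using seg_eq[OF e R(1)] by metis
    then show ?thesis by (simp add: set_integrable_def)
  qed
  have dom: "set_integrable lebesgue (seg e R) (\<lambda>x. 2 * B\<^sup>2 + 2 * (norm (A e x))\<^sup>2)"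
    by (intro set_integral_add(1) set_integrable_mult_right i1 L2_loc_seg(2)[OF A_loc e])
  have F_meas: "F \<in> borel_measurable M"
    unfolding F_def[abs_def]
  proof (intro borel_measurable_diff borel_measurable_times borel_measurable_const measurable_compose[OF A_M borel_measurable_of_real])
    show "(\<lambda>z. u' (fst z) (snd z)) \<in> borel_measurable M"
      using wd by (intro loc_int_M) (simp add: has_weak_deriv_def)
    show "fn ?u \<in> borel_measurable M" using cont by (rule continuous_M)
  qed
  have F: "square_integrable M F"
    unfolding square_integrable_def
  proof (intro conjI F_meas)
    have "integrable M (\<lambda>z. if fst z = e then indicator (seg e R) (snd z) *\<^sub>R (2 * B\<^sup>2 + 2 * (norm (A e (snd z)))\<^sup>2) else 0)"
      by (rule single_edge_integrable[OF e dom])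
    then show "integrable M (\<lambda>z. (cmod (F z))\<^sup>2)"
    proof (rule Bochner_Integration.integrable_bound)
      show "(\<lambda>z. (cmod (F z))\<^sup>2) \<in> borel_measurable M" using F_meas by measurable
      have "(cmod (F z))\<^sup>2 \<le> (if fst z = e then indicator (seg e R) (snd z) *\<^sub>R (2 * B\<^sup>2 + 2 * (norm (A e (snd z)))\<^sup>2) else 0)" for z
      proof (cases "fst z = e \<and> snd z \<in> seg e R")
        case True
        let ?x = "snd z"
        have "cmod (F z) \<le> \<bar>bump' n a b ?x\<bar> + \<bar>A e ?x\<bar> * bump n a b ?x"
          using norm_triangle_ineq4[of "(1 / \<i>) * u' (fst z) ?x" "of_real (A (fst z) ?x) * fn ?u z"] True bump_bounds[of n a b ?x]
          by (simp add: F_def u'_def norm_mult norm_divide)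
        also have "\<dots> \<le> \<bar>bump' n a b ?x\<bar> + \<bar>A e ?x\<bar> * 1"
          by (intro add_left_mono mult_left_mono bump_bounds) auto
        finally have "(cmod (F z))\<^sup>2 \<le> (\<bar>bump' n a b ?x\<bar> + \<bar>A e ?x\<bar>)\<^sup>2" by (intro power_mono) auto
        also have "\<dots> \<le> 2 * \<bar>bump' n a b ?x\<bar>\<^sup>2 + 2 * \<bar>A e ?x\<bar>\<^sup>2" by (rule square_sum_le)
        also have "\<dots> \<le> 2 * B\<^sup>2 + 2 * (norm (A e ?x))\<^sup>2" using B'[of ?x] by simp
        finally show ?thesis using True by simp
      next
        case False
        then have "F z = 0" using out[of "snd z"] by (auto simp: F_def u'_def)
        then show ?thesis using False by (auto simp: indicator_def)
      qed
      then show "AE z in M. norm ((cmod (F z))\<^sup>2) \<le> norm (if fst z = e then indicator (seg e R) (snd z) *\<^sub>R (2 * B\<^sup>2 + 2 * (norm (A e (snd z)))\<^sup>2) else 0)"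
        by (intro AE_I2) (rule norm_mono_of_nonneg[OF zero_le_power2])
    qed
  qed
  have W: "square_integrable M (W ?u)"
    unfolding square_integrable_def
  proof
    have fnu: "fn ?u \<in> borel_measurable M" using cont by (rule continuous_M)
    then show Wm: "W ?u \<in> borel_measurable M" by (rule W_measurable)
    have "integrable M (\<lambda>z. if fst z = e then indicator (seg e R) (snd z) *\<^sub>R V e (snd z) else 0)"
      by (rule single_edge_integrable[OF e L1_loc_seg[OF V_loc e]])
    then show "integrable M (\<lambda>z. (cmod (W ?u z))\<^sup>2)"
    proof (rule Bochner_Integration.integrable_bound)
      show "(\<lambda>z. (cmod (W ?u z))\<^sup>2) \<in> borel_measurable M" using Wm by measurable
      have "(cmod (W ?u z))\<^sup>2 \<le> (if fst z = e then indicator (seg e R) (snd z) *\<^sub>R V e (snd z) else 0)" if z: "z \<in> space M" for z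
      proof (cases "fst z = e \<and> snd z \<in> seg e R")
        case True
        have "(bump n a b (snd z))\<^sup>2 \<le> 1" using bump_bounds[of n a b "snd z"] by (simp add: power_le_one)
        then have "V e (snd z) * (bump n a b (snd z))\<^sup>2 \<le> V e (snd z) * 1"
          using V_ge_M[OF z] True by (intro mult_left_mono) auto
        then show ?thesis using True by (simp add: W_sq[OF z])
      next
        case False
        then show ?thesis using out[of "snd z"] by (auto simp: W_sq[OF z])
      qed
      then show "AE z in M. norm ((cmod (W ?u z))\<^sup>2) \<le> norm (if fst z = e then indicator (seg e R) (snd z) *\<^sub>R V e (snd z) else 0)"
        by (intro AE_I2) (rule norm_mono_of_nonneg[OF zero_le_power2])
    qed
  qed
  show ?thesis
    by (rule H1_I(1)[OF cont gg wd F _ W]) (auto simp: F_def)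
qed

lemma orthogonal_to_H1_imp_zero:
  assumes F: "square_integrable M F" and orth: "\<And>v. v \<in> H1 \<Longrightarrow> (LINT z|M. F z * cnj (fn v z)) = 0"
  shows "AE z in M. F z = 0"
proof -
  have "AE x in lebesgue. x \<in> I e \<longrightarrow> F (e, x) = 0" if e: "e \<in> E" for e
  proof -
    have "AE x in lebesgue. x \<in> J e \<longrightarrow> F (e, x) = 0"
    proof (rule bump_orthogonal_imp_AE_zero[OF _ open_interior])
      \<comment> \<open>The second term and the factor \<open>\<i>\<close> match the shape of \<open>L2_locally_integrable\<close>.\<close>
      have "locally_integrable (J e) (\<lambda>x. \<i> * (F (e, x) + of_real (A e x) * 0))"
        by (rule L2_locally_integrable[OF e F, of "\<lambda>_. 0"]) (simp add: square_integrable_def)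
      then show "locally_integrable (J e) (\<lambda>x. F (e, x))"
        using locally_integrable_lincomb[of "J e" "\<lambda>x. \<i> * F (e, x)" "\<lambda>x. \<i> * F (e, x)" "- \<i>" 0] by simp
      fix n a b assume sub: "{a..b} \<subseteq> J e"
      let ?v = "\<lambda>e' x. if e' = e then complex_of_real (bump n a b x) else 0"
      have v: "?v \<in> H1" by (rule bump_in_H1[OF e sub])
      have "0 = (LINT z|M. F z * cnj (fn ?v z))" using orth[OF v] by simp
      also have "\<dots> = (\<Sum>\<^sub>\<infinity>e'\<in>E. LINT x:I e'|lebesgue. F (e', x) * cnj (?v e' x))"
        using integral_M[OF square_integrable_prod[OF F H1_D(6)[OF v]]] by (simp only: fst_conv snd_conv)
      also have "\<dots> = (\<Sum>\<^sub>\<infinity>e'\<in>{e}. LINT x:I e'|lebesgue. F (e', x) * cnj (?v e' x))"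
        by (rule infsum_cong_neutral) (use e in \<open>auto simp: set_lebesgue_integral_def\<close>)
      also have "\<dots> = (LINT x:I e|lebesgue. F (e, x) * of_real (bump n a b x))" by simp
      also have "\<dots> = (LINT x:J e|lebesgue. F (e, x) * of_real (bump n a b x))"
        unfolding set_lebesgue_integral_def
      proof (rule Bochner_Integration.integral_cong[OF HOL.refl])
        fix x
        show "indicator (I e) x *\<^sub>R (F (e, x) * of_real (bump n a b x)) = indicator (J e) x *\<^sub>R (F (e, x) * of_real (bump n a b x))"
        proof (cases "x \<in> J e")
          case True
          then have "x \<in> I e" using J_sub by blast
          then show ?thesis using True by simp
        next
          case False
          then have "x \<notin> {a<..<b}" using sub by (auto simp: subset_eq)
          then show ?thesis by (simp add: bump_outside)
        qed
      qed
      finally show "(LINT x:J e|lebesgue. F (e, x) * of_real (bump n a b x)) = 0" by simp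
    qed
    then show ?thesis using AE_J[of e] by eventually_elim auto
  qed
  then show ?thesis by (simp add: AE_M_iff)
qed

lemma Q_form_lincomb:
  assumes u: "u \<in> H1" and u': "u' \<in> H1" and v: "v \<in> H1"
  shows "Q_form G A V (\<lambda>e x. s * u e x + t * u' e x) v = s * Q_form G A V u v + t * Q_form G A V u' v"
proof -
  let ?w = "\<lambda>e x. s * u e x + t * u' e x"
  have w: "?w \<in> H1" by (rule H1_lincomb(1)[OF u u'])
  have lin: "(LINT z|M. (s * f z + t * f' z) * cnj (k z)) = s * (LINT z|M. f z * cnj (k z)) + t * (LINT z|M. f' z * cnj (k z))"
    if "square_integrable M f" "square_integrable M f'" "square_integrable M k" for f f' k
  proof -
    have "(LINT z|M. (s * f z + t * f' z) * cnj (k z)) = (LINT z|M. s * (f z * cnj (k z)) + t * (f' z * cnj (k z)))"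
      by (simp add: algebra_simps)
    also have "\<dots> = (LINT z|M. s * (f z * cnj (k z))) + (LINT z|M. t * (f' z * cnj (k z)))"
      using that by (intro Bochner_Integration.integral_add integrable_mult_right square_integrable_prod)
    finally show ?thesis by simp
  qed
  have D: "(LINT z|M. DA ?w z * cnj (DA v z)) = (LINT z|M. (s * DA u z + t * DA u' z) * cnj (DA v z))"
  proof (rule integral_cong_AE)
    show "AE z in M. DA ?w z * cnj (DA v z) = (s * DA u z + t * DA u' z) * cnj (DA v z)"
      using H1_lincomb(2)[OF u u', of s t] by eventually_elim simp
    show "(\<lambda>z. DA ?w z * cnj (DA v z)) \<in> borel_measurable M"
      "(\<lambda>z. (s * DA u z + t * DA u' z) * cnj (DA v z)) \<in> borel_measurable M"
      by (intro borel_measurable_integrable square_integrable_prod square_integrable_lincomb H1_D(4) u u' v w)+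
  qed
  have W: "W ?w = (\<lambda>z. s * W u z + t * W u' z)" by (auto simp: W_def algebra_simps)
  show ?thesis
    unfolding Q_form_eq[OF w v] Q_form_eq[OF u v] Q_form_eq[OF u' v] D W
      lin[OF H1_D(4)[OF u] H1_D(4)[OF u'] H1_D(4)[OF v]] lin[OF H1_D(5)[OF u] H1_D(5)[OF u'] H1_D(5)[OF v]]
    by (simp only: ring_distribs add_ac)
qed

lemma Q_form_hermitian:
  assumes u: "u \<in> H1" and v: "v \<in> H1" shows "Q_form G A V v u = cnj (Q_form G A V u v)"
proof -
  have h: "(LINT z|M. g z * cnj (f z)) = cnj (LINT z|M. f z * cnj (g z))"
    if "square_integrable M f" "square_integrable M g" for f g
    using pos_form.q_herm[OF square_integrable_form, of f M g] that by simp
  show ?thesis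
    by (simp only: Q_form_eq u v complex_cnj_add h[OF H1_D(4)[OF u] H1_D(4)[OF v]] h[OF H1_D(5)[OF u] H1_D(5)[OF v]])
qed

lemma Q_form_self:
  "u \<in> H1 \<Longrightarrow> Re (Q_form G A V u u) = sqnorm M (DA u) + sqnorm M (W u)"
  by (simp add: Q_form_eq ip_self)

definition D :: "('e, complex) fam set set" where "D = L2_class G ` H1"

text \<open>
  The form lives on families, while operators in \<open>L\<^sup>2\<close> act on classes. \<open>pick\<close> transfers the form; the choice
  is immaterial by \<open>Q_form_cong\<close>.
\<close>

definition pick :: "('e, complex) fam set \<Rightarrow> ('e, complex) fam" where
  "pick a = (SOME u. u \<in> H1 \<and> L2_class G u = a)"

definition q :: "('e, complex) fam set \<Rightarrow> ('e, complex) fam set \<Rightarrow> complex" where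
  "q a b = Q_form G A V (pick a) (pick b)"

lemma q_class:
  assumes u: "u \<in> H1" and v: "v \<in> H1" shows "q (L2_class G u) (L2_class G v) = Q_form G A V u v"
proof -
  have p: "pick (L2_class G u) \<in> H1" "AE z in M. fn (pick (L2_class G u)) z = fn u z" if "u \<in> H1" for u
  proof -
    have *: "pick (L2_class G u) \<in> H1 \<and> L2_class G (pick (L2_class G u)) = L2_class G u"
      unfolding pick_def using someI[of "\<lambda>w. w \<in> H1 \<and> L2_class G w = L2_class G u" u] that by blast
    then show "pick (L2_class G u) \<in> H1" by blast
    show "AE z in M. fn (pick (L2_class G u)) z = fn u z"
      using * by (intro cls_eqD H1_D(6)) (simp_all add: L2_class_eq_cls)
  qed
  show ?thesis unfolding q_def using p[OF u] p[OF v] u v by (intro Q_form_cong)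
qed

lemma D_sub: "D \<subseteq> vectors (L2 G)"
  using H1_D(6) by (auto simp: D_def vectors_L2 L2_class_eq_cls)

lemma class_add:
  "u \<in> H1 \<Longrightarrow> v \<in> H1 \<Longrightarrow> vadd (L2 G) (L2_class G u) (L2_class G v) = L2_class G (\<lambda>e x. 1 * u e x + 1 * v e x)"
  by (simp add: L2_class_eq_cls vadd_cls H1_D(6))

lemma class_scale:
  "u \<in> H1 \<Longrightarrow> vscale (L2 G) c (L2_class G u) = L2_class G (\<lambda>e x. c * u e x + 0 * u e x)"
  by (simp add: L2_class_eq_cls vscale_cls H1_D(6))

lemma q_form: "pos_form D (vadd (L2 G)) (vscale (L2 G)) q"
proof
  show "D \<noteq> {}" using zero_in_H1 by (auto simp: D_def)
next
  fix a b assume "a \<in> D" "b \<in> D"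
  then obtain u v where uv: "u \<in> H1" "v \<in> H1" and ab: "a = L2_class G u" "b = L2_class G v" by (auto simp: D_def)
  show "vadd (L2 G) a b \<in> D"
    unfolding ab class_add[OF uv] D_def by (intro imageI H1_lincomb(1) uv)
  show "q b a = cnj (q a b)" unfolding ab q_class[OF uv] q_class[OF uv(2,1)] by (rule Q_form_hermitian[OF uv])
  show "q (vscale (L2 G) c a) b = c * q a b" for c
    unfolding ab class_scale[OF uv(1)] q_class[OF H1_lincomb(1)[OF uv(1) uv(1)] uv(2)]
      Q_form_lincomb[OF uv(1) uv(1) uv(2)] q_class[OF uv] by simp
  fix c assume "c \<in> D"
  then obtain w where w: "w \<in> H1" "c = L2_class G w" by (auto simp: D_def)
  show "q (vadd (L2 G) a b) c = q a c + q b c"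
    unfolding ab w(2) class_add[OF uv] q_class[OF H1_lincomb(1)[OF uv] w(1)]
      Q_form_lincomb[OF uv w(1)] q_class[OF uv(1) w(1)] q_class[OF uv(2) w(1)] by simp
next
  fix a c assume "a \<in> D"
  then obtain u where u: "u \<in> H1" and a: "a = L2_class G u" by (auto simp: D_def)
  show "vscale (L2 G) c a \<in> D"
    unfolding a class_scale[OF u] D_def by (intro imageI H1_lincomb(1) u)
  show "0 \<le> Re (q a a)" unfolding a using u by (simp add: q_class Q_form_self Bochner_Integration.integral_nonneg)
qed

interpretation q: pos_form D "vadd (L2 G)" "vscale (L2 G)" q by (rule q_form)

lemma q_diff_self:
  assumes u: "u \<in> H1" and v: "v \<in> H1"
  shows "Re (q (q.diff (L2_class G u) (L2_class G v)) (q.diff (L2_class G u) (L2_class G v)))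
       = sqdist M (DA u) (DA v) + sqdist M (W u) (W v)"
proof -
  let ?w = "\<lambda>e x. 1 * u e x + (-1) * v e x"
  have w: "?w \<in> H1" by (rule H1_lincomb(1)[OF u v])
  have "q.diff (L2_class G u) (L2_class G v) = L2_class G ?w"
    using H1_D(6)[OF u] H1_D(6)[OF v] square_integrable_mult[OF H1_D(6)[OF v], of "-1"]
    by (simp add: q.diff_def L2_class_eq_cls vscale_cls vadd_cls)
  moreover have "Re (q (L2_class G ?w) (L2_class G ?w)) = sqnorm M (DA ?w) + sqnorm M (W ?w)"
    by (simp only: q_class[OF w w] Q_form_self[OF w])
  moreover have "W ?w = (\<lambda>z. W u z - W v z)" by (auto simp: W_def algebra_simps)
  moreover have "sqnorm M (DA ?w) = sqdist M (DA u) (DA v)"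
  proof (rule integral_cong_AE)
    show "AE z in M. (cmod (DA ?w z))\<^sup>2 = (cmod (DA u z - DA v z))\<^sup>2"
      using H1_lincomb(2)[OF u v, of 1 "-1"] by eventually_elim simp
  qed (use H1_D(4)[OF w] square_integrable_diff[OF H1_D(4)[OF u] H1_D(4)[OF v]]
        in \<open>auto simp: square_integrable_def intro: borel_measurable_integrable\<close>)
  ultimately show ?thesis by simp
qed

lemma q_complete: "q.complete_form"
  unfolding q.complete_form_def
proof (intro allI impI)
  fix s :: "nat \<Rightarrow> _" assume s: "\<forall>n. s n \<in> D"
    and C: "\<forall>\<epsilon>>0. \<exists>N. \<forall>m\<ge>N. \<forall>n\<ge>N. Re (q (q.diff (s m) (s n)) (q.diff (s m) (s n))) < \<epsilon>"
  have "\<forall>n. \<exists>u. u \<in> H1 \<and> s n = L2_class G u" using s by (auto simp: D_def)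
  then obtain u where u: "\<And>n. u n \<in> H1" and su: "\<And>n. s n = L2_class G (u n)" by metis
  have nn: "0 \<le> sqnorm M f" for f :: "'e \<times> real \<Rightarrow> complex" by (simp add: Bochner_Integration.integral_nonneg)
  have C': "\<exists>N. \<forall>m\<ge>N. \<forall>n\<ge>N. sqdist M (DA (u m)) (DA (u n)) < \<epsilon> \<and> sqdist M (W (u m)) (W (u n)) < \<epsilon>"
    if "0 < \<epsilon>" for \<epsilon>
  proof -
    have "\<exists>N. \<forall>m\<ge>N. \<forall>n\<ge>N.
        (sqdist M (DA (u m)) (DA (u n))) + sqdist M (W (u m)) (W (u n)) < \<epsilon>"
      using C[rule_format, OF that] unfolding su q_diff_self[OF u u] .
    then obtain N where N: "\<And>m n. N \<le> m \<Longrightarrow> N \<le> n \<Longrightarrow>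
        (sqdist M (DA (u m)) (DA (u n))) + sqdist M (W (u m)) (W (u n)) < \<epsilon>"
      by blast
    show ?thesis
    proof (intro exI[of _ N] allI impI conjI)
      fix m n assume "N \<le> m" "N \<le> n"
      then show "sqdist M (DA (u m)) (DA (u n)) < \<epsilon>" "sqdist M (W (u m)) (W (u n)) < \<epsilon>"
        using N[of m n] nn[of "\<lambda>z. DA (u m) z - DA (u n) z"] nn[of "\<lambda>z. W (u m) z - W (u n) z"] by linarith+
    qed
  qed
  have "L2_Cauchy M (\<lambda>n. DA (u n))" "L2_Cauchy M (\<lambda>n. W (u n))"
    unfolding L2_Cauchy_def using C' H1_D(4,5)[OF u] by meson+
  then obtain U where U: "U \<in> H1" "(\<lambda>n. sqdist M (DA (u n)) (DA U)) \<longlonglongrightarrow> 0"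
    "(\<lambda>n. sqdist M (W (u n)) (W U)) \<longlonglongrightarrow> 0"
    using H1_complete[of u] u by blast
  show "\<exists>x\<in>D. (\<lambda>n. Re (q (q.diff (s n) x) (q.diff (s n) x))) \<longlonglongrightarrow> 0"
  proof (rule bexI[of _ "L2_class G U"])
    show "L2_class G U \<in> D" using U(1) by (simp add: D_def)
    show "(\<lambda>n. Re (q (q.diff (s n) (L2_class G U)) (q.diff (s n) (L2_class G U)))) \<longlonglongrightarrow> 0"
      unfolding su q_diff_self[OF u U(1)] using tendsto_add[OF U(2,3)] by simp
  qed
qed

lemma q_ge: "a \<in> D \<Longrightarrow> Re (vinner (L2 G) a a) \<le> Re (q a a)"
proof -
  assume "a \<in> D"
  then obtain u where u: "u \<in> H1" and a: "a = L2_class G u" by (auto simp: D_def)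
  have "Re (vinner (L2 G) a a) = sqnorm M (fn u)"
    using H1_D(6)[OF u] by (simp add: a L2_class_eq_cls vinner_cls ip_self)
  also have "\<dots> \<le> sqnorm M (W u)" by (rule H1_D(8)[OF u])
  also have "\<dots> \<le> Re (q a a)" unfolding a using u by (simp add: q_class Q_form_self Bochner_Integration.integral_nonneg)
  finally show ?thesis .
qed

lemma D_perp:
  assumes a: "a \<in> vectors (L2 G)" and orth: "\<And>v. v \<in> D \<Longrightarrow> vinner (L2 G) a v = 0"
  shows "vinner (L2 G) a a = 0"
proof -
  obtain F where F: "square_integrable M F" "a = cls F" using a by (auto simp: vectors_L2)
  have "(LINT z|M. F z * cnj (fn v z)) = 0" if v: "v \<in> H1" for v
    using orth[of "L2_class G v"] v vinner_cls[OF F(1) H1_D(6)[OF v]] by (simp add: D_def F(2) L2_class_eq_cls)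
  then have "AE z in M. F z = 0" by (rule orthogonal_to_H1_imp_zero[OF F(1)])
  then have "(LINT z|M. F z * cnj (F z)) = 0" by (intro integral_eq_zero_AE) auto
  then show ?thesis using F by (simp add: vinner_cls)
qed

lemma unique_operator:
  "\<exists>!T. self_adjoint (L2 G) T \<and> dom T \<subseteq> L2_class G ` H1 \<and>
        (\<forall>u\<in>H1. \<forall>v\<in>H1. L2_class G u \<in> dom T \<longrightarrow>
           Q_form G A V u v = vinner (L2 G) (the (T (L2_class G u))) (L2_class G v))"
proof -
  have "\<exists>!T. self_adjoint (L2 G) T \<and> dom T \<subseteq> D \<and> (\<forall>u\<in>dom T. \<forall>v\<in>D. q u v = vinner (L2 G) (the (T u)) v)"
    by (rule form_representation[OF L2_form L2_complete L2_definite q_form q_complete D_sub q_ge D_perp])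
  moreover have "self_adjoint (L2 G) T \<and> dom T \<subseteq> D \<and> (\<forall>a\<in>dom T. \<forall>b\<in>D. q a b = vinner (L2 G) (the (T a)) b) \<longleftrightarrow>
      self_adjoint (L2 G) T \<and> dom T \<subseteq> L2_class G ` H1 \<and>
      (\<forall>u\<in>H1. \<forall>v\<in>H1. L2_class G u \<in> dom T \<longrightarrow>
         Q_form G A V u v = vinner (L2 G) (the (T (L2_class G u))) (L2_class G v))" for T
  proof (cases "dom T \<subseteq> D")
    case True
    have "(\<forall>a\<in>dom T. \<forall>b\<in>D. q a b = vinner (L2 G) (the (T a)) b) \<longleftrightarrow>
      (\<forall>u\<in>H1. \<forall>v\<in>H1. L2_class G u \<in> dom T \<longrightarrow>
         Q_form G A V u v = vinner (L2 G) (the (T (L2_class G u))) (L2_class G v))" (is "?L \<longleftrightarrow> ?R")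
    proof
      assume L: ?L
      show ?R
      proof (intro ballI impI)
        fix u v assume uv: "u \<in> H1" "v \<in> H1" "L2_class G u \<in> dom T"
        then have "L2_class G v \<in> D" by (simp add: D_def)
        then show "Q_form G A V u v = vinner (L2 G) (the (T (L2_class G u))) (L2_class G v)"
          using L uv(3) q_class[OF uv(1,2)] by simp
      qed
    next
      assume R: ?R
      show ?L
      proof (intro ballI)
        fix a b assume a: "a \<in> dom T" and b: "b \<in> D"
        obtain u where u: "u \<in> H1" "a = L2_class G u" using a True by (auto simp: D_def)
        obtain v where v: "v \<in> H1" "b = L2_class G v" using b by (auto simp: D_def)
        show "q a b = vinner (L2 G) (the (T a)) b"
          using R u v a q_class[OF u(1) v(1)] by simp
      qed
    qed
    then show ?thesis by (simp only: D_def)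
  next
    case False
    then show ?thesis by (simp add: D_def)
  qed
  ultimately show ?thesis by (simp only:)
qed

end

theorem theorem2p3:
  fixes G :: "('v, 'e) metric_graph" and A V :: "('e, real) fam"
  assumes "metric_graph G" and "connected_graph G" and "locally_finite_graph G"
    and "\<And>e x. e \<in> edges G \<Longrightarrow> x \<in> edge_interval G e \<Longrightarrow> 1 \<le> V e x"
    and "L2_loc G A" and "L1_loc G V"
  shows "\<exists>!T. self_adjoint (L2 G) T \<and>
              dom T \<subseteq> L2_class G ` H1_mag G A V \<and>
              (\<forall>u\<in>H1_mag G A V. \<forall>v\<in>H1_mag G A V. L2_class G u \<in> dom T \<longrightarrow>
                 Q_form G A V u v = vinner (L2 G) (the (T (L2_class G u))) (L2_class G v))"
proof -
  interpret magnetic G A V by unfold_locales (fact assms)+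
  show ?thesis by (rule unique_operator)
qed

end
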